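(* Let $\mathcal{A}=D(a,\sigma)$ be a generalized Weyl algebra of degree $\alpha$ (a finite or infinite ordinal) with base ring $D$. Let $S$ be a multiplicatively closed subset of the center $Z(D)$ consisting of regular elements of $D$ and which is $\sigma$-stable, i.e. $\sigma_\beta^j(S)\subset S$ for all $\beta<\alpha$, $j\in\mathbb{Z}$. Let $\mathfrak{A}=D_S(a,\sigma)$, where $D_S$ is the localization of $D$ at $S$ and each $\sigma_\beta$ is extended to an automorphism of $D_S$ in the natural way. Then $S$ is a left and right denominator set in $\mathcal{A}$ and $\mathcal{A}_S\simeq\mathfrak{A}$.
   Context: Rings are $\mathsf{k}$-algebras over an arbitrary field $\mathsf{k}$ (not necessarily commutative). Generalized Weyl algebra (GWA): let $D$ be a ring, $\alpha$ an ordinal, $\sigma=\langle\sigma_\beta\rangle_{\beta<\alpha}$ commuting automorphisms of $D$, and $a=\langle a_\beta\rangle_{\beta<\alpha}$ nonzero elements of the center of $D$ with $\sigma_\beta(a_\gamma)=a_\gamma$ for $\gamma\neq\beta$. The GWA $D(a,\sigma)$ of degree $\alpha$ and base ring $D$ is generated over $D$ by $X_\beta^+,X_\beta^-$ ($\beta<\alpha$) with relations $X_\beta^{+}d=\sigma_\beta(d)X_\beta^{+}$, $X_\beta^{-}d=\sigma_\beta^{-1}(d)X_\beta^{-}$ for $d\in D$; $[X_\beta^+,X_\gamma^+]=[X_\beta^-,X_\gamma^-]=[X_\beta^+,X_\gamma^-]=0$ for $\beta\neq\gamma$; $X_\beta^-X_\beta^+=a_\beta$, $X_\beta^+X_\beta^-=\sigma_\beta(a_\beta)$.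 *)

theory Defs
  imports "HOL-Algebra.Module" "HOL-Algebra.QuotRing"
begin

text \<open>
  All algebras are unital and associative but not necessarily commutative; the locale
  \<open>algebra\<close> of HOL-Algebra requires commutativity.
\<close>

locale k_algebra = field K + module K A + A: ring A
  for K :: "('k, 'm) ring_scheme" (structure) and A :: "('k, 'a, 'p) module_scheme" (structure) +
  assumes smult_mult_left:
      "\<lbrakk>c \<in> carrier K; x \<in> carrier A; y \<in> carrier A\<rbrakk> \<Longrightarrow>
        (c \<odot>\<^bsub>A\<^esub> x) \<otimes>\<^bsub>A\<^esub> y = c \<odot>\<^bsub>A\<^esub> (x \<otimes>\<^bsub>A\<^esub> y)"
    and smult_mult_right:
      "\<lbrakk>c \<in> carrier K; x \<in> carrier A; y \<in> carrier A\<rbrakk> \<Longrightarrow>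
        x \<otimes>\<^bsub>A\<^esub> (c \<odot>\<^bsub>A\<^esub> y) = c \<odot>\<^bsub>A\<^esub> (x \<otimes>\<^bsub>A\<^esub> y)"

definition k_algebra_iso ::
    "('k, 'm) ring_scheme \<Rightarrow> ('k, 'a, 'p) module_scheme \<Rightarrow> ('k, 'b, 'q) module_scheme \<Rightarrow> ('a \<Rightarrow> 'b) set"
  where "k_algebra_iso K A B =
    {h \<in> ring_iso A B. \<forall>c \<in> carrier K. \<forall>x \<in> carrier A. h (c \<odot>\<^bsub>A\<^esub> x) = c \<odot>\<^bsub>B\<^esub> h x}"

definition ring_center :: "('a, 'p) ring_scheme \<Rightarrow> 'a set"
  where "ring_center R =
    {z \<in> carrier R. \<forall>x \<in> carrier R. z \<otimes>\<^bsub>R\<^esub> x = x \<otimes>\<^bsub>R\<^esub> z}"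

definition regular_element :: "('a, 'p) ring_scheme \<Rightarrow> 'a \<Rightarrow> bool"
  where "regular_element R s \<longleftrightarrow> s \<in> carrier R \<and>
    (\<forall>x \<in> carrier R. s \<otimes>\<^bsub>R\<^esub> x = \<zero>\<^bsub>R\<^esub> \<longrightarrow> x = \<zero>\<^bsub>R\<^esub>) \<and>
    (\<forall>x \<in> carrier R. x \<otimes>\<^bsub>R\<^esub> s = \<zero>\<^bsub>R\<^esub> \<longrightarrow> x = \<zero>\<^bsub>R\<^esub>)"


section \<open>Generalized Weyl algebras\<close>

text \<open>
  The free associative \<open>K\<close>-algebra on \<open>G\<close>: finitely supported functions on the words over \<open>G\<close>,
  multiplied by convolution along concatenation.
\<close>

definition free_algebra ::
    "('k, 'm) ring_scheme \<Rightarrow> 'g set \<Rightarrow> ('k, 'g list \<Rightarrow> 'k) module"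
  where "free_algebra K G = \<lparr>
    carrier = {f. (\<forall>w. f w \<in> carrier K) \<and> (\<forall>w. w \<notin> lists G \<longrightarrow> f w = \<zero>\<^bsub>K\<^esub>) \<and>
                  finite {w. f w \<noteq> \<zero>\<^bsub>K\<^esub>}},
    mult = (\<lambda>f g w. \<Oplus>\<^bsub>K\<^esub>p\<in>{(u, v). u @ v = w}. f (fst p) \<otimes>\<^bsub>K\<^esub> g (snd p)),
    one = (\<lambda>w. if w = [] then \<one>\<^bsub>K\<^esub> else \<zero>\<^bsub>K\<^esub>),
    zero = (\<lambda>w. \<zero>\<^bsub>K\<^esub>),
    add = (\<lambda>f g w. f w \<oplus>\<^bsub>K\<^esub> g w),
    smult = (\<lambda>c f w. c \<otimes>\<^bsub>K\<^esub> f w)\<rparr>"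

definition free_gen :: "('k, 'm) ring_scheme \<Rightarrow> 'g \<Rightarrow> 'g list \<Rightarrow> 'k"
  where "free_gen K g = (\<lambda>w. if w = [g] then \<one>\<^bsub>K\<^esub> else \<zero>\<^bsub>K\<^esub>)"

definition algebra_quot :: "('k, 'a, 'p) module_scheme \<Rightarrow> 'a set \<Rightarrow> ('k, 'a set) module"
  where "algebra_quot A I =
    ring.extend (A Quot I) \<lparr>smult = (\<lambda>c P. \<Union>x\<in>P. I +>\<^bsub>A\<^esub> (c \<odot>\<^bsub>A\<^esub> x))\<rparr>"

text \<open>
  An ordinal is given by a well-order relation \<open>\<alpha>\<close>; the indices \<open>\<beta> < \<alpha>\<close> are the elements
  of \<open>Field \<alpha>\<close>.
\<close>

locale gwa_data = k_algebra K D
  for K :: "('k, 'm) ring_scheme" (structure) and D :: "('k, 'd, 'p) module_scheme" (structure) +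
  fixes \<alpha> :: "'i rel" and \<sigma> :: "'i \<Rightarrow> 'd \<Rightarrow> 'd" and a :: "'i \<Rightarrow> 'd"
  assumes ordinal: "Well_order \<alpha>"
    and automorphism: "\<beta> \<in> Field \<alpha> \<Longrightarrow> \<sigma> \<beta> \<in> k_algebra_iso K D D"
    and commuting: "\<lbrakk>\<beta> \<in> Field \<alpha>; \<gamma> \<in> Field \<alpha>; d \<in> carrier D\<rbrakk> \<Longrightarrow>
      \<sigma> \<beta> (\<sigma> \<gamma> d) = \<sigma> \<gamma> (\<sigma> \<beta> d)"
    and central: "\<beta> \<in> Field \<alpha> \<Longrightarrow> a \<beta> \<in> ring_center D"
    and nonzero: "\<beta> \<in> Field \<alpha> \<Longrightarrow> a \<beta> \<noteq> \<zero>\<^bsub>D\<^esub>"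
    and fixed: "\<lbrakk>\<beta> \<in> Field \<alpha>; \<gamma> \<in> Field \<alpha>; \<gamma> \<noteq> \<beta>\<rbrakk> \<Longrightarrow> \<sigma> \<beta> (a \<gamma>) = a \<gamma>"

datatype ('d, 'i) gwa_gen = Base 'd | Xplus 'i | Xminus 'i

definition gwa_gens :: "('k, 'd, 'p) module_scheme \<Rightarrow> 'i rel \<Rightarrow> ('d, 'i) gwa_gen set"
  where "gwa_gens D \<alpha> = Base ` carrier D \<union> Xplus ` Field \<alpha> \<union> Xminus ` Field \<alpha>"

text \<open>
  A pair \<open>(p, q)\<close> stands for the relation \<open>p = q\<close>. The first four families say that
  \<open>Base\<close> is a homomorphism of \<open>K\<close>-algebras from \<open>D\<close>, so that the quotient is generated over \<open>D\<close>
  by the \<open>Xplus \<beta>\<close> and \<open>Xminus \<beta>\<close>.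
\<close>

definition gwa_relations ::
    "('k, 'm) ring_scheme \<Rightarrow> ('k, 'd, 'p) module_scheme \<Rightarrow> 'i rel \<Rightarrow> ('i \<Rightarrow> 'd \<Rightarrow> 'd) \<Rightarrow> ('i \<Rightarrow> 'd) \<Rightarrow>
      ((('d, 'i) gwa_gen list \<Rightarrow> 'k) \<times> (('d, 'i) gwa_gen list \<Rightarrow> 'k)) set"
  where "gwa_relations K D \<alpha> \<sigma> a =
    (let F = free_algebra K (gwa_gens D \<alpha>);
         B = (\<lambda>d. free_gen K (Base d));
         X = (\<lambda>\<beta>. free_gen K (Xplus \<beta>));
         Y = (\<lambda>\<beta>. free_gen K (Xminus \<beta>));
         \<sigma>' = (\<lambda>\<beta>. inv_into (carrier D) (\<sigma> \<beta>))
     in {(B (d \<oplus>\<^bsub>D\<^esub> e), B d \<oplus>\<^bsub>F\<^esub> B e) | d e. d \<in> carrier D \<and> e \<in> carrier D}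
      \<union> {(B (d \<otimes>\<^bsub>D\<^esub> e), B d \<otimes>\<^bsub>F\<^esub> B e) | d e. d \<in> carrier D \<and> e \<in> carrier D}
      \<union> {(B \<one>\<^bsub>D\<^esub>, \<one>\<^bsub>F\<^esub>)}
      \<union> {(B (c \<odot>\<^bsub>D\<^esub> d), c \<odot>\<^bsub>F\<^esub> B d) | c d. c \<in> carrier K \<and> d \<in> carrier D}
      \<union> {(X \<beta> \<otimes>\<^bsub>F\<^esub> B d, B (\<sigma> \<beta> d) \<otimes>\<^bsub>F\<^esub> X \<beta>) | \<beta> d. \<beta> \<in> Field \<alpha> \<and> d \<in> carrier D}
      \<union> {(Y \<beta> \<otimes>\<^bsub>F\<^esub> B d, B (\<sigma>' \<beta> d) \<otimes>\<^bsub>F\<^esub> Y \<beta>) | \<beta> d. \<beta> \<in> Field \<alpha> \<and> d \<in> carrier D}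
      \<union> {(X \<beta> \<otimes>\<^bsub>F\<^esub> X \<gamma>, X \<gamma> \<otimes>\<^bsub>F\<^esub> X \<beta>) | \<beta> \<gamma>. \<beta> \<in> Field \<alpha> \<and> \<gamma> \<in> Field \<alpha> \<and> \<beta> \<noteq> \<gamma>}
      \<union> {(Y \<beta> \<otimes>\<^bsub>F\<^esub> Y \<gamma>, Y \<gamma> \<otimes>\<^bsub>F\<^esub> Y \<beta>) | \<beta> \<gamma>. \<beta> \<in> Field \<alpha> \<and> \<gamma> \<in> Field \<alpha> \<and> \<beta> \<noteq> \<gamma>}
      \<union> {(X \<beta> \<otimes>\<^bsub>F\<^esub> Y \<gamma>, Y \<gamma> \<otimes>\<^bsub>F\<^esub> X \<beta>) | \<beta> \<gamma>. \<beta> \<in> Field \<alpha> \<and> \<gamma> \<in> Field \<alpha> \<and> \<beta> \<noteq> \<gamma>}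
      \<union> {(Y \<beta> \<otimes>\<^bsub>F\<^esub> X \<beta>, B (a \<beta>)) | \<beta>. \<beta> \<in> Field \<alpha>}
      \<union> {(X \<beta> \<otimes>\<^bsub>F\<^esub> Y \<beta>, B (\<sigma> \<beta> (a \<beta>))) | \<beta>. \<beta> \<in> Field \<alpha>})"

definition gwa_ideal ::
    "('k, 'm) ring_scheme \<Rightarrow> ('k, 'd, 'p) module_scheme \<Rightarrow> 'i rel \<Rightarrow> ('i \<Rightarrow> 'd \<Rightarrow> 'd) \<Rightarrow> ('i \<Rightarrow> 'd) \<Rightarrow>
      (('d, 'i) gwa_gen list \<Rightarrow> 'k) set"
  where "gwa_ideal K D \<alpha> \<sigma> a =
    (let F = free_algebra K (gwa_gens D \<alpha>)
     in Idl\<^bsub>F\<^esub> {p \<ominus>\<^bsub>F\<^esub> q | p q. (p, q) \<in> gwa_relations K D \<alpha> \<sigma> a})"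

definition gwa ::
    "('k, 'm) ring_scheme \<Rightarrow> ('k, 'd, 'p) module_scheme \<Rightarrow> 'i rel \<Rightarrow> ('i \<Rightarrow> 'd \<Rightarrow> 'd) \<Rightarrow> ('i \<Rightarrow> 'd) \<Rightarrow>
      ('k, (('d, 'i) gwa_gen list \<Rightarrow> 'k) set) module"
  where "gwa K D \<alpha> \<sigma> a =
    algebra_quot (free_algebra K (gwa_gens D \<alpha>)) (gwa_ideal K D \<alpha> \<sigma> a)"

text \<open>The canonical homomorphism from the base ring; it is what lets one regard subsets of \<open>D\<close>
  as subsets of the generalized Weyl algebra.\<close>

definition gwa_base ::
    "('k, 'm) ring_scheme \<Rightarrow> ('k, 'd, 'p) module_scheme \<Rightarrow> 'i rel \<Rightarrow> ('i \<Rightarrow> 'd \<Rightarrow> 'd) \<Rightarrow> ('i \<Rightarrow> 'd) \<Rightarrow>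
      'd \<Rightarrow> (('d, 'i) gwa_gen list \<Rightarrow> 'k) set"
  where "gwa_base K D \<alpha> \<sigma> a d =
    gwa_ideal K D \<alpha> \<sigma> a +>\<^bsub>free_algebra K (gwa_gens D \<alpha>)\<^esub> free_gen K (Base d)"


section \<open>Denominator sets and localization\<close>

definition left_denominator_set :: "('a, 'p) ring_scheme \<Rightarrow> 'a set \<Rightarrow> bool"
  where "left_denominator_set R S \<longleftrightarrow> submonoid S R \<and>
    (\<forall>r \<in> carrier R. \<forall>s \<in> S. \<exists>r' \<in> carrier R. \<exists>s' \<in> S. s' \<otimes>\<^bsub>R\<^esub> r = r' \<otimes>\<^bsub>R\<^esub> s) \<and>
    (\<forall>r \<in> carrier R. \<forall>s \<in> S. r \<otimes>\<^bsub>R\<^esub> s = \<zero>\<^bsub>R\<^esub> \<longrightarrow> (\<exists>s' \<in> S. s' \<otimes>\<^bsub>R\<^esub> r = \<zero>\<^bsub>R\<^esub>))"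

definition right_denominator_set :: "('a, 'p) ring_scheme \<Rightarrow> 'a set \<Rightarrow> bool"
  where "right_denominator_set R S \<longleftrightarrow> submonoid S R \<and>
    (\<forall>r \<in> carrier R. \<forall>s \<in> S. \<exists>r' \<in> carrier R. \<exists>s' \<in> S. r \<otimes>\<^bsub>R\<^esub> s' = s \<otimes>\<^bsub>R\<^esub> r') \<and>
    (\<forall>r \<in> carrier R. \<forall>s \<in> S. s \<otimes>\<^bsub>R\<^esub> r = \<zero>\<^bsub>R\<^esub> \<longrightarrow> (\<exists>s' \<in> S. r \<otimes>\<^bsub>R\<^esub> s' = \<zero>\<^bsub>R\<^esub>))"

text \<open>
  The Ore localization of \<open>R\<close> at a left denominator set \<open>S\<close>: \<open>left_frac R S s r\<close> is the class
  of the pair \<open>(s, r)\<close>, i.e. the fraction \<open>s\<^sup>-\<^sup>1 r\<close>. For \<open>S\<close> contained in the center it is the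
  usual ring of fractions. In the sum, \<open>c s = d t\<close> is a common denominator; in the product,
  \<open>u r = c t\<close> gives \<open>r t\<^sup>-\<^sup>1 = u\<^sup>-\<^sup>1 c\<close>. The operations do not depend on the choices, so
  the union over all of them is a single class.
\<close>

definition left_frac :: "('a, 'p) ring_scheme \<Rightarrow> 'a set \<Rightarrow> 'a \<Rightarrow> 'a \<Rightarrow> ('a \<times> 'a) set"
  where "left_frac R S s r = {(t, q). t \<in> S \<and> q \<in> carrier R \<and>
    (\<exists>c \<in> carrier R. \<exists>d \<in> carrier R.
      c \<otimes>\<^bsub>R\<^esub> s = d \<otimes>\<^bsub>R\<^esub> t \<and> c \<otimes>\<^bsub>R\<^esub> s \<in> S \<and> c \<otimes>\<^bsub>R\<^esub> r = d \<otimes>\<^bsub>R\<^esub> q)}"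

definition localization :: "('k, 'a, 'p) module_scheme \<Rightarrow> 'a set \<Rightarrow> ('k, ('a \<times> 'a) set) module"
  where "localization R S = \<lparr>
    carrier = {left_frac R S s r | s r. s \<in> S \<and> r \<in> carrier R},
    mult = (\<lambda>P Q. \<Union>{left_frac R S (u \<otimes>\<^bsub>R\<^esub> s) (c \<otimes>\<^bsub>R\<^esub> q) | s r t q u c.
      (s, r) \<in> P \<and> (t, q) \<in> Q \<and> u \<in> S \<and> c \<in> carrier R \<and> u \<otimes>\<^bsub>R\<^esub> r = c \<otimes>\<^bsub>R\<^esub> t}),
    one = left_frac R S \<one>\<^bsub>R\<^esub> \<one>\<^bsub>R\<^esub>,
    zero = left_frac R S \<one>\<^bsub>R\<^esub> \<zero>\<^bsub>R\<^esub>,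
    add = (\<lambda>P Q. \<Union>{left_frac R S (c \<otimes>\<^bsub>R\<^esub> s) (c \<otimes>\<^bsub>R\<^esub> r \<oplus>\<^bsub>R\<^esub> d \<otimes>\<^bsub>R\<^esub> q) | s r t q c d.
      (s, r) \<in> P \<and> (t, q) \<in> Q \<and> c \<in> carrier R \<and> d \<in> carrier R \<and>
      c \<otimes>\<^bsub>R\<^esub> s = d \<otimes>\<^bsub>R\<^esub> t \<and> c \<otimes>\<^bsub>R\<^esub> s \<in> S}),
    smult = (\<lambda>k P. \<Union>{left_frac R S s (k \<odot>\<^bsub>R\<^esub> r) | s r. (s, r) \<in> P})\<rparr>"

definition loc_embed :: "('a, 'p) ring_scheme \<Rightarrow> 'a set \<Rightarrow> 'a \<Rightarrow> ('a \<times> 'a) set"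
  where "loc_embed R S r = left_frac R S \<one>\<^bsub>R\<^esub> r"

text \<open>The extension \<open>s\<^sup>-\<^sup>1 r \<mapsto> f(s)\<^sup>-\<^sup>1 f(r)\<close> of an automorphism \<open>f\<close> with \<open>f(S) \<subseteq> S\<close>.\<close>

definition loc_map ::
    "('a, 'p) ring_scheme \<Rightarrow> 'a set \<Rightarrow> ('a \<Rightarrow> 'a) \<Rightarrow> ('a \<times> 'a) set \<Rightarrow> ('a \<times> 'a) set"
  where "loc_map R S f P = \<Union>{left_frac R S (f s) (f r) | s r. (s, r) \<in> P}"

definition aut_pow :: "('a, 'p) ring_scheme \<Rightarrow> ('a \<Rightarrow> 'a) \<Rightarrow> int \<Rightarrow> 'a \<Rightarrow> 'a"
  where "aut_pow R f j =
    (if 0 \<le> j then f ^^ nat j else inv_into (carrier R) f ^^ nat (- j))"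

end

theory Submission
  imports Defs
begin

text \<open>
  Let \<open>\<phi>\<close> be the map from the generalized Weyl algebra over \<open>D\<close> to the one over \<open>D\<^sub>S\<close> given by the
  presentations. Once the left Ore condition is known, the localization is recognized from three
  properties of \<open>\<phi>\<close>: it inverts \<open>S\<close>, every element of the target is a left fraction of values of
  \<open>\<phi>\<close>, and every element of its kernel is killed by some \<open>s \<in> S\<close> on the left. The Ore conditions
  and the second property are checked on generators. For the third, the target acts on the module
  \<open>S\<^sup>-\<^sup>1 \<A>\<close>, and \<open>\<phi>(r)\<close> maps \<open>1\<close> to the class of \<open>r\<close>, so no basis of \<open>\<A>\<close> over \<open>D\<close> is needed.
  It also gives left reversibility. Right reversibility follows from a grading: the relators are
  homogeneous for the grading of words by the automorphism of \<open>D\<close> they induce, and a homogeneous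
  element commutes with \<open>S\<close> up to that automorphism.
\<close>


text \<open>Both algebras are given only by generators and relations, so regularity of
  \<open>s \<in> S\<close> in \<open>D\<close> says nothing directly about multiplication by
  \<open>s\<close> in \<A>, and torsion has to be allowed for in the constructions over \<A>.
  Regularity enters through the cross-multiplication criterion for equality of fractions over
  \<open>D\<close>. A presented algebra is easy to map out of, but equality in it is hard to refute:
  this takes a module on which it acts, and such an action is obtained by checking the defining
  relations on operators. The module \<open>S\<^sup>-\<^sup>1 \<A>\<close> is formed by inverting
  the commuting left multiplications by \<open>S\<close>. Left reversibility then follows at once,
  since \<open>r s = 0\<close> gives
  \<open>\<phi>(r) = \<phi>(r s) \<phi>(s)\<^sup>-\<^sup>1 = 0\<close>. The other side is not
  symmetric: from \<open>s r = 0\<close> one again gets only some \<open>s' r = 0\<close> with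
  \<open>s'\<close> on the left. The grading resolves this by moving \<open>s\<close> through each
  homogeneous component of \<open>r\<close> to the right.\<close>

lemma (in abelian_group) minus_eq_zeroD:
  "\<lbrakk>x \<in> carrier G; y \<in> carrier G; x \<ominus> y = \<zero>\<rbrakk> \<Longrightarrow> x = y"
  by (metis a_minus_def minus_equality minus_minus a_inv_closed)

definition k_algebra_hom ::
    "('k, 'm) ring_scheme \<Rightarrow> ('k, 'a, 'p) module_scheme \<Rightarrow> ('k, 'b, 'q) module_scheme \<Rightarrow> ('a \<Rightarrow> 'b) set"
  where "k_algebra_hom K A B =
    {h \<in> ring_hom A B. \<forall>c \<in> carrier K. \<forall>x \<in> carrier A. h (c \<odot>\<^bsub>A\<^esub> x) = c \<odot>\<^bsub>B\<^esub> h x}"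

lemma k_algebra_homD:
  assumes "h \<in> k_algebra_hom K A B"
  shows "x \<in> carrier A \<Longrightarrow> h x \<in> carrier B"
    and "\<lbrakk>x \<in> carrier A; y \<in> carrier A\<rbrakk> \<Longrightarrow> h (x \<oplus>\<^bsub>A\<^esub> y) = h x \<oplus>\<^bsub>B\<^esub> h y"
    and "\<lbrakk>x \<in> carrier A; y \<in> carrier A\<rbrakk> \<Longrightarrow> h (x \<otimes>\<^bsub>A\<^esub> y) = h x \<otimes>\<^bsub>B\<^esub> h y"
    and "h \<one>\<^bsub>A\<^esub> = \<one>\<^bsub>B\<^esub>"
    and "\<lbrakk>c \<in> carrier K; x \<in> carrier A\<rbrakk> \<Longrightarrow> h (c \<odot>\<^bsub>A\<^esub> x) = c \<odot>\<^bsub>B\<^esub> h x"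
  using assms by (auto simp: k_algebra_hom_def ring_hom_def)

lemma k_algebra_hom_minus:
  assumes "k_algebra K A" "k_algebra K B" "h \<in> k_algebra_hom K A B"
  shows "h \<zero>\<^bsub>A\<^esub> = \<zero>\<^bsub>B\<^esub>"
    and "\<lbrakk>x \<in> carrier A; y \<in> carrier A\<rbrakk> \<Longrightarrow> h (x \<ominus>\<^bsub>A\<^esub> y) = h x \<ominus>\<^bsub>B\<^esub> h y"
proof -
  interpret A: k_algebra K A by fact
  interpret B: k_algebra K B by fact
  interpret ring_hom_ring A B h
    using assms(3) by (intro ring_hom_ringI2 A.A.ring_axioms B.A.ring_axioms) (simp add: k_algebra_hom_def)
  show "h \<zero>\<^bsub>A\<^esub> = \<zero>\<^bsub>B\<^esub>" by simp
  show "h (x \<ominus>\<^bsub>A\<^esub> y) = h x \<ominus>\<^bsub>B\<^esub> h y" if "x \<in> carrier A" "y \<in> carrier A"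
    using that by (simp add: a_minus_def)
qed

section \<open>Free algebras\<close>

lemma splits_Nil: "{(u, v). u @ v = []} = {([], [])}"
  by auto

lemma splits_Cons:
  "{(u, v). u @ v = x # w} = insert ([], x # w) ((\<lambda>(u, v). (x # u, v)) ` {(u, v). u @ v = w})"
  by (auto simp: append_eq_Cons_conv image_iff)

lemma finite_splits: "finite {(u, v). u @ v = w}"
  by (induction w) (simp_all add: splits_Nil splits_Cons)

lemma free_algebra_simps:
  "carrier (free_algebra K G) = {f. (\<forall>w. f w \<in> carrier K) \<and> (\<forall>w. w \<notin> lists G \<longrightarrow> f w = \<zero>\<^bsub>K\<^esub>) \<and>
      finite {w. f w \<noteq> \<zero>\<^bsub>K\<^esub>}}"
  "\<one>\<^bsub>free_algebra K G\<^esub> = (\<lambda>w. if w = [] then \<one>\<^bsub>K\<^esub> else \<zero>\<^bsub>K\<^esub>)"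
  "\<zero>\<^bsub>free_algebra K G\<^esub> = (\<lambda>w. \<zero>\<^bsub>K\<^esub>)"
  "f \<oplus>\<^bsub>free_algebra K G\<^esub> g = (\<lambda>w. f w \<oplus>\<^bsub>K\<^esub> g w)"
  "c \<odot>\<^bsub>free_algebra K G\<^esub> f = (\<lambda>w. c \<otimes>\<^bsub>K\<^esub> f w)"
  by (simp_all add: free_algebra_def)

context field
begin

lemma free_mult_Nil:
  assumes "\<forall>v. f v \<in> carrier R" "\<forall>v. g v \<in> carrier R"
  shows "(f \<otimes>\<^bsub>free_algebra R G\<^esub> g) [] = f [] \<otimes> g []"
  using assms by (simp add: free_algebra_def splits_Nil)

text \<open>A split of \<open>x # w\<close> has either an empty left factor or one starting with
  \<open>x\<close>. This turns convolution into a recursion on the word, in which \<open>f\<close>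
  is replaced by its left translate \<open>\<lambda>v. f (x # v)\<close>; the algebra laws follow by
  induction on the word with \<open>f\<close> arbitrary, without double sums. As every word has
  finitely many splits, it is enough to assume that the values lie in the field.\<close>

lemma free_mult_Cons:
  assumes f: "\<forall>v. f v \<in> carrier R" and g: "\<forall>v. g v \<in> carrier R"
  shows "(f \<otimes>\<^bsub>free_algebra R G\<^esub> g) (x # w) =
    f [] \<otimes> g (x # w) \<oplus> ((\<lambda>v. f (x # v)) \<otimes>\<^bsub>free_algebra R G\<^esub> g) w"
proof -
  let ?c = "\<lambda>p. (x # fst p, snd p)" and ?S = "{(u, v). u @ v = w}"
  have inj: "inj_on ?c ?S" by (auto simp: inj_on_def)
  have c: "?c = (\<lambda>(u, v). (x # u, v))" by auto
  have "(f \<otimes>\<^bsub>free_algebra R G\<^esub> g) (x # w)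
    = (\<Oplus>p\<in>insert ([], x # w) (?c ` ?S). f (fst p) \<otimes> g (snd p))"
    unfolding c by (simp add: free_algebra_def splits_Cons)
  also have "\<dots> = f [] \<otimes> g (x # w) \<oplus> (\<Oplus>p\<in>?c ` ?S. f (fst p) \<otimes> g (snd p))"
    using f g by (subst finsum_insert) (auto simp: finite_splits)
  also have "(\<Oplus>p\<in>?c ` ?S. f (fst p) \<otimes> g (snd p)) = (\<Oplus>p\<in>?S. f (fst (?c p)) \<otimes> g (snd (?c p)))"
    using f g inj by (intro finsum_reindex) simp_all
  also have "\<dots> = ((\<lambda>v. f (x # v)) \<otimes>\<^bsub>free_algebra R G\<^esub> g) w"
    by (simp add: free_algebra_def)
  finally show ?thesis .
qed

lemma free_mult_range:
  assumes "\<forall>v. f v \<in> carrier R" "\<forall>v. g v \<in> carrier R"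
  shows "(f \<otimes>\<^bsub>free_algebra R G\<^esub> g) w \<in> carrier R"
  using assms(1)
  by (induction w arbitrary: f) (simp_all add: free_mult_Nil free_mult_Cons assms)

lemma free_mult_addl:
  assumes "\<forall>v. f v \<in> carrier R" "\<forall>v. f' v \<in> carrier R" "\<forall>v. g v \<in> carrier R"
  shows "((\<lambda>v. f v \<oplus> f' v) \<otimes>\<^bsub>free_algebra R G\<^esub> g) w =
    (f \<otimes>\<^bsub>free_algebra R G\<^esub> g) w \<oplus> (f' \<otimes>\<^bsub>free_algebra R G\<^esub> g) w"
  using assms(1,2)
  by (induction w arbitrary: f f')
    (simp_all add: free_mult_Nil free_mult_Cons assms l_distr free_mult_range a_ac)

lemma free_mult_addr:
  assumes "\<forall>v. f v \<in> carrier R" "\<forall>v. g v \<in> carrier R" "\<forall>v. g' v \<in> carrier R"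
  shows "(f \<otimes>\<^bsub>free_algebra R G\<^esub> (\<lambda>v. g v \<oplus> g' v)) w =
    (f \<otimes>\<^bsub>free_algebra R G\<^esub> g) w \<oplus> (f \<otimes>\<^bsub>free_algebra R G\<^esub> g') w"
  using assms(1)
  by (induction w arbitrary: f)
    (simp_all add: free_mult_Nil free_mult_Cons assms r_distr free_mult_range a_ac)

lemma free_mult_smultl:
  assumes "c \<in> carrier R" "\<forall>v. f v \<in> carrier R" "\<forall>v. g v \<in> carrier R"
  shows "((\<lambda>v. c \<otimes> f v) \<otimes>\<^bsub>free_algebra R G\<^esub> g) w = c \<otimes> (f \<otimes>\<^bsub>free_algebra R G\<^esub> g) w"
  using assms(2)
  by (induction w arbitrary: f)
    (simp_all add: free_mult_Nil free_mult_Cons assms m_assoc r_distr free_mult_range)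

lemma free_mult_smultr:
  assumes "c \<in> carrier R" "\<forall>v. f v \<in> carrier R" "\<forall>v. g v \<in> carrier R"
  shows "(f \<otimes>\<^bsub>free_algebra R G\<^esub> (\<lambda>v. c \<otimes> g v)) w = c \<otimes> (f \<otimes>\<^bsub>free_algebra R G\<^esub> g) w"
  using assms(2)
  by (induction w arbitrary: f)
    (simp_all add: free_mult_Nil free_mult_Cons assms m_lcomm r_distr free_mult_range)

text \<open>The left translate of \<open>f g\<close> by \<open>x\<close> is \<open>f []\<close>
  times the translate of \<open>g\<close> plus the translate of \<open>f\<close> times
  \<open>g\<close>, so the induction step rests on additivity and homogeneity in the left
  factor.\<close>

lemma free_mult_assoc:
  assumes "\<forall>v. f v \<in> carrier R" "\<forall>v. g v \<in> carrier R" "\<forall>v. h v \<in> carrier R"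
  shows "((f \<otimes>\<^bsub>free_algebra R G\<^esub> g) \<otimes>\<^bsub>free_algebra R G\<^esub> h) w =
    (f \<otimes>\<^bsub>free_algebra R G\<^esub> (g \<otimes>\<^bsub>free_algebra R G\<^esub> h)) w"
  using assms(1,2)
proof (induction w arbitrary: f g)
  case Nil
  then show ?case
    using assms(3) by (simp add: free_mult_Nil free_mult_range m_assoc)
next
  case (Cons x w)
  then show ?case
    using assms(3)
    by (simp add: free_mult_Cons[of "f \<otimes>\<^bsub>free_algebra R G\<^esub> g"] free_mult_Cons free_mult_Nil
        free_mult_range free_mult_addl free_mult_smultl r_distr m_assoc a_assoc)
qed

lemma free_mult_zero:
  assumes "\<forall>v. g v \<in> carrier R"
  shows "((\<lambda>_. \<zero>) \<otimes>\<^bsub>free_algebra R G\<^esub> g) w = \<zero>"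
  by (induction w) (simp_all add: free_mult_Nil free_mult_Cons assms)

lemma free_mult_onel:
  assumes "\<forall>v. g v \<in> carrier R"
  shows "((\<lambda>v. if v = [] then \<one> else \<zero>) \<otimes>\<^bsub>free_algebra R G\<^esub> g) w = g w"
  using assms by (cases w) (simp_all add: free_mult_Nil free_mult_Cons free_mult_zero)

lemma free_mult_oner:
  assumes "\<forall>v. f v \<in> carrier R"
  shows "(f \<otimes>\<^bsub>free_algebra R G\<^esub> (\<lambda>v. if v = [] then \<one> else \<zero>)) w = f w"
  using assms by (induction w arbitrary: f) (simp_all add: free_mult_Nil free_mult_Cons)

lemma free_gen_range: "\<forall>v. free_gen R x v \<in> carrier R"
  by (auto simp: free_gen_def)

lemma free_gen_mult:
  assumes "\<forall>v. g v \<in> carrier R"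
  shows "(free_gen R x \<otimes>\<^bsub>free_algebra R G\<^esub> g) w =
    (case w of [] \<Rightarrow> \<zero> | y # v \<Rightarrow> if y = x then g v else \<zero>)"
proof (cases w)
  case Nil
  then show ?thesis
    using assms by (simp add: free_mult_Nil[OF free_gen_range]) (simp add: free_gen_def)
next
  case (Cons y v)
  have "(\<lambda>v. free_gen R x (y # v)) = (if y = x then (\<lambda>v. if v = [] then \<one> else \<zero>) else (\<lambda>_. \<zero>))"
    by (auto simp: free_gen_def)
  moreover have "free_gen R x [] = \<zero>" by (simp add: free_gen_def)
  ultimately show ?thesis
    using assms Cons
    by (simp add: free_mult_Cons[OF free_gen_range] free_mult_zero free_mult_onel)
qed

lemma mult_free_gen:
  assumes "\<forall>v. f v \<in> carrier R"
  shows "(f \<otimes>\<^bsub>free_algebra R G\<^esub> free_gen R x) w =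
    (if w \<noteq> [] \<and> last w = x then f (butlast w) else \<zero>)"
  using assms
proof (induction w arbitrary: f)
  case Nil
  then show ?case
    by (simp add: free_mult_Nil[OF _ free_gen_range]) (simp add: free_gen_def)
next
  case (Cons y w)
  then show ?case
    by (simp add: free_mult_Cons[OF _ free_gen_range]) (auto simp: free_gen_def)
qed

text \<open>Serves twice: it bounds the support of a product, and it makes the degrees of
  homogeneous factors compose in \<open>homogeneous_mult\<close>.\<close>

lemma free_mult_supp:
  assumes "\<forall>v. f v \<in> carrier R" "\<forall>v. g v \<in> carrier R" "(f \<otimes>\<^bsub>free_algebra R G\<^esub> g) w \<noteq> \<zero>"
  shows "\<exists>u v. w = u @ v \<and> f u \<noteq> \<zero> \<and> g v \<noteq> \<zero>"
  using assms(1,3)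
proof (induction w arbitrary: f)
  case Nil
  then show ?case using assms(2) by (auto simp: free_mult_Nil)
next
  case (Cons x w)
  show ?case
  proof (cases "f [] \<noteq> \<zero> \<and> g (x # w) \<noteq> \<zero>")
    case True
    then show ?thesis by (metis append_Nil)
  next
    case False
    then have "f [] \<otimes> g (x # w) = \<zero>" using Cons(2) assms(2) by auto
    with Cons(2,3) assms(2) have "((\<lambda>v. f (x # v)) \<otimes>\<^bsub>free_algebra R G\<^esub> g) w \<noteq> \<zero>"
      by (auto simp: free_mult_Cons)
    from Cons.IH[OF _ this] Cons(2) obtain u v where "w = u @ v" "f (x # u) \<noteq> \<zero>" "g v \<noteq> \<zero>" by auto
    then show ?thesis by (metis append_Cons)
  qed
qed

lemma free_algebra_range: "f \<in> carrier (free_algebra R G) \<Longrightarrow> \<forall>v. f v \<in> carrier R"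
  by (auto simp: free_algebra_simps)

lemma free_mult_closed:
  assumes f: "f \<in> carrier (free_algebra R G)" and g: "g \<in> carrier (free_algebra R G)"
  shows "f \<otimes>\<^bsub>free_algebra R G\<^esub> g \<in> carrier (free_algebra R G)"
proof -
  let ?p = "f \<otimes>\<^bsub>free_algebra R G\<^esub> g"
  note r = free_algebra_range[OF f] free_algebra_range[OF g]
  have "{w. ?p w \<noteq> \<zero>} \<subseteq> (\<lambda>(u, v). u @ v) ` ({u. f u \<noteq> \<zero>} \<times> {v. g v \<noteq> \<zero>})"
    using free_mult_supp[OF r] by (force simp: image_iff)
  moreover have "finite ({u. f u \<noteq> \<zero>} \<times> {v. g v \<noteq> \<zero>})"
    using f g by (simp add: free_algebra_simps)
  ultimately have "finite {w. ?p w \<noteq> \<zero>}" by (meson finite_imageI finite_subset)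
  moreover have "?p w = \<zero>" if "w \<notin> lists G" for w
  proof (rule ccontr)
    assume "?p w \<noteq> \<zero>"
    then obtain u v where "w = u @ v" "f u \<noteq> \<zero>" "g v \<noteq> \<zero>" using free_mult_supp[OF r] by blast
    with f g have "w \<in> lists G" by (auto simp: free_algebra_simps)
    with that show False ..
  qed
  moreover have "?p w \<in> carrier R" for w
    using free_mult_range[OF r] .
  ultimately show ?thesis by (subst free_algebra_simps) simp
qed

lemma free_smult_closed:
  assumes "c \<in> carrier R" "f \<in> carrier (free_algebra R G)"
  shows "c \<odot>\<^bsub>free_algebra R G\<^esub> f \<in> carrier (free_algebra R G)"
proof -
  have "{w. c \<otimes> f w \<noteq> \<zero>} \<subseteq> {w. f w \<noteq> \<zero>}" using assms by auto
  with assms show ?thesis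
    by (auto simp: free_algebra_simps elim: rev_finite_subset)
qed

lemma free_add_closed:
  assumes "f \<in> carrier (free_algebra R G)" "g \<in> carrier (free_algebra R G)"
  shows "f \<oplus>\<^bsub>free_algebra R G\<^esub> g \<in> carrier (free_algebra R G)"
proof -
  have "{w. f w \<oplus> g w \<noteq> \<zero>} \<subseteq> {w. f w \<noteq> \<zero>} \<union> {w. g w \<noteq> \<zero>}" by auto
  with assms show ?thesis
    by (auto simp: free_algebra_simps intro: finite_subset[OF _ finite_UnI])
qed

lemma free_one_closed: "\<one>\<^bsub>free_algebra R G\<^esub> \<in> carrier (free_algebra R G)"
  by (auto simp: free_algebra_simps)

lemma free_gen_closed: "x \<in> G \<Longrightarrow> free_gen R x \<in> carrier (free_algebra R G)"
  by (auto simp: free_algebra_simps free_gen_def)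

lemma free_algebra_k_algebra: "k_algebra R (free_algebra R G)"
proof -
  let ?F = "free_algebra R G"
  have ag: "abelian_group ?F"
  proof (rule abelian_groupI)
    fix f assume f: "f \<in> carrier ?F"
    \<comment> \<open>Membership of the negative is inherited from the scalar multiple by
      -1.\<close>
    have "(\<lambda>w. \<ominus> f w) \<in> carrier ?F"
      using free_smult_closed[OF _ f, of "\<ominus> \<one>"] f
      by (auto simp: free_algebra_simps l_minus)
    moreover have "(\<lambda>w. \<ominus> f w) \<oplus>\<^bsub>?F\<^esub> f = \<zero>\<^bsub>?F\<^esub>"
      using f by (auto simp: free_algebra_simps l_neg)
    ultimately show "\<exists>g\<in>carrier ?F. g \<oplus>\<^bsub>?F\<^esub> f = \<zero>\<^bsub>?F\<^esub>" by blast
  qed (auto simp: free_add_closed, auto simp: free_algebra_simps a_ac)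
  have "ring ?F"
  proof (rule ringI[OF ag])
    show "monoid ?F"
    proof (rule monoidI)
      fix f g h assume "f \<in> carrier ?F" "g \<in> carrier ?F" "h \<in> carrier ?F"
      then show "f \<otimes>\<^bsub>?F\<^esub> g \<otimes>\<^bsub>?F\<^esub> h = f \<otimes>\<^bsub>?F\<^esub> (g \<otimes>\<^bsub>?F\<^esub> h)"
        by (simp add: fun_eq_iff free_mult_assoc free_algebra_range)
    next
      fix f assume f: "f \<in> carrier ?F"
      show "\<one>\<^bsub>?F\<^esub> \<otimes>\<^bsub>?F\<^esub> f = f"
        using free_algebra_range[OF f] by (simp add: fun_eq_iff free_algebra_simps(2) free_mult_onel)
      show "f \<otimes>\<^bsub>?F\<^esub> \<one>\<^bsub>?F\<^esub> = f"
        using free_algebra_range[OF f] by (simp add: fun_eq_iff free_algebra_simps(2) free_mult_oner)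
    qed (auto simp: free_mult_closed free_one_closed)
  next
    fix f g h assume "f \<in> carrier ?F" "g \<in> carrier ?F" "h \<in> carrier ?F"
    note r = this[THEN free_algebra_range]
    show "(f \<oplus>\<^bsub>?F\<^esub> g) \<otimes>\<^bsub>?F\<^esub> h = f \<otimes>\<^bsub>?F\<^esub> h \<oplus>\<^bsub>?F\<^esub> g \<otimes>\<^bsub>?F\<^esub> h"
      using free_mult_addl[OF r, of G] by (simp add: fun_eq_iff free_algebra_simps)
    show "h \<otimes>\<^bsub>?F\<^esub> (f \<oplus>\<^bsub>?F\<^esub> g) = h \<otimes>\<^bsub>?F\<^esub> f \<oplus>\<^bsub>?F\<^esub> h \<otimes>\<^bsub>?F\<^esub> g"
      using free_mult_addr[OF r(3,1,2), of G] by (simp add: fun_eq_iff free_algebra_simps)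
  qed
  moreover have "module R ?F"
    by (rule moduleI[OF is_cring ag])
      (auto simp: free_smult_closed, auto simp: free_algebra_simps l_distr r_distr m_assoc)
  moreover have "k_algebra_axioms R ?F"
  proof
    fix c f g assume c: "c \<in> carrier R" and fg: "f \<in> carrier ?F" "g \<in> carrier ?F"
    note r = fg[THEN free_algebra_range]
    show "c \<odot>\<^bsub>?F\<^esub> f \<otimes>\<^bsub>?F\<^esub> g = c \<odot>\<^bsub>?F\<^esub> (f \<otimes>\<^bsub>?F\<^esub> g)"
      using free_mult_smultl[OF c r, of G] by (simp add: fun_eq_iff free_algebra_simps)
    show "f \<otimes>\<^bsub>?F\<^esub> (c \<odot>\<^bsub>?F\<^esub> g) = c \<odot>\<^bsub>?F\<^esub> (f \<otimes>\<^bsub>?F\<^esub> g)"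
      using free_mult_smultr[OF c r, of G] by (simp add: fun_eq_iff free_algebra_simps)
  qed
  ultimately show ?thesis
    by (intro k_algebra.intro field_axioms)
qed

lemma mono_closed: "w \<in> lists G \<Longrightarrow> (\<lambda>v. if v = w then \<one> else \<zero>) \<in> carrier (free_algebra R G)"
  by (auto simp: free_algebra_simps)

lemma mono_Cons:
  "(\<lambda>v. if v = x # w then \<one> else \<zero>) =
    free_gen R x \<otimes>\<^bsub>free_algebra R G\<^esub> (\<lambda>v. if v = w then \<one> else \<zero>)"
proof
  show "(if v = x # w then \<one> else \<zero>) =
      (free_gen R x \<otimes>\<^bsub>free_algebra R G\<^esub> (\<lambda>v. if v = w then \<one> else \<zero>)) v" for v
    by (subst free_gen_mult) (auto split: list.splits)
qed

lemma free_algebra_mono: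
  assumes "w \<in> lists G" "P \<one>\<^bsub>free_algebra R G\<^esub>" and gen: "\<And>x. x \<in> G \<Longrightarrow> P (free_gen R x)"
    and mult: "\<And>f g. \<lbrakk>f \<in> carrier (free_algebra R G); g \<in> carrier (free_algebra R G); P f; P g\<rbrakk> \<Longrightarrow>
        P (f \<otimes>\<^bsub>free_algebra R G\<^esub> g)"
  shows "P (\<lambda>v. if v = w then \<one> else \<zero>)"
  using assms(1)
proof (induction w)
  case Nil
  then show ?case using assms(2) by (simp add: free_algebra_simps)
next
  case (Cons x w)
  then show ?case
    using mult[OF free_gen_closed mono_closed gen Cons.IH]
    by (simp add: mono_Cons[where x = x and w = w and G = G])
qed

text \<open>The monomial case is demanded only for words in the support of \<open>f\<close>. This
  lets \<open>part_shift\<close> use that every such word has the prescribed degree, which a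
  structural induction would forget.\<close>

lemma free_algebra_span:
  assumes "f \<in> carrier (free_algebra R G)"
    and zero: "P \<zero>\<^bsub>free_algebra R G\<^esub>"
    and add: "\<And>g h. \<lbrakk>g \<in> carrier (free_algebra R G); h \<in> carrier (free_algebra R G); P g; P h\<rbrakk> \<Longrightarrow>
        P (g \<oplus>\<^bsub>free_algebra R G\<^esub> h)"
    and mono: "\<And>c w. \<lbrakk>c \<in> carrier R; w \<in> lists G; f w \<noteq> \<zero>\<rbrakk> \<Longrightarrow>
        P (c \<odot>\<^bsub>free_algebra R G\<^esub> (\<lambda>v. if v = w then \<one> else \<zero>))"
  shows "P f"
proof -
  let ?F = "free_algebra R G"
  \<comment> \<open>Generalized to any \<open>g\<close> supported in a finite part \<open>A\<close>
    of the support of \<open>f\<close>, so that one word can be split off at a time.\<close>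
  have "P g" if "finite A" "A \<subseteq> {w. f w \<noteq> \<zero>}" "{w. g w \<noteq> \<zero>} \<subseteq> A" "g \<in> carrier ?F" for A g
    using that
  proof (induction A arbitrary: g)
    case empty
    then have "g = \<zero>\<^bsub>?F\<^esub>" by (auto simp: free_algebra_simps)
    then show ?case using zero by simp
  next
    case (insert w A)
    let ?m = "\<lambda>v. if v = w then \<one> else \<zero>"
    have w: "w \<in> lists G" "f w \<noteq> \<zero>" "g w \<in> carrier R"
      using insert(4,6) assms(1) by (auto simp: free_algebra_simps)
    then have m: "?m \<in> carrier ?F" by (intro mono_closed)
    have g: "g(w := \<zero>) \<in> carrier ?F"
      using insert(6) by (auto simp: free_algebra_simps elim: rev_finite_subset)
    have "g = (g w \<odot>\<^bsub>?F\<^esub> ?m) \<oplus>\<^bsub>?F\<^esub> g(w := \<zero>)"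
      using insert(6) by (auto simp: free_algebra_simps fun_eq_iff)
    moreover have "P (g w \<odot>\<^bsub>?F\<^esub> ?m)" using mono w by blast
    moreover have "P (g(w := \<zero>))" using insert(4,5) by (intro insert.IH[OF _ _ g]) auto
    ultimately show ?case using add g w m free_smult_closed by metis
  qed
  then show ?thesis using assms(1) by (auto simp: free_algebra_simps)
qed

lemma free_algebra_induct [consumes 1, case_names one gen mult add smult]:
  assumes "f \<in> carrier (free_algebra R G)"
    and one: "P \<one>\<^bsub>free_algebra R G\<^esub>"
    and gen: "\<And>x. x \<in> G \<Longrightarrow> P (free_gen R x)"
    and mult: "\<And>f g. \<lbrakk>f \<in> carrier (free_algebra R G); g \<in> carrier (free_algebra R G); P f; P g\<rbrakk> \<Longrightarrow>
        P (f \<otimes>\<^bsub>free_algebra R G\<^esub> g)"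
    and add: "\<And>f g. \<lbrakk>f \<in> carrier (free_algebra R G); g \<in> carrier (free_algebra R G); P f; P g\<rbrakk> \<Longrightarrow>
        P (f \<oplus>\<^bsub>free_algebra R G\<^esub> g)"
    and smult: "\<And>c f. \<lbrakk>c \<in> carrier R; f \<in> carrier (free_algebra R G); P f\<rbrakk> \<Longrightarrow>
        P (c \<odot>\<^bsub>free_algebra R G\<^esub> f)"
  shows "P f"
proof (rule free_algebra_span[OF assms(1)])
  have "\<zero>\<^bsub>free_algebra R G\<^esub> = \<zero> \<odot>\<^bsub>free_algebra R G\<^esub> \<one>\<^bsub>free_algebra R G\<^esub>"
    by (auto simp: free_algebra_simps)
  then show "P \<zero>\<^bsub>free_algebra R G\<^esub>" using smult[OF _ free_one_closed one] by simp
  fix c w assume c: "c \<in> carrier R" and w: "w \<in> lists G"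
  from c w show "P (c \<odot>\<^bsub>free_algebra R G\<^esub> (\<lambda>v. if v = w then \<one> else \<zero>))"
    by (intro smult mono_closed free_algebra_mono[OF w one gen mult])
qed (rule add)

end

section \<open>Evaluation of the free algebra in an arbitrary algebra\<close>

definition word_eval :: "('a, 'p) ring_scheme \<Rightarrow> ('g \<Rightarrow> 'a) \<Rightarrow> 'g list \<Rightarrow> 'a"
  where "word_eval E \<eta> w = foldr (\<lambda>x r. \<eta> x \<otimes>\<^bsub>E\<^esub> r) w \<one>\<^bsub>E\<^esub>"

definition free_eval ::
    "('k, 'm) ring_scheme \<Rightarrow> ('k, 'a, 'p) module_scheme \<Rightarrow> ('g \<Rightarrow> 'a) \<Rightarrow> ('g list \<Rightarrow> 'k) \<Rightarrow> 'a"
  where "free_eval K E \<eta> f = (\<Oplus>\<^bsub>E\<^esub>w\<in>{w. f w \<noteq> \<zero>\<^bsub>K\<^esub>}. f w \<odot>\<^bsub>E\<^esub> word_eval E \<eta> w)"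

locale free_evaluation = k_algebra K E
  for K :: "('k, 'm) ring_scheme" (structure) and E :: "('k, 'a, 'p) module_scheme" (structure) +
  fixes G :: "'g set" and \<eta> :: "'g \<Rightarrow> 'a"
  assumes gens_closed: "x \<in> G \<Longrightarrow> \<eta> x \<in> carrier E"
begin

abbreviation "F \<equiv> free_algebra K G"
abbreviation "\<epsilon> \<equiv> free_eval K E \<eta>"

sublocale F: k_algebra K F
  by (rule free_algebra_k_algebra)

lemma word_eval_closed: "w \<in> lists G \<Longrightarrow> word_eval E \<eta> w \<in> carrier E"
  by (induction w) (simp_all add: word_eval_def gens_closed)

lemma term_closed:
  "w \<in> lists G \<Longrightarrow> f \<in> carrier F \<Longrightarrow> f w \<odot>\<^bsub>E\<^esub> word_eval E \<eta> w \<in> carrier E"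
  by (simp add: word_eval_closed free_algebra_range)

lemma supp_lists: "f \<in> carrier F \<Longrightarrow> f w \<noteq> \<zero> \<Longrightarrow> w \<in> lists G"
  by (metis (mono_tags, lifting) free_algebra_simps(1) mem_Collect_eq)

lemma finite_supp: "f \<in> carrier F \<Longrightarrow> finite {w. f w \<noteq> \<zero>}"
  by (simp add: free_algebra_simps)

text \<open>The sums for \<open>f\<close>, \<open>g\<close> and their sum run over different
  supports; padding by zero terms puts them over a common index set.\<close>

lemma free_eval_superset:
  assumes f: "f \<in> carrier F" and A: "finite A" "A \<subseteq> lists G" "{w. f w \<noteq> \<zero>} \<subseteq> A"
  shows "\<epsilon> f = (\<Oplus>\<^bsub>E\<^esub>w\<in>A. f w \<odot>\<^bsub>E\<^esub> word_eval E \<eta> w)"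
  unfolding free_eval_def
proof (rule M.add.finprod_mono_neutral_cong_left[OF A(1,3)])
  show "f w \<odot>\<^bsub>E\<^esub> word_eval E \<eta> w = \<zero>\<^bsub>E\<^esub>" if "w \<in> A - {w. f w \<noteq> \<zero>}" for w
    using that A(2) by (auto simp: word_eval_closed subset_iff)
  show "(\<lambda>w. f w \<odot>\<^bsub>E\<^esub> word_eval E \<eta> w) \<in> A \<rightarrow> carrier E"
    using f A(2) term_closed by blast
qed simp

lemma free_eval_closed:
  assumes f: "f \<in> carrier F" shows "\<epsilon> f \<in> carrier E"
  unfolding free_eval_def using f term_closed supp_lists by (intro M.finsum_closed) blast

lemma free_eval_add:
  assumes f: "f \<in> carrier F" and g: "g \<in> carrier F"
  shows "\<epsilon> (f \<oplus>\<^bsub>F\<^esub> g) = \<epsilon> f \<oplus>\<^bsub>E\<^esub> \<epsilon> g"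
proof -
  let ?A = "{w. f w \<noteq> \<zero>} \<union> {w. g w \<noteq> \<zero>}"
  have fin: "finite ?A" and G: "?A \<subseteq> lists G"
    using f g finite_supp supp_lists by blast+
  have fg: "{w. (f \<oplus>\<^bsub>F\<^esub> g) w \<noteq> \<zero>} \<subseteq> ?A" by (auto simp: free_algebra_simps)
  have r: "\<forall>w. f w \<in> carrier K" "\<forall>w. g w \<in> carrier K"
    using f g free_algebra_range by blast+
  have "\<epsilon> (f \<oplus>\<^bsub>F\<^esub> g) = (\<Oplus>\<^bsub>E\<^esub>w\<in>?A. (f \<oplus>\<^bsub>F\<^esub> g) w \<odot>\<^bsub>E\<^esub> word_eval E \<eta> w)"
    using f g fg by (intro free_eval_superset fin G) simp_all
  also have "\<dots> = (\<Oplus>\<^bsub>E\<^esub>w\<in>?A. f w \<odot>\<^bsub>E\<^esub> word_eval E \<eta> w \<oplus>\<^bsub>E\<^esub> g w \<odot>\<^bsub>E\<^esub> word_eval E \<eta> w)"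
  proof (rule M.finsum_cong'[OF refl])
    show "(\<lambda>w. f w \<odot>\<^bsub>E\<^esub> word_eval E \<eta> w \<oplus>\<^bsub>E\<^esub> g w \<odot>\<^bsub>E\<^esub> word_eval E \<eta> w) \<in> ?A \<rightarrow> carrier E"
      using G r by (auto simp: word_eval_closed subset_iff)
    show "(f \<oplus>\<^bsub>F\<^esub> g) w \<odot>\<^bsub>E\<^esub> word_eval E \<eta> w =
        f w \<odot>\<^bsub>E\<^esub> word_eval E \<eta> w \<oplus>\<^bsub>E\<^esub> g w \<odot>\<^bsub>E\<^esub> word_eval E \<eta> w" if "w \<in> ?A" for w
    proof -
      have "w \<in> lists G" using that G by blast
      then show ?thesis
        using r by (simp add: word_eval_closed smult_l_distr free_algebra_simps(4))
    qed
  qed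
  also have "\<dots> = (\<Oplus>\<^bsub>E\<^esub>w\<in>?A. f w \<odot>\<^bsub>E\<^esub> word_eval E \<eta> w) \<oplus>\<^bsub>E\<^esub> (\<Oplus>\<^bsub>E\<^esub>w\<in>?A. g w \<odot>\<^bsub>E\<^esub> word_eval E \<eta> w)"
    using f g G term_closed by (intro M.finsum_addf) blast+
  also have "\<dots> = \<epsilon> f \<oplus>\<^bsub>E\<^esub> \<epsilon> g"
    using f g by (simp add: free_eval_superset[OF _ fin G])
  finally show ?thesis .
qed

lemma free_eval_smult:
  assumes c: "c \<in> carrier K" and f: "f \<in> carrier F"
  shows "\<epsilon> (c \<odot>\<^bsub>F\<^esub> f) = c \<odot>\<^bsub>E\<^esub> \<epsilon> f"
proof -
  let ?A = "{w. f w \<noteq> \<zero>}"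
  have fin: "finite ?A" and G: "?A \<subseteq> lists G"
    using f finite_supp supp_lists by blast+
  have r: "\<forall>w. f w \<in> carrier K" using f free_algebra_range by blast
  have "\<epsilon> (c \<odot>\<^bsub>F\<^esub> f) = (\<Oplus>\<^bsub>E\<^esub>w\<in>?A. (c \<odot>\<^bsub>F\<^esub> f) w \<odot>\<^bsub>E\<^esub> word_eval E \<eta> w)"
    using free_smult_closed[OF c f] c by (intro free_eval_superset fin G) (auto simp: free_algebra_simps(5))
  also have "\<dots> = (\<Oplus>\<^bsub>E\<^esub>w\<in>?A. c \<odot>\<^bsub>E\<^esub> (f w \<odot>\<^bsub>E\<^esub> word_eval E \<eta> w))"
    using G r c
    by (intro M.finsum_cong'[OF refl])
      (auto simp: word_eval_closed subset_iff free_algebra_simps(5) smult_assoc1 simp flip: lists_eq_set)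
  also have "\<dots> = c \<odot>\<^bsub>E\<^esub> \<epsilon> f"
    unfolding free_eval_def using c f G term_closed by (intro finsum_smult_ldistr[symmetric] fin) blast+
  finally show ?thesis .
qed

lemma free_eval_one: "\<epsilon> \<one>\<^bsub>F\<^esub> = \<one>\<^bsub>E\<^esub>"
  using free_eval_superset[of "\<one>\<^bsub>F\<^esub>" "{[]}"]
  by (simp add: free_one_closed word_eval_def M.finsum_insert) (simp add: free_algebra_simps)

lemma free_eval_gen_mult:
  assumes x: "x \<in> G" and f: "f \<in> carrier F"
  shows "\<epsilon> (free_gen K x \<otimes>\<^bsub>F\<^esub> f) = \<eta> x \<otimes>\<^bsub>E\<^esub> \<epsilon> f"
proof -
  let ?A = "{w. f w \<noteq> \<zero>}"
  have fin: "finite ?A" and G: "?A \<subseteq> lists G"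
    using f finite_supp supp_lists by blast+
  have r: "\<forall>w. f w \<in> carrier K" using f free_algebra_range by blast
  have G': "\<forall>w. f w \<noteq> \<zero> \<longrightarrow> (\<forall>y\<in>set w. y \<in> G)" using G by (auto simp: subset_iff)
  have xf: "(free_gen K x \<otimes>\<^bsub>F\<^esub> f) w = (case w of [] \<Rightarrow> \<zero> | y # v \<Rightarrow> if y = x then f v else \<zero>)" for w
    using free_gen_mult[OF r] .
  \<comment> \<open>Multiplication by the generator prepends the letter \<open>x\<close> to every
    word, so the support is carried along by \<open>Cons x\<close> and the sum can be
    reindexed.\<close>
  have "\<epsilon> (free_gen K x \<otimes>\<^bsub>F\<^esub> f) = (\<Oplus>\<^bsub>E\<^esub>w\<in>Cons x ` ?A. (free_gen K x \<otimes>\<^bsub>F\<^esub> f) w \<odot>\<^bsub>E\<^esub> word_eval E \<eta> w)"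
  proof (rule free_eval_superset)
    show "{w. (free_gen K x \<otimes>\<^bsub>F\<^esub> f) w \<noteq> \<zero>} \<subseteq> Cons x ` ?A"
    proof
      fix w assume "w \<in> {w. (free_gen K x \<otimes>\<^bsub>F\<^esub> f) w \<noteq> \<zero>}"
      then show "w \<in> Cons x ` ?A" by (cases w) (auto simp: xf split: if_splits)
    qed
    show "Cons x ` ?A \<subseteq> lists G" using x subsetD[OF G] by (intro image_subsetI lists.Cons)
    show "free_gen K x \<otimes>\<^bsub>F\<^esub> f \<in> carrier F" using x f by (simp add: free_gen_closed)
    show "finite (Cons x ` ?A)" using fin by (rule finite_imageI)
  qed
  also have "\<dots> = (\<Oplus>\<^bsub>E\<^esub>w\<in>?A. (free_gen K x \<otimes>\<^bsub>F\<^esub> f) (x # w) \<odot>\<^bsub>E\<^esub> word_eval E \<eta> (x # w))"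
    using r x G' by (intro M.finsum_reindex) (auto simp: xf inj_on_def intro!: smult_closed word_eval_closed)
  also have "\<dots> = (\<Oplus>\<^bsub>E\<^esub>w\<in>?A. \<eta> x \<otimes>\<^bsub>E\<^esub> (f w \<odot>\<^bsub>E\<^esub> word_eval E \<eta> w))"
  proof (rule M.finsum_cong'[OF refl])
    show "(\<lambda>w. \<eta> x \<otimes>\<^bsub>E\<^esub> (f w \<odot>\<^bsub>E\<^esub> word_eval E \<eta> w)) \<in> ?A \<rightarrow> carrier E"
      using f x G term_closed gens_closed by blast
    show "(free_gen K x \<otimes>\<^bsub>F\<^esub> f) (x # w) \<odot>\<^bsub>E\<^esub> word_eval E \<eta> (x # w) =
        \<eta> x \<otimes>\<^bsub>E\<^esub> (f w \<odot>\<^bsub>E\<^esub> word_eval E \<eta> w)" if "w \<in> ?A" for w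
    proof -
      have "w \<in> lists G" using that G by blast
      then show ?thesis
        using r x word_eval_closed gens_closed by (simp add: xf smult_mult_right) (simp add: word_eval_def)
    qed
  qed
  also have "\<dots> = \<eta> x \<otimes>\<^bsub>E\<^esub> \<epsilon> f"
    unfolding free_eval_def using x f G term_closed gens_closed
    by (intro A.finsum_rdistr[symmetric] fin) blast+
  finally show ?thesis .
qed

lemma free_eval_gen:
  assumes x: "x \<in> G"
  shows "\<epsilon> (free_gen K x) = \<eta> x"
  using free_eval_gen_mult[OF x free_one_closed] x
  by (simp add: free_eval_one free_gen_closed gens_closed)

text \<open>Induction on the left factor only: associativity and distributivity reduce it to a
  single generator, where \<open>free_eval_gen_mult\<close> applies.\<close>

lemma free_eval_mult:
  assumes "f \<in> carrier F" "g \<in> carrier F"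
  shows "\<epsilon> (f \<otimes>\<^bsub>F\<^esub> g) = \<epsilon> f \<otimes>\<^bsub>E\<^esub> \<epsilon> g"
  using assms
proof (induction f arbitrary: g rule: free_algebra_induct)
  case one
  then show ?case by (simp add: free_eval_one free_eval_closed)
next
  case (gen x)
  then show ?case by (simp add: free_eval_gen_mult free_eval_gen)
next
  case (mult f f')
  then show ?case by (simp add: F.A.m_assoc A.m_assoc free_eval_closed)
next
  case (add f f')
  then show ?case by (simp add: F.A.l_distr A.l_distr free_eval_closed free_eval_add)
next
  case (smult c f)
  then show ?case by (simp add: F.smult_mult_left smult_mult_left free_eval_closed free_eval_smult)
qed

lemma free_eval_hom: "\<epsilon> \<in> k_algebra_hom K F E"
  by (simp add: k_algebra_hom_def ring_hom_memI free_eval_closed free_eval_add free_eval_mult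
      free_eval_one free_eval_smult)

end

section \<open>Quotient algebras\<close>

locale algebra_ideal = k_algebra K A + I: ideal I A
  for K :: "('k, 'm) ring_scheme" (structure) and A :: "('k, 'a, 'p) module_scheme" (structure)
    and I :: "'a set"
begin

abbreviation "Q \<equiv> algebra_quot A I"

lemma algebra_quot_simps:
  "carrier Q = carrier (A Quot I)" "mult Q = mult (A Quot I)" "one Q = one (A Quot I)"
  "zero Q = zero (A Quot I)" "add Q = add (A Quot I)"
  by (simp_all add: algebra_quot_def ring.defs)

text \<open>Scalars act through multiplication by \<open>c \<odot> \<one>\<close>, so a ring ideal
  is automatically a subspace and the quotient inherits the scalars.\<close>

lemma smult_ideal: "c \<in> carrier K \<Longrightarrow> i \<in> I \<Longrightarrow> c \<odot>\<^bsub>A\<^esub> i \<in> I"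
  using I.I_l_closed[of i "c \<odot>\<^bsub>A\<^esub> \<one>\<^bsub>A\<^esub>"] smult_mult_left[of c "\<one>\<^bsub>A\<^esub>" i]
  by (simp add: I.Icarr)

lemma quot_carrierE:
  assumes "P \<in> carrier Q" obtains x where "x \<in> carrier A" "P = I +>\<^bsub>A\<^esub> x"
  using assms by (auto simp: algebra_quot_simps FactRing_simps)

lemma coset_closed: "x \<in> carrier A \<Longrightarrow> I +>\<^bsub>A\<^esub> x \<in> carrier Q"
  by (auto simp: algebra_quot_simps FactRing_simps)

lemma coset_eq_iff:
  assumes "x \<in> carrier A" "y \<in> carrier A"
  shows "I +>\<^bsub>A\<^esub> x = I +>\<^bsub>A\<^esub> y \<longleftrightarrow> x \<ominus>\<^bsub>A\<^esub> y \<in> I"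
proof
  assume "I +>\<^bsub>A\<^esub> x = I +>\<^bsub>A\<^esub> y"
  then have "x \<in> I +>\<^bsub>A\<^esub> y" using I.a_rcos_self assms by blast
  then show "x \<ominus>\<^bsub>A\<^esub> y \<in> I" using I.a_rcos_module_minus A.ring_axioms assms by blast
next
  assume "x \<ominus>\<^bsub>A\<^esub> y \<in> I"
  then have "x \<in> I +>\<^bsub>A\<^esub> y" using I.a_rcos_module_minus A.ring_axioms assms by blast
  then show "I +>\<^bsub>A\<^esub> x = I +>\<^bsub>A\<^esub> y" using I.a_repr_independence'[OF _ assms(2)] by simp
qed

lemma coset_zero_iff: "x \<in> carrier A \<Longrightarrow> I +>\<^bsub>A\<^esub> x = \<zero>\<^bsub>Q\<^esub> \<longleftrightarrow> x \<in> I"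
  using I.a_rcos_self[of x] I.a_rcos_const by (auto simp: algebra_quot_simps FactRing_def)

text \<open>All representatives contribute the same coset to the union in
  \<open>algebra_quot\<close>, so the union collapses.\<close>

lemma coset_smult:
  assumes c: "c \<in> carrier K" and x: "x \<in> carrier A"
  shows "c \<odot>\<^bsub>Q\<^esub> (I +>\<^bsub>A\<^esub> x) = I +>\<^bsub>A\<^esub> (c \<odot>\<^bsub>A\<^esub> x)"
proof -
  have "I +>\<^bsub>A\<^esub> (c \<odot>\<^bsub>A\<^esub> y) = I +>\<^bsub>A\<^esub> (c \<odot>\<^bsub>A\<^esub> x)" if "y \<in> I +>\<^bsub>A\<^esub> x" for y
  proof -
    have y: "y \<in> carrier A" using that x I.a_elemrcos_carrier by blast
    have "y \<ominus>\<^bsub>A\<^esub> x \<in> I" using that x y I.a_rcos_module_minus A.ring_axioms by blast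
    then have "c \<odot>\<^bsub>A\<^esub> (y \<ominus>\<^bsub>A\<^esub> x) \<in> I" using c smult_ideal by blast
    then show ?thesis
      using c x y by (simp add: coset_eq_iff a_minus_def smult_r_distr smult_r_minus)
  qed
  moreover have "x \<in> I +>\<^bsub>A\<^esub> x" using x I.a_rcos_self by blast
  ultimately have "(\<Union>y\<in>I +>\<^bsub>A\<^esub> x. I +>\<^bsub>A\<^esub> (c \<odot>\<^bsub>A\<^esub> y)) = I +>\<^bsub>A\<^esub> (c \<odot>\<^bsub>A\<^esub> x)" by blast
  then show ?thesis by (simp add: algebra_quot_def ring.defs)
qed

lemma coset_add:
  "\<lbrakk>x \<in> carrier A; y \<in> carrier A\<rbrakk> \<Longrightarrow> (I +>\<^bsub>A\<^esub> x) \<oplus>\<^bsub>Q\<^esub> (I +>\<^bsub>A\<^esub> y) = I +>\<^bsub>A\<^esub> (x \<oplus>\<^bsub>A\<^esub> y)"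
  using ring_hom_add[OF I.rcos_ring_hom, of x y] by (simp add: algebra_quot_simps)

lemma coset_mult:
  "\<lbrakk>x \<in> carrier A; y \<in> carrier A\<rbrakk> \<Longrightarrow> (I +>\<^bsub>A\<^esub> x) \<otimes>\<^bsub>Q\<^esub> (I +>\<^bsub>A\<^esub> y) = I +>\<^bsub>A\<^esub> (x \<otimes>\<^bsub>A\<^esub> y)"
  using ring_hom_mult[OF I.rcos_ring_hom, of x y] by (simp add: algebra_quot_simps)

lemma coset_hom: "(+>\<^bsub>A\<^esub>) I \<in> k_algebra_hom K A Q"
  using I.rcos_ring_hom
  by (auto simp: k_algebra_hom_def ring_hom_def algebra_quot_simps coset_smult)

lemma algebra_quot_k_algebra: "k_algebra K Q"
proof -
  have ring: "ring Q"
  proof (rule ringI)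
    interpret R: ring "A Quot I" by (rule I.quotient_is_ring)
    show "abelian_group Q"
    proof (rule abelian_groupI)
      fix x assume "x \<in> carrier Q"
      then show "\<exists>y\<in>carrier Q. y \<oplus>\<^bsub>Q\<^esub> x = \<zero>\<^bsub>Q\<^esub>"
        using R.l_neg R.a_inv_closed unfolding algebra_quot_simps by blast
    qed (simp_all add: algebra_quot_simps R.a_ac)
    show "monoid Q" by (rule monoidI) (simp_all add: algebra_quot_simps R.m_assoc)
  qed (simp_all add: algebra_quot_simps ring.ring_simprules[OF I.quotient_is_ring])
  then have "abelian_group Q" by (rule ring.is_abelian_group)
  have "module K Q"
  proof (rule moduleI)
    fix c d x y assume c: "c \<in> carrier K" "d \<in> carrier K" and x: "x \<in> carrier Q" "y \<in> carrier Q"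
    obtain u v where u: "u \<in> carrier A" "x = I +>\<^bsub>A\<^esub> u" and v: "v \<in> carrier A" "y = I +>\<^bsub>A\<^esub> v"
      using x by (metis quot_carrierE)
    show "c \<odot>\<^bsub>Q\<^esub> x \<in> carrier Q" using c u by (simp add: coset_smult coset_closed)
    show "(c \<oplus> d) \<odot>\<^bsub>Q\<^esub> x = c \<odot>\<^bsub>Q\<^esub> x \<oplus>\<^bsub>Q\<^esub> d \<odot>\<^bsub>Q\<^esub> x"
      using c u by (simp add: coset_smult coset_add smult_l_distr)
    show "c \<odot>\<^bsub>Q\<^esub> (x \<oplus>\<^bsub>Q\<^esub> y) = c \<odot>\<^bsub>Q\<^esub> x \<oplus>\<^bsub>Q\<^esub> c \<odot>\<^bsub>Q\<^esub> y"
      using c u v by (simp add: coset_smult coset_add smult_r_distr)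
    show "(c \<otimes> d) \<odot>\<^bsub>Q\<^esub> x = c \<odot>\<^bsub>Q\<^esub> (d \<odot>\<^bsub>Q\<^esub> x)"
      using c u by (simp add: coset_smult smult_assoc1)
  next
    fix x assume "x \<in> carrier Q"
    then show "\<one> \<odot>\<^bsub>Q\<^esub> x = x" by (auto simp: coset_smult elim: quot_carrierE)
  qed (fact is_cring, fact)
  moreover have "k_algebra_axioms K Q"
  proof
    fix c x y assume c: "c \<in> carrier K" and x: "x \<in> carrier Q" "y \<in> carrier Q"
    obtain u v where u: "u \<in> carrier A" "x = I +>\<^bsub>A\<^esub> u" and v: "v \<in> carrier A" "y = I +>\<^bsub>A\<^esub> v"
      using x by (metis quot_carrierE)
    show "c \<odot>\<^bsub>Q\<^esub> x \<otimes>\<^bsub>Q\<^esub> y = c \<odot>\<^bsub>Q\<^esub> (x \<otimes>\<^bsub>Q\<^esub> y)"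
      using c u v by (simp add: coset_smult coset_mult smult_mult_left)
    show "x \<otimes>\<^bsub>Q\<^esub> (c \<odot>\<^bsub>Q\<^esub> y) = c \<odot>\<^bsub>Q\<^esub> (x \<otimes>\<^bsub>Q\<^esub> y)"
      using c u v by (simp add: coset_smult coset_mult smult_mult_right)
  qed
  ultimately show ?thesis using ring by (intro k_algebra.intro field_axioms)
qed

end

section \<open>The presentation of a generalized Weyl algebra\<close>

text \<open>
  Only closure of the operations of \<open>D\<close> is assumed, so that the results also apply to the
  localization of \<open>D\<close> without verifying the ring axioms for it.
\<close>

locale gwa_presentation = field K
  for K :: "('k, 'm) ring_scheme" (structure) +
  fixes D :: "('k, 'd, 'p) module_scheme" (structure)
    and \<alpha> :: "'i rel" and \<sigma> :: "'i \<Rightarrow> 'd \<Rightarrow> 'd" and a :: "'i \<Rightarrow> 'd"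
  assumes D_add: "\<lbrakk>d \<in> carrier D; e \<in> carrier D\<rbrakk> \<Longrightarrow> d \<oplus>\<^bsub>D\<^esub> e \<in> carrier D"
    and D_mult: "\<lbrakk>d \<in> carrier D; e \<in> carrier D\<rbrakk> \<Longrightarrow> d \<otimes>\<^bsub>D\<^esub> e \<in> carrier D"
    and D_one: "\<one>\<^bsub>D\<^esub> \<in> carrier D"
    and D_smult: "\<lbrakk>c \<in> carrier K; d \<in> carrier D\<rbrakk> \<Longrightarrow> c \<odot>\<^bsub>D\<^esub> d \<in> carrier D"
    and \<sigma>_closed: "\<lbrakk>\<beta> \<in> Field \<alpha>; d \<in> carrier D\<rbrakk> \<Longrightarrow> \<sigma> \<beta> d \<in> carrier D"
    and \<sigma>_inv_closed: "\<lbrakk>\<beta> \<in> Field \<alpha>; d \<in> carrier D\<rbrakk> \<Longrightarrow> inv_into (carrier D) (\<sigma> \<beta>) d \<in> carrier D"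
    and a_closed: "\<beta> \<in> Field \<alpha> \<Longrightarrow> a \<beta> \<in> carrier D"
begin

abbreviation "F \<equiv> free_algebra K (gwa_gens D \<alpha>)"
abbreviation "I \<equiv> gwa_ideal K D \<alpha> \<sigma> a"
abbreviation "rels \<equiv> gwa_relations K D \<alpha> \<sigma> a"
abbreviation "A \<equiv> gwa K D \<alpha> \<sigma> a"
abbreviation "gB d \<equiv> free_gen K (Base d)"
abbreviation "gX \<beta> \<equiv> free_gen K (Xplus \<beta>)"
abbreviation "gY \<beta> \<equiv> free_gen K (Xminus \<beta>)"
abbreviation "\<pi> \<equiv> (+>\<^bsub>F\<^esub>) I"
abbreviation "b \<equiv> gwa_base K D \<alpha> \<sigma> a"
abbreviation "X \<beta> \<equiv> \<pi> (gX \<beta>)"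
abbreviation "Y \<beta> \<equiv> \<pi> (gY \<beta>)"
abbreviation "\<sigma>' \<beta> \<equiv> inv_into (carrier D) (\<sigma> \<beta>)"

sublocale F: k_algebra K F
  by (rule free_algebra_k_algebra)

lemma gens_closed:
  "d \<in> carrier D \<Longrightarrow> gB d \<in> carrier F"
  "\<beta> \<in> Field \<alpha> \<Longrightarrow> gX \<beta> \<in> carrier F"
  "\<beta> \<in> Field \<alpha> \<Longrightarrow> gY \<beta> \<in> carrier F"
  by (simp_all add: gwa_gens_def free_gen_closed)

lemma gwa_relationsE:
  assumes "(p, q) \<in> rels"
  obtains
    (add) d e where "d \<in> carrier D" "e \<in> carrier D" "p = gB (d \<oplus>\<^bsub>D\<^esub> e)" "q = gB d \<oplus>\<^bsub>F\<^esub> gB e"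
  | (mult) d e where "d \<in> carrier D" "e \<in> carrier D" "p = gB (d \<otimes>\<^bsub>D\<^esub> e)" "q = gB d \<otimes>\<^bsub>F\<^esub> gB e"
  | (one) "p = gB \<one>\<^bsub>D\<^esub>" "q = \<one>\<^bsub>F\<^esub>"
  | (smult) c d where "c \<in> carrier K" "d \<in> carrier D" "p = gB (c \<odot>\<^bsub>D\<^esub> d)" "q = c \<odot>\<^bsub>F\<^esub> gB d"
  | (XB) \<beta> d where "\<beta> \<in> Field \<alpha>" "d \<in> carrier D" "p = gX \<beta> \<otimes>\<^bsub>F\<^esub> gB d" "q = gB (\<sigma> \<beta> d) \<otimes>\<^bsub>F\<^esub> gX \<beta>"
  | (YB) \<beta> d where "\<beta> \<in> Field \<alpha>" "d \<in> carrier D" "p = gY \<beta> \<otimes>\<^bsub>F\<^esub> gB d" "q = gB (\<sigma>' \<beta> d) \<otimes>\<^bsub>F\<^esub> gY \<beta>"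
  | (XX) \<beta> \<gamma> where "\<beta> \<in> Field \<alpha>" "\<gamma> \<in> Field \<alpha>" "\<beta> \<noteq> \<gamma>" "p = gX \<beta> \<otimes>\<^bsub>F\<^esub> gX \<gamma>" "q = gX \<gamma> \<otimes>\<^bsub>F\<^esub> gX \<beta>"
  | (YY) \<beta> \<gamma> where "\<beta> \<in> Field \<alpha>" "\<gamma> \<in> Field \<alpha>" "\<beta> \<noteq> \<gamma>" "p = gY \<beta> \<otimes>\<^bsub>F\<^esub> gY \<gamma>" "q = gY \<gamma> \<otimes>\<^bsub>F\<^esub> gY \<beta>"
  | (XY) \<beta> \<gamma> where "\<beta> \<in> Field \<alpha>" "\<gamma> \<in> Field \<alpha>" "\<beta> \<noteq> \<gamma>" "p = gX \<beta> \<otimes>\<^bsub>F\<^esub> gY \<gamma>" "q = gY \<gamma> \<otimes>\<^bsub>F\<^esub> gX \<beta>"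
  | (YXa) \<beta> where "\<beta> \<in> Field \<alpha>" "p = gY \<beta> \<otimes>\<^bsub>F\<^esub> gX \<beta>" "q = gB (a \<beta>)"
  | (XYa) \<beta> where "\<beta> \<in> Field \<alpha>" "p = gX \<beta> \<otimes>\<^bsub>F\<^esub> gY \<beta>" "q = gB (\<sigma> \<beta> (a \<beta>))"
  using assms unfolding gwa_relations_def Let_def Un_iff mem_Collect_eq singleton_iff prod.inject
  by (elim disjE exE conjE) metis+

lemma gwa_relations_closed:
  assumes "(p, q) \<in> rels" shows "p \<in> carrier F" "q \<in> carrier F"
  using assms
  by (auto elim!: gwa_relationsE
      simp: gens_closed D_add D_mult D_one D_smult \<sigma>_closed \<sigma>_inv_closed a_closed)

lemma relators_closed: "{p \<ominus>\<^bsub>F\<^esub> q | p q. (p, q) \<in> rels} \<subseteq> carrier F"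
  using gwa_relations_closed by auto

sublocale algebra_ideal K F I
proof (intro algebra_ideal.intro F.k_algebra_axioms)
  show "ideal I F"
    using relators_closed by (simp add: gwa_ideal_def Let_def F.A.genideal_ideal)
qed

lemma gwa_eq: "A = algebra_quot F I"
  by (simp add: gwa_def)

sublocale A: k_algebra K A
  using algebra_quot_k_algebra by (simp add: gwa_eq)

lemma proj_hom: "\<pi> \<in> k_algebra_hom K F A"
  using coset_hom by (simp add: gwa_eq)

lemmas proj_closed = k_algebra_homD(1)[OF proj_hom]
lemmas proj_add = k_algebra_homD(2)[OF proj_hom]
lemmas proj_mult = k_algebra_homD(3)[OF proj_hom]
lemmas proj_one = k_algebra_homD(4)[OF proj_hom]
lemmas proj_smult = k_algebra_homD(5)[OF proj_hom]

lemma proj_zero_iff: "f \<in> carrier F \<Longrightarrow> \<pi> f = \<zero>\<^bsub>A\<^esub> \<longleftrightarrow> f \<in> I"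
  using coset_zero_iff by (simp add: gwa_eq)

lemma proj_eq_iff: "f \<in> carrier F \<Longrightarrow> g \<in> carrier F \<Longrightarrow> \<pi> f = \<pi> g \<longleftrightarrow> f \<ominus>\<^bsub>F\<^esub> g \<in> I"
  by (rule coset_eq_iff)

lemma proj_surj: "P \<in> carrier A \<Longrightarrow> \<exists>f\<in>carrier F. P = \<pi> f"
  by (metis quot_carrierE gwa_eq)

lemma relation_in_ideal: "(p, q) \<in> rels \<Longrightarrow> p \<ominus>\<^bsub>F\<^esub> q \<in> I"
  using F.A.genideal_self[OF relators_closed] by (auto simp: gwa_ideal_def Let_def)

lemma relation: "(p, q) \<in> rels \<Longrightarrow> \<pi> p = \<pi> q"
  using gwa_relations_closed relation_in_ideal by (simp add: proj_eq_iff)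

lemma b_eq: "b d = \<pi> (gB d)"
  by (simp add: gwa_base_def)

lemma b_closed [simp]: "d \<in> carrier D \<Longrightarrow> b d \<in> carrier A"
  by (simp add: b_eq proj_closed gens_closed)

lemma X_closed [simp]: "\<beta> \<in> Field \<alpha> \<Longrightarrow> X \<beta> \<in> carrier A"
  by (simp add: proj_closed gens_closed)

lemma Y_closed [simp]: "\<beta> \<in> Field \<alpha> \<Longrightarrow> Y \<beta> \<in> carrier A"
  by (simp add: proj_closed gens_closed)

lemma gwa_relations_mem:
  "\<lbrakk>d \<in> carrier D; e \<in> carrier D\<rbrakk> \<Longrightarrow> (gB (d \<oplus>\<^bsub>D\<^esub> e), gB d \<oplus>\<^bsub>F\<^esub> gB e) \<in> rels"
  "\<lbrakk>d \<in> carrier D; e \<in> carrier D\<rbrakk> \<Longrightarrow> (gB (d \<otimes>\<^bsub>D\<^esub> e), gB d \<otimes>\<^bsub>F\<^esub> gB e) \<in> rels"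
  "(gB \<one>\<^bsub>D\<^esub>, \<one>\<^bsub>F\<^esub>) \<in> rels"
  "\<lbrakk>c \<in> carrier K; d \<in> carrier D\<rbrakk> \<Longrightarrow> (gB (c \<odot>\<^bsub>D\<^esub> d), c \<odot>\<^bsub>F\<^esub> gB d) \<in> rels"
  "\<lbrakk>\<beta> \<in> Field \<alpha>; d \<in> carrier D\<rbrakk> \<Longrightarrow> (gX \<beta> \<otimes>\<^bsub>F\<^esub> gB d, gB (\<sigma> \<beta> d) \<otimes>\<^bsub>F\<^esub> gX \<beta>) \<in> rels"
  "\<lbrakk>\<beta> \<in> Field \<alpha>; d \<in> carrier D\<rbrakk> \<Longrightarrow> (gY \<beta> \<otimes>\<^bsub>F\<^esub> gB d, gB (\<sigma>' \<beta> d) \<otimes>\<^bsub>F\<^esub> gY \<beta>) \<in> rels"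
  "\<lbrakk>\<beta> \<in> Field \<alpha>; \<gamma> \<in> Field \<alpha>; \<beta> \<noteq> \<gamma>\<rbrakk> \<Longrightarrow> (gX \<beta> \<otimes>\<^bsub>F\<^esub> gX \<gamma>, gX \<gamma> \<otimes>\<^bsub>F\<^esub> gX \<beta>) \<in> rels"
  "\<lbrakk>\<beta> \<in> Field \<alpha>; \<gamma> \<in> Field \<alpha>; \<beta> \<noteq> \<gamma>\<rbrakk> \<Longrightarrow> (gY \<beta> \<otimes>\<^bsub>F\<^esub> gY \<gamma>, gY \<gamma> \<otimes>\<^bsub>F\<^esub> gY \<beta>) \<in> rels"
  "\<lbrakk>\<beta> \<in> Field \<alpha>; \<gamma> \<in> Field \<alpha>; \<beta> \<noteq> \<gamma>\<rbrakk> \<Longrightarrow> (gX \<beta> \<otimes>\<^bsub>F\<^esub> gY \<gamma>, gY \<gamma> \<otimes>\<^bsub>F\<^esub> gX \<beta>) \<in> rels"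
  "\<beta> \<in> Field \<alpha> \<Longrightarrow> (gY \<beta> \<otimes>\<^bsub>F\<^esub> gX \<beta>, gB (a \<beta>)) \<in> rels"
  "\<beta> \<in> Field \<alpha> \<Longrightarrow> (gX \<beta> \<otimes>\<^bsub>F\<^esub> gY \<beta>, gB (\<sigma> \<beta> (a \<beta>))) \<in> rels"
  unfolding gwa_relations_def Let_def Un_iff mem_Collect_eq prod.inject singleton_iff by metis+

lemma b_add: "\<lbrakk>d \<in> carrier D; e \<in> carrier D\<rbrakk> \<Longrightarrow> b (d \<oplus>\<^bsub>D\<^esub> e) = b d \<oplus>\<^bsub>A\<^esub> b e"
  using relation[OF gwa_relations_mem(1)] by (simp add: b_eq proj_add gens_closed)

lemma b_mult: "\<lbrakk>d \<in> carrier D; e \<in> carrier D\<rbrakk> \<Longrightarrow> b (d \<otimes>\<^bsub>D\<^esub> e) = b d \<otimes>\<^bsub>A\<^esub> b e"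
  using relation[OF gwa_relations_mem(2)] by (simp add: b_eq proj_mult gens_closed)

lemma b_one: "b \<one>\<^bsub>D\<^esub> = \<one>\<^bsub>A\<^esub>"
  using relation[OF gwa_relations_mem(3)] by (simp add: b_eq proj_one)

lemma b_smult: "\<lbrakk>c \<in> carrier K; d \<in> carrier D\<rbrakk> \<Longrightarrow> b (c \<odot>\<^bsub>D\<^esub> d) = c \<odot>\<^bsub>A\<^esub> b d"
  using relation[OF gwa_relations_mem(4)] by (simp add: b_eq proj_smult gens_closed)

lemma X_b: "\<lbrakk>\<beta> \<in> Field \<alpha>; d \<in> carrier D\<rbrakk> \<Longrightarrow> X \<beta> \<otimes>\<^bsub>A\<^esub> b d = b (\<sigma> \<beta> d) \<otimes>\<^bsub>A\<^esub> X \<beta>"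
  using relation[OF gwa_relations_mem(5)] by (simp add: b_eq proj_mult gens_closed \<sigma>_closed)

lemma Y_b: "\<lbrakk>\<beta> \<in> Field \<alpha>; d \<in> carrier D\<rbrakk> \<Longrightarrow> Y \<beta> \<otimes>\<^bsub>A\<^esub> b d = b (\<sigma>' \<beta> d) \<otimes>\<^bsub>A\<^esub> Y \<beta>"
  using relation[OF gwa_relations_mem(6)] by (simp add: b_eq proj_mult gens_closed \<sigma>_inv_closed)

lemma X_X: "\<lbrakk>\<beta> \<in> Field \<alpha>; \<gamma> \<in> Field \<alpha>; \<beta> \<noteq> \<gamma>\<rbrakk> \<Longrightarrow> X \<beta> \<otimes>\<^bsub>A\<^esub> X \<gamma> = X \<gamma> \<otimes>\<^bsub>A\<^esub> X \<beta>"
  using relation[OF gwa_relations_mem(7)] by (simp add: proj_mult gens_closed)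

lemma Y_Y: "\<lbrakk>\<beta> \<in> Field \<alpha>; \<gamma> \<in> Field \<alpha>; \<beta> \<noteq> \<gamma>\<rbrakk> \<Longrightarrow> Y \<beta> \<otimes>\<^bsub>A\<^esub> Y \<gamma> = Y \<gamma> \<otimes>\<^bsub>A\<^esub> Y \<beta>"
  using relation[OF gwa_relations_mem(8)] by (simp add: proj_mult gens_closed)

lemma X_Y: "\<lbrakk>\<beta> \<in> Field \<alpha>; \<gamma> \<in> Field \<alpha>; \<beta> \<noteq> \<gamma>\<rbrakk> \<Longrightarrow> X \<beta> \<otimes>\<^bsub>A\<^esub> Y \<gamma> = Y \<gamma> \<otimes>\<^bsub>A\<^esub> X \<beta>"
  using relation[OF gwa_relations_mem(9)] by (simp add: proj_mult gens_closed)

lemma Y_X_a: "\<beta> \<in> Field \<alpha> \<Longrightarrow> Y \<beta> \<otimes>\<^bsub>A\<^esub> X \<beta> = b (a \<beta>)"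
  using relation[OF gwa_relations_mem(10)] by (simp add: b_eq proj_mult gens_closed)

lemma X_Y_a: "\<beta> \<in> Field \<alpha> \<Longrightarrow> X \<beta> \<otimes>\<^bsub>A\<^esub> Y \<beta> = b (\<sigma> \<beta> (a \<beta>))"
  using relation[OF gwa_relations_mem(11)] by (simp add: b_eq proj_mult gens_closed)

text \<open>Lifted from the free algebra along the surjection \<pi>. The unit is covered by
  \<open>base\<close>, as \<open>b\<close> preserves it.\<close>

lemma gwa_induct [consumes 1, case_names base Xplus Xminus mult add smult]:
  assumes r: "r \<in> carrier A"
    and base: "\<And>d. d \<in> carrier D \<Longrightarrow> P (b d)"
    and Xplus: "\<And>\<beta>. \<beta> \<in> Field \<alpha> \<Longrightarrow> P (X \<beta>)"
    and Xminus: "\<And>\<beta>. \<beta> \<in> Field \<alpha> \<Longrightarrow> P (Y \<beta>)"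
    and mult: "\<And>r q. \<lbrakk>r \<in> carrier A; q \<in> carrier A; P r; P q\<rbrakk> \<Longrightarrow> P (r \<otimes>\<^bsub>A\<^esub> q)"
    and add: "\<And>r q. \<lbrakk>r \<in> carrier A; q \<in> carrier A; P r; P q\<rbrakk> \<Longrightarrow> P (r \<oplus>\<^bsub>A\<^esub> q)"
    and smult: "\<And>c r. \<lbrakk>c \<in> carrier K; r \<in> carrier A; P r\<rbrakk> \<Longrightarrow> P (c \<odot>\<^bsub>A\<^esub> r)"
  shows "P r"
proof -
  have "P (\<pi> f)" if "f \<in> carrier F" for f
    using that
  proof (induction f rule: free_algebra_induct)
    case one
    then show ?case using base[OF D_one] by (simp add: b_one proj_one)
  next
    case (gen x)
    then show ?case using base Xplus Xminus by (auto simp: gwa_gens_def b_eq)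
  qed (simp_all add: proj_add proj_mult proj_smult proj_closed mult add smult)
  then show ?thesis using proj_surj[OF r] by blast
qed

text \<open>Used with two targets: the algebra over the localized base ring, which gives the
  comparison map, and the operators on the localized module, which give the action. The equations
  assumed are the eleven families of relations, read in \<open>E\<close>.\<close>

lemma universal_property:
  fixes E :: "('k, 'e, 'q) module_scheme"
  assumes E: "k_algebra K E"
    and closed: "\<And>d. d \<in> carrier D \<Longrightarrow> B d \<in> carrier E" "\<And>\<beta>. \<beta> \<in> Field \<alpha> \<Longrightarrow> U \<beta> \<in> carrier E"
      "\<And>\<beta>. \<beta> \<in> Field \<alpha> \<Longrightarrow> V \<beta> \<in> carrier E"
    and add: "\<And>d e. \<lbrakk>d \<in> carrier D; e \<in> carrier D\<rbrakk> \<Longrightarrow> B (d \<oplus>\<^bsub>D\<^esub> e) = B d \<oplus>\<^bsub>E\<^esub> B e"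
    and mult: "\<And>d e. \<lbrakk>d \<in> carrier D; e \<in> carrier D\<rbrakk> \<Longrightarrow> B (d \<otimes>\<^bsub>D\<^esub> e) = B d \<otimes>\<^bsub>E\<^esub> B e"
    and one: "B \<one>\<^bsub>D\<^esub> = \<one>\<^bsub>E\<^esub>"
    and smult: "\<And>c d. \<lbrakk>c \<in> carrier K; d \<in> carrier D\<rbrakk> \<Longrightarrow> B (c \<odot>\<^bsub>D\<^esub> d) = c \<odot>\<^bsub>E\<^esub> B d"
    and UB: "\<And>\<beta> d. \<lbrakk>\<beta> \<in> Field \<alpha>; d \<in> carrier D\<rbrakk> \<Longrightarrow> U \<beta> \<otimes>\<^bsub>E\<^esub> B d = B (\<sigma> \<beta> d) \<otimes>\<^bsub>E\<^esub> U \<beta>"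
    and VB: "\<And>\<beta> d. \<lbrakk>\<beta> \<in> Field \<alpha>; d \<in> carrier D\<rbrakk> \<Longrightarrow> V \<beta> \<otimes>\<^bsub>E\<^esub> B d = B (\<sigma>' \<beta> d) \<otimes>\<^bsub>E\<^esub> V \<beta>"
    and UU: "\<And>\<beta> \<gamma>. \<lbrakk>\<beta> \<in> Field \<alpha>; \<gamma> \<in> Field \<alpha>; \<beta> \<noteq> \<gamma>\<rbrakk> \<Longrightarrow> U \<beta> \<otimes>\<^bsub>E\<^esub> U \<gamma> = U \<gamma> \<otimes>\<^bsub>E\<^esub> U \<beta>"
    and VV: "\<And>\<beta> \<gamma>. \<lbrakk>\<beta> \<in> Field \<alpha>; \<gamma> \<in> Field \<alpha>; \<beta> \<noteq> \<gamma>\<rbrakk> \<Longrightarrow> V \<beta> \<otimes>\<^bsub>E\<^esub> V \<gamma> = V \<gamma> \<otimes>\<^bsub>E\<^esub> V \<beta>"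
    and UV: "\<And>\<beta> \<gamma>. \<lbrakk>\<beta> \<in> Field \<alpha>; \<gamma> \<in> Field \<alpha>; \<beta> \<noteq> \<gamma>\<rbrakk> \<Longrightarrow> U \<beta> \<otimes>\<^bsub>E\<^esub> V \<gamma> = V \<gamma> \<otimes>\<^bsub>E\<^esub> U \<beta>"
    and VUa: "\<And>\<beta>. \<beta> \<in> Field \<alpha> \<Longrightarrow> V \<beta> \<otimes>\<^bsub>E\<^esub> U \<beta> = B (a \<beta>)"
    and UVa: "\<And>\<beta>. \<beta> \<in> Field \<alpha> \<Longrightarrow> U \<beta> \<otimes>\<^bsub>E\<^esub> V \<beta> = B (\<sigma> \<beta> (a \<beta>))"
  obtains h where "h \<in> k_algebra_hom K A E" "\<And>d. d \<in> carrier D \<Longrightarrow> h (b d) = B d"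
    "\<And>\<beta>. \<beta> \<in> Field \<alpha> \<Longrightarrow> h (X \<beta>) = U \<beta>" "\<And>\<beta>. \<beta> \<in> Field \<alpha> \<Longrightarrow> h (Y \<beta>) = V \<beta>"
proof -
  interpret E: k_algebra K E by fact
  define \<eta> where "\<eta> x = (case x of Base d \<Rightarrow> B d | Xplus \<beta> \<Rightarrow> U \<beta> | Xminus \<beta> \<Rightarrow> V \<beta>)" for x
  interpret ev: free_evaluation K E "gwa_gens D \<alpha>" \<eta>
    by unfold_locales (auto simp: gwa_gens_def \<eta>_def closed)
  let ?\<epsilon> = "free_eval K E \<eta>"
  note \<epsilon>_hom = ev.free_eval_hom
  note \<epsilon> = k_algebra_homD[OF \<epsilon>_hom]
  have \<epsilon>_gens: "d \<in> carrier D \<Longrightarrow> ?\<epsilon> (gB d) = B d" "\<beta> \<in> Field \<alpha> \<Longrightarrow> ?\<epsilon> (gX \<beta>) = U \<beta>"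
    "\<beta> \<in> Field \<alpha> \<Longrightarrow> ?\<epsilon> (gY \<beta>) = V \<beta>" for d \<beta>
    by (simp_all add: ev.free_eval_gen gwa_gens_def \<eta>_def)
  interpret \<epsilon>: ring_hom_ring F E ?\<epsilon>
    using \<epsilon>_hom by (intro ring_hom_ringI2 F.A.ring_axioms E.A.ring_axioms) (simp add: k_algebra_hom_def)
  have "?\<epsilon> p = ?\<epsilon> q" if "(p, q) \<in> rels" for p q
    using that
    by (cases rule: gwa_relationsE)
      (simp_all add: \<epsilon>_gens \<epsilon>(2,3,5) gens_closed D_add D_mult D_one D_smult \<sigma>_closed \<sigma>_inv_closed
        a_closed add mult one smult UB VB UU VV UV VUa UVa)
  then have "?\<epsilon> (p \<ominus>\<^bsub>F\<^esub> q) = \<zero>\<^bsub>E\<^esub>" if "(p, q) \<in> rels" for p q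
  proof -
    have "?\<epsilon> p = ?\<epsilon> q" "p \<in> carrier F" "q \<in> carrier F"
      using that gwa_relations_closed[OF that] \<open>\<And>p q. (p, q) \<in> rels \<Longrightarrow> ?\<epsilon> p = ?\<epsilon> q\<close> by blast+
    then show ?thesis
      using k_algebra_hom_minus(2)[OF F.k_algebra_axioms E \<epsilon>_hom] \<epsilon>(1)[of q] E.M.r_neg
      by (metis a_minus_def)
  qed
  then have "{p \<ominus>\<^bsub>F\<^esub> q | p q. (p, q) \<in> rels} \<subseteq> a_kernel F E ?\<epsilon>"
    using relators_closed unfolding a_kernel_def' by blast
  then have ker: "I \<subseteq> a_kernel F E ?\<epsilon>"
    unfolding gwa_ideal_def Let_def by (intro F.A.genideal_minimal \<epsilon>.kernel_is_ideal)
  have wd: "?\<epsilon> f = ?\<epsilon> g" if "f \<in> carrier F" "g \<in> carrier F" "\<pi> f = \<pi> g" for f g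
  proof -
    have "f \<ominus>\<^bsub>F\<^esub> g \<in> a_kernel F E ?\<epsilon>" using that ker by (auto simp: proj_eq_iff)
    then have "?\<epsilon> (f \<ominus>\<^bsub>F\<^esub> g) = \<zero>\<^bsub>E\<^esub>" unfolding a_kernel_def' by blast
    then have "?\<epsilon> f \<ominus>\<^bsub>E\<^esub> ?\<epsilon> g = \<zero>\<^bsub>E\<^esub>"
      using k_algebra_hom_minus(2)[OF F.k_algebra_axioms E \<epsilon>_hom that(1,2)] by metis
    then show ?thesis using E.M.minus_eq_zeroD \<epsilon>(1) that(1,2) by blast
  qed
  \<comment> \<open>An element of the quotient is evaluated at a chosen preimage; by
    \<open>wd\<close> the value does not depend on the choice.\<close>
  define h where "h P = ?\<epsilon> (SOME f. f \<in> carrier F \<and> \<pi> f = P)" for P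
  have h: "h (\<pi> f) = ?\<epsilon> f" if "f \<in> carrier F" for f
    unfolding h_def by (rule someI2[of _ f]) (use that wd in blast)+
  show thesis
  proof
    have "h x \<in> carrier E" if "x \<in> carrier A" for x
      using proj_surj[OF that] h \<epsilon>(1) by auto
    moreover have "h (x \<oplus>\<^bsub>A\<^esub> y) = h x \<oplus>\<^bsub>E\<^esub> h y" "h (x \<otimes>\<^bsub>A\<^esub> y) = h x \<otimes>\<^bsub>E\<^esub> h y"
      if "x \<in> carrier A" "y \<in> carrier A" for x y
      using proj_surj[OF that(1)] proj_surj[OF that(2)]
      by (auto simp: h \<epsilon> simp flip: proj_add proj_mult)
    moreover have "h (c \<odot>\<^bsub>A\<^esub> x) = c \<odot>\<^bsub>E\<^esub> h x" if "c \<in> carrier K" "x \<in> carrier A" for c x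
      using proj_surj[OF that(2)] that(1) by (auto simp: h \<epsilon> simp flip: proj_smult)
    moreover have "h \<one>\<^bsub>A\<^esub> = \<one>\<^bsub>E\<^esub>" using h[OF F.A.one_closed] by (simp add: proj_one \<epsilon>)
    ultimately show "h \<in> k_algebra_hom K A E" by (simp add: k_algebra_hom_def ring_hom_memI)
  qed (simp_all add: b_eq h \<epsilon>_gens gens_closed)
qed

end

section \<open>The Ore conditions\<close>

locale gwa_localization = gwa_data K D \<alpha> \<sigma> a
  for K :: "('k, 'm) ring_scheme" (structure) and D :: "('k, 'd, 'p) module_scheme" (structure)
    and \<alpha> :: "'i rel" and \<sigma> :: "'i \<Rightarrow> 'd \<Rightarrow> 'd" and a :: "'i \<Rightarrow> 'd" +
  fixes S :: "'d set"
  assumes S_submonoid: "submonoid S D"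
    and S_center: "S \<subseteq> ring_center D"
    and S_regular: "\<forall>s \<in> S. regular_element D s"
    and S_stable: "\<forall>\<beta> \<in> Field \<alpha>. \<forall>j :: int. aut_pow D (\<sigma> \<beta>) j ` S \<subseteq> S"
begin

abbreviation "\<sigma>' \<beta> \<equiv> inv_into (carrier D) (\<sigma> \<beta>)"

lemma \<sigma>_bij: "\<beta> \<in> Field \<alpha> \<Longrightarrow> bij_betw (\<sigma> \<beta>) (carrier D) (carrier D)"
  using automorphism by (auto simp: k_algebra_iso_def ring_iso_def)

lemma \<sigma>_closed [simp]: "\<beta> \<in> Field \<alpha> \<Longrightarrow> d \<in> carrier D \<Longrightarrow> \<sigma> \<beta> d \<in> carrier D"
  using \<sigma>_bij bij_betwE by blast

lemma \<sigma>'_closed [simp]: "\<beta> \<in> Field \<alpha> \<Longrightarrow> d \<in> carrier D \<Longrightarrow> \<sigma>' \<beta> d \<in> carrier D"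
  by (metis \<sigma>_bij bij_betw_imp_surj_on inv_into_into)

lemma \<sigma>_\<sigma>' [simp]: "\<beta> \<in> Field \<alpha> \<Longrightarrow> d \<in> carrier D \<Longrightarrow> \<sigma> \<beta> (\<sigma>' \<beta> d) = d"
  using \<sigma>_bij bij_betw_inv_into_right by metis

lemma \<sigma>'_\<sigma> [simp]: "\<beta> \<in> Field \<alpha> \<Longrightarrow> d \<in> carrier D \<Longrightarrow> \<sigma>' \<beta> (\<sigma> \<beta> d) = d"
  using \<sigma>_bij bij_betw_inv_into_left by metis

lemma \<sigma>_hom:
  assumes "\<beta> \<in> Field \<alpha>"
  shows "d \<in> carrier D \<Longrightarrow> e \<in> carrier D \<Longrightarrow> \<sigma> \<beta> (d \<oplus>\<^bsub>D\<^esub> e) = \<sigma> \<beta> d \<oplus>\<^bsub>D\<^esub> \<sigma> \<beta> e"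
    and "d \<in> carrier D \<Longrightarrow> e \<in> carrier D \<Longrightarrow> \<sigma> \<beta> (d \<otimes>\<^bsub>D\<^esub> e) = \<sigma> \<beta> d \<otimes>\<^bsub>D\<^esub> \<sigma> \<beta> e"
    and "\<sigma> \<beta> \<one>\<^bsub>D\<^esub> = \<one>\<^bsub>D\<^esub>"
    and "c \<in> carrier K \<Longrightarrow> d \<in> carrier D \<Longrightarrow> \<sigma> \<beta> (c \<odot>\<^bsub>D\<^esub> d) = c \<odot>\<^bsub>D\<^esub> \<sigma> \<beta> d"
  using automorphism[OF assms] by (auto simp: k_algebra_iso_def ring_iso_def ring_hom_def)

lemma \<sigma>'_eqI: "\<lbrakk>\<beta> \<in> Field \<alpha>; d \<in> carrier D; e \<in> carrier D; \<sigma> \<beta> e = d\<rbrakk> \<Longrightarrow> \<sigma>' \<beta> d = e"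
  using \<sigma>'_\<sigma> by blast

lemma \<sigma>'_hom:
  assumes "\<beta> \<in> Field \<alpha>"
  shows "d \<in> carrier D \<Longrightarrow> e \<in> carrier D \<Longrightarrow> \<sigma>' \<beta> (d \<otimes>\<^bsub>D\<^esub> e) = \<sigma>' \<beta> d \<otimes>\<^bsub>D\<^esub> \<sigma>' \<beta> e"
    and "\<sigma>' \<beta> \<one>\<^bsub>D\<^esub> = \<one>\<^bsub>D\<^esub>"
  using assms by (auto intro!: \<sigma>'_eqI simp: \<sigma>_hom)

lemma \<sigma>_\<sigma>'_commute:
  assumes "\<beta> \<in> Field \<alpha>" "\<gamma> \<in> Field \<alpha>" "d \<in> carrier D"
  shows "\<sigma> \<beta> (\<sigma>' \<gamma> d) = \<sigma>' \<gamma> (\<sigma> \<beta> d)"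
  using assms commuting[of \<beta> \<gamma> "\<sigma>' \<gamma> d"] by (intro \<sigma>'_eqI[symmetric]) auto

lemma \<sigma>'_commute:
  assumes "\<beta> \<in> Field \<alpha>" "\<gamma> \<in> Field \<alpha>" "d \<in> carrier D"
  shows "\<sigma>' \<beta> (\<sigma>' \<gamma> d) = \<sigma>' \<gamma> (\<sigma>' \<beta> d)"
  using assms \<sigma>_\<sigma>'_commute[of \<beta> \<gamma> "\<sigma>' \<beta> d"] by (intro \<sigma>'_eqI) auto

lemma a_closed [simp]: "\<beta> \<in> Field \<alpha> \<Longrightarrow> a \<beta> \<in> carrier D"
  using central by (auto simp: ring_center_def)

lemma S_closed [simp]: "s \<in> S \<Longrightarrow> s \<in> carrier D"
  using S_center by (auto simp: ring_center_def)

lemma S_one [simp]: "\<one>\<^bsub>D\<^esub> \<in> S"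
  using submonoid.one_closed[OF S_submonoid] .

lemma S_mult [simp]: "s \<in> S \<Longrightarrow> t \<in> S \<Longrightarrow> s \<otimes>\<^bsub>D\<^esub> t \<in> S"
  using submonoid.m_closed[OF S_submonoid] .

lemma S_central: "s \<in> S \<Longrightarrow> d \<in> carrier D \<Longrightarrow> s \<otimes>\<^bsub>D\<^esub> d = d \<otimes>\<^bsub>D\<^esub> s"
  using S_center by (auto simp: ring_center_def)

lemma S_\<sigma> [simp]: "\<beta> \<in> Field \<alpha> \<Longrightarrow> s \<in> S \<Longrightarrow> \<sigma> \<beta> s \<in> S"
  using S_stable[rule_format, of \<beta> 1] by (auto simp: aut_pow_def)

lemma S_\<sigma>' [simp]: "\<beta> \<in> Field \<alpha> \<Longrightarrow> s \<in> S \<Longrightarrow> \<sigma>' \<beta> s \<in> S"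
  using S_stable[rule_format, of \<beta> "-1"] by (auto simp: aut_pow_def)

sublocale G: gwa_presentation K D \<alpha> \<sigma> a
  by unfold_locales simp_all

lemma b_commute: "s \<in> S \<Longrightarrow> d \<in> carrier D \<Longrightarrow> G.b s \<otimes>\<^bsub>G.A\<^esub> G.b d = G.b d \<otimes>\<^bsub>G.A\<^esub> G.b s"
  using S_central by (simp flip: G.b_mult)

text \<open>The elements \<open>r\<close> that can be passed in this way for every \<open>s\<close>
  form a subalgebra, so generators suffice: base elements commute with \<open>S\<close>, while
  \<open>X \<beta> s = (\<sigma> \<beta> s) X \<beta>\<close> and
  \<open>Y \<beta> s = (\<sigma>' \<beta> s) Y \<beta>\<close> have multipliers in the stable set
  \<open>S\<close>. Keeping \<open>s\<close> arbitrary matters for products, where the second factor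
  changes the denominator met by the first.\<close>

lemma left_ore:
  assumes "r \<in> carrier G.A" "s \<in> S"
  shows "\<exists>s'\<in>S. \<exists>r'\<in>carrier G.A. G.b s' \<otimes>\<^bsub>G.A\<^esub> r = r' \<otimes>\<^bsub>G.A\<^esub> G.b s"
  using assms
proof (induction r arbitrary: s rule: G.gwa_induct)
  case (base d)
  then show ?case using b_commute by (intro bexI[of _ s] bexI[of _ "G.b d"]) simp_all
next
  case (Xplus \<beta>)
  then show ?case by (intro bexI[of _ "\<sigma> \<beta> s"] bexI[of _ "G.X \<beta>"]) (simp_all add: G.X_b)
next
  case (Xminus \<beta>)
  then show ?case by (intro bexI[of _ "\<sigma>' \<beta> s"] bexI[of _ "G.Y \<beta>"]) (simp_all add: G.Y_b)
next
  case (mult r q)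
  obtain s1 q' where 1: "s1 \<in> S" "q' \<in> carrier G.A" "G.b s1 \<otimes>\<^bsub>G.A\<^esub> q = q' \<otimes>\<^bsub>G.A\<^esub> G.b s"
    using mult.IH(2)[OF mult.prems] by blast
  obtain s2 r' where 2: "s2 \<in> S" "r' \<in> carrier G.A" "G.b s2 \<otimes>\<^bsub>G.A\<^esub> r = r' \<otimes>\<^bsub>G.A\<^esub> G.b s1"
    using mult.IH(1)[OF 1(1)] by blast
  have "G.b s2 \<otimes>\<^bsub>G.A\<^esub> (r \<otimes>\<^bsub>G.A\<^esub> q) = (G.b s2 \<otimes>\<^bsub>G.A\<^esub> r) \<otimes>\<^bsub>G.A\<^esub> q"
    using 2(1) mult.hyps by (simp add: G.A.A.m_assoc)
  also have "\<dots> = r' \<otimes>\<^bsub>G.A\<^esub> (G.b s1 \<otimes>\<^bsub>G.A\<^esub> q)"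
    using 1(1) 2 mult.hyps by (simp add: G.A.A.m_assoc)
  also have "\<dots> = (r' \<otimes>\<^bsub>G.A\<^esub> q') \<otimes>\<^bsub>G.A\<^esub> G.b s"
    using 1 2(2) mult.prems by (simp add: G.A.A.m_assoc)
  finally show ?case using 1 2 by blast
next
  case (add r q)
  obtain s1 r' where 1: "s1 \<in> S" "r' \<in> carrier G.A" "G.b s1 \<otimes>\<^bsub>G.A\<^esub> r = r' \<otimes>\<^bsub>G.A\<^esub> G.b s"
    using add by blast
  obtain s2 q' where 2: "s2 \<in> S" "q' \<in> carrier G.A" "G.b s2 \<otimes>\<^bsub>G.A\<^esub> q = q' \<otimes>\<^bsub>G.A\<^esub> G.b s"
    using add by blast
  \<comment> \<open>Both summands are brought to the common multiplier \<open>s1 s2\<close>, which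
    is possible because elements of \<open>S\<close> commute.\<close>
  have "G.b (s1 \<otimes>\<^bsub>D\<^esub> s2) \<otimes>\<^bsub>G.A\<^esub> r = G.b s2 \<otimes>\<^bsub>G.A\<^esub> r' \<otimes>\<^bsub>G.A\<^esub> G.b s"
    using 1 2 add by (simp add: G.b_mult b_commute[of s1 s2] G.A.A.m_assoc)
  moreover have "G.b (s1 \<otimes>\<^bsub>D\<^esub> s2) \<otimes>\<^bsub>G.A\<^esub> q = G.b s1 \<otimes>\<^bsub>G.A\<^esub> q' \<otimes>\<^bsub>G.A\<^esub> G.b s"
    using 1 2 add by (simp add: G.b_mult G.A.A.m_assoc)
  ultimately have "G.b (s1 \<otimes>\<^bsub>D\<^esub> s2) \<otimes>\<^bsub>G.A\<^esub> (r \<oplus>\<^bsub>G.A\<^esub> q) =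
      (G.b s2 \<otimes>\<^bsub>G.A\<^esub> r' \<oplus>\<^bsub>G.A\<^esub> G.b s1 \<otimes>\<^bsub>G.A\<^esub> q') \<otimes>\<^bsub>G.A\<^esub> G.b s"
    using 1 2 add by (simp add: G.A.A.r_distr G.A.A.l_distr)
  then show ?case using 1 2
    by (intro bexI[of _ "s1 \<otimes>\<^bsub>D\<^esub> s2"] bexI[of _ "G.b s2 \<otimes>\<^bsub>G.A\<^esub> r' \<oplus>\<^bsub>G.A\<^esub> G.b s1 \<otimes>\<^bsub>G.A\<^esub> q'"]) simp_all
next
  case (smult c r)
  obtain s1 r' where 1: "s1 \<in> S" "r' \<in> carrier G.A" "G.b s1 \<otimes>\<^bsub>G.A\<^esub> r = r' \<otimes>\<^bsub>G.A\<^esub> G.b s"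
    using smult by blast
  then have "G.b s1 \<otimes>\<^bsub>G.A\<^esub> (c \<odot>\<^bsub>G.A\<^esub> r) = (c \<odot>\<^bsub>G.A\<^esub> r') \<otimes>\<^bsub>G.A\<^esub> G.b s"
    using smult by (simp add: G.A.smult_mult_left G.A.smult_mult_right)
  then show ?case using 1 smult by blast
qed

text \<open>Mirror image of \<open>left_ore\<close>: the witness for \<open>X \<beta>\<close> is now
  \<open>\<sigma>' \<beta> s\<close>, because
  \<open>X \<beta> (\<sigma>' \<beta> s) = s X \<beta>\<close>, and in a product the first factor is
  treated first.\<close>

lemma right_ore:
  assumes "r \<in> carrier G.A" "s \<in> S"
  shows "\<exists>s'\<in>S. \<exists>r'\<in>carrier G.A. r \<otimes>\<^bsub>G.A\<^esub> G.b s' = G.b s \<otimes>\<^bsub>G.A\<^esub> r'"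
  using assms
proof (induction r arbitrary: s rule: G.gwa_induct)
  case (base d)
  then show ?case using b_commute by (intro bexI[of _ s] bexI[of _ "G.b d"]) simp_all
next
  case (Xplus \<beta>)
  then show ?case by (intro bexI[of _ "\<sigma>' \<beta> s"] bexI[of _ "G.X \<beta>"]) (simp_all add: G.X_b)
next
  case (Xminus \<beta>)
  then show ?case by (intro bexI[of _ "\<sigma> \<beta> s"] bexI[of _ "G.Y \<beta>"]) (simp_all add: G.Y_b)
next
  case (mult r q)
  obtain s1 r' where 1: "s1 \<in> S" "r' \<in> carrier G.A" "r \<otimes>\<^bsub>G.A\<^esub> G.b s1 = G.b s \<otimes>\<^bsub>G.A\<^esub> r'"
    using mult.IH(1)[OF mult.prems] by blast
  obtain s2 q' where 2: "s2 \<in> S" "q' \<in> carrier G.A" "q \<otimes>\<^bsub>G.A\<^esub> G.b s2 = G.b s1 \<otimes>\<^bsub>G.A\<^esub> q'"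
    using mult.IH(2)[OF 1(1)] by blast
  have "(r \<otimes>\<^bsub>G.A\<^esub> q) \<otimes>\<^bsub>G.A\<^esub> G.b s2 = (r \<otimes>\<^bsub>G.A\<^esub> G.b s1) \<otimes>\<^bsub>G.A\<^esub> q'"
    using 1(1,2) 2 mult by (simp add: G.A.A.m_assoc)
  also have "\<dots> = G.b s \<otimes>\<^bsub>G.A\<^esub> (r' \<otimes>\<^bsub>G.A\<^esub> q')"
    using 1 2 mult by (simp add: G.A.A.m_assoc)
  finally show ?case using 1 2 by blast
next
  case (add r q)
  obtain s1 r' where 1: "s1 \<in> S" "r' \<in> carrier G.A" "r \<otimes>\<^bsub>G.A\<^esub> G.b s1 = G.b s \<otimes>\<^bsub>G.A\<^esub> r'"
    using add by blast
  obtain s2 q' where 2: "s2 \<in> S" "q' \<in> carrier G.A" "q \<otimes>\<^bsub>G.A\<^esub> G.b s2 = G.b s \<otimes>\<^bsub>G.A\<^esub> q'"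
    using add by blast
  have "r \<otimes>\<^bsub>G.A\<^esub> G.b (s1 \<otimes>\<^bsub>D\<^esub> s2) = G.b s \<otimes>\<^bsub>G.A\<^esub> (r' \<otimes>\<^bsub>G.A\<^esub> G.b s2)"
    using 1 2 add by (simp add: G.b_mult flip: G.A.A.m_assoc)
  moreover have "q \<otimes>\<^bsub>G.A\<^esub> G.b (s1 \<otimes>\<^bsub>D\<^esub> s2) = G.b s \<otimes>\<^bsub>G.A\<^esub> (q' \<otimes>\<^bsub>G.A\<^esub> G.b s1)"
    using 1 2 add by (simp add: G.b_mult b_commute[of s1 s2] flip: G.A.A.m_assoc)
  ultimately have "(r \<oplus>\<^bsub>G.A\<^esub> q) \<otimes>\<^bsub>G.A\<^esub> G.b (s1 \<otimes>\<^bsub>D\<^esub> s2) =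
      G.b s \<otimes>\<^bsub>G.A\<^esub> (r' \<otimes>\<^bsub>G.A\<^esub> G.b s2 \<oplus>\<^bsub>G.A\<^esub> q' \<otimes>\<^bsub>G.A\<^esub> G.b s1)"
    using 1 2 add by (simp add: G.A.A.r_distr G.A.A.l_distr)
  then show ?case using 1 2
    by (intro bexI[of _ "s1 \<otimes>\<^bsub>D\<^esub> s2"] bexI[of _ "r' \<otimes>\<^bsub>G.A\<^esub> G.b s2 \<oplus>\<^bsub>G.A\<^esub> q' \<otimes>\<^bsub>G.A\<^esub> G.b s1"]) simp_all
next
  case (smult c r)
  obtain s1 r' where 1: "s1 \<in> S" "r' \<in> carrier G.A" "r \<otimes>\<^bsub>G.A\<^esub> G.b s1 = G.b s \<otimes>\<^bsub>G.A\<^esub> r'"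
    using smult by blast
  then have "(c \<odot>\<^bsub>G.A\<^esub> r) \<otimes>\<^bsub>G.A\<^esub> G.b s1 = G.b s \<otimes>\<^bsub>G.A\<^esub> (c \<odot>\<^bsub>G.A\<^esub> r')"
    using smult by (simp add: G.A.smult_mult_left G.A.smult_mult_right)
  then show ?case using 1 smult by blast
qed

section \<open>The grading by the automorphisms\<close>

text \<open>
  A word \<open>w\<close> satisfies \<open>s w = w (shift s w)\<close> for \<open>s \<in> S\<close>. Both sides of a relation take the
  same value under \<open>shift s\<close>, so the ideal of relations is graded by this value. Left multiplication
  changes \<open>s\<close>, hence \<open>graded_part\<close> quantifies over all \<open>s\<close>.
\<close>

fun shift1 :: "'d \<Rightarrow> ('d, 'i) gwa_gen \<Rightarrow> 'd" where
  "shift1 s (Base d) = s"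
| "shift1 s (Xplus \<beta>) = \<sigma>' \<beta> s"
| "shift1 s (Xminus \<beta>) = \<sigma> \<beta> s"

abbreviation "shift \<equiv> foldl shift1"

text \<open>A set \<open>T\<close> of degrees, rather than a single degree, because right
  multiplication by a letter pulls \<open>T\<close> back along \<open>shift1\<close>, and the
  preimage of a singleton need not be a singleton outside \<open>carrier D\<close>. Finite sets
  \<open>T\<close> also occur when an element is assembled from its components.\<close>

definition part :: "'d \<Rightarrow> 'd set \<Rightarrow> (('d, 'i) gwa_gen list \<Rightarrow> 'k) \<Rightarrow> ('d, 'i) gwa_gen list \<Rightarrow> 'k"
  where "part s T f = (\<lambda>w. if shift s w \<in> T then f w else \<zero>)"

definition homogeneous :: "'d \<Rightarrow> 'd \<Rightarrow> (('d, 'i) gwa_gen list \<Rightarrow> 'k) \<Rightarrow> bool"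
  where "homogeneous s e f \<longleftrightarrow> (\<forall>w. f w \<noteq> \<zero> \<longrightarrow> shift s w = e)"

definition graded_part :: "(('d, 'i) gwa_gen list \<Rightarrow> 'k) set"
  where "graded_part = {f \<in> carrier G.F. \<forall>s\<in>carrier D. \<forall>T. part s T f \<in> G.I}"

lemma shift1_S: "x \<in> gwa_gens D \<alpha> \<Longrightarrow> s \<in> S \<Longrightarrow> shift1 s x \<in> S"
  by (cases x) (auto simp: gwa_gens_def)

lemma shift1_closed: "x \<in> gwa_gens D \<alpha> \<Longrightarrow> s \<in> carrier D \<Longrightarrow> shift1 s x \<in> carrier D"
  by (cases x) (auto simp: gwa_gens_def)

lemma shift_S: "w \<in> lists (gwa_gens D \<alpha>) \<Longrightarrow> s \<in> S \<Longrightarrow> shift s w \<in> S"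
  by (induction w arbitrary: s) (auto simp: shift1_S)

lemma part_closed: "f \<in> carrier G.F \<Longrightarrow> part s T f \<in> carrier G.F"
  by (auto simp: free_algebra_simps part_def elim: rev_finite_subset)

lemma part_add:
  "f \<in> carrier G.F \<Longrightarrow> g \<in> carrier G.F \<Longrightarrow> part s T (f \<oplus>\<^bsub>G.F\<^esub> g) = part s T f \<oplus>\<^bsub>G.F\<^esub> part s T g"
  by (auto simp: free_algebra_simps part_def)

lemma part_smult: "c \<in> carrier K \<Longrightarrow> part s T (c \<odot>\<^bsub>G.F\<^esub> f) = c \<odot>\<^bsub>G.F\<^esub> part s T f"
  by (auto simp: free_algebra_simps part_def)

lemma part_gen_mult:
  assumes f: "f \<in> carrier G.F"
  shows "part s T (free_gen K x \<otimes>\<^bsub>G.F\<^esub> f) = free_gen K x \<otimes>\<^bsub>G.F\<^esub> part (shift1 s x) T f"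
proof
  fix w
  show "part s T (free_gen K x \<otimes>\<^bsub>G.F\<^esub> f) w = (free_gen K x \<otimes>\<^bsub>G.F\<^esub> part (shift1 s x) T f) w"
    using free_algebra_range[OF f] free_algebra_range[OF part_closed[OF f]]
    by (cases w) (simp_all add: part_def[of s T] free_gen_mult, simp add: part_def)
qed

text \<open>The last letter acts on the final value; so here, unlike in
  \<open>part_gen_mult\<close>, the starting value \<open>s\<close> stays and the condition on the
  degree is pulled back.\<close>

lemma part_mult_gen:
  assumes f: "f \<in> carrier G.F"
  shows "part s T (f \<otimes>\<^bsub>G.F\<^esub> free_gen K x) = part s {e. shift1 e x \<in> T} f \<otimes>\<^bsub>G.F\<^esub> free_gen K x"
proof
  fix w
  show "part s T (f \<otimes>\<^bsub>G.F\<^esub> free_gen K x) w = (part s {e. shift1 e x \<in> T} f \<otimes>\<^bsub>G.F\<^esub> free_gen K x) w"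
    using free_algebra_range[OF f] free_algebra_range[OF part_closed[OF f]]
    by (cases w rule: rev_cases) (simp_all add: part_def[of s T] mult_free_gen, simp add: part_def)
qed

lemma graded_part_add:
  "f \<in> graded_part \<Longrightarrow> g \<in> graded_part \<Longrightarrow> f \<oplus>\<^bsub>G.F\<^esub> g \<in> graded_part"
  by (auto simp: graded_part_def part_add G.I.a_closed)

lemma graded_part_smult: "c \<in> carrier K \<Longrightarrow> f \<in> graded_part \<Longrightarrow> c \<odot>\<^bsub>G.F\<^esub> f \<in> graded_part"
  by (auto simp: graded_part_def part_smult G.smult_ideal)

lemma graded_part_l:
  assumes "g \<in> carrier G.F" "f \<in> graded_part" shows "g \<otimes>\<^bsub>G.F\<^esub> f \<in> graded_part"
  using assms
proof (induction g arbitrary: f rule: free_algebra_induct)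
  case one
  then show ?case by (simp add: graded_part_def)
next
  case (gen x)
  then show ?case
    by (auto simp: graded_part_def part_gen_mult free_gen_closed shift1_closed G.I.I_l_closed)
next
  case (mult g g')
  then have "f \<in> carrier G.F" by (simp add: graded_part_def)
  with mult show ?case by (simp add: G.F.A.m_assoc)
next
  case (add g g')
  then have "f \<in> carrier G.F" by (simp add: graded_part_def)
  with add show ?case by (simp add: G.F.A.l_distr graded_part_add)
next
  case (smult c g)
  then have "f \<in> carrier G.F" by (simp add: graded_part_def)
  with smult show ?case by (simp add: G.F.smult_mult_left graded_part_smult)
qed

lemma graded_part_r:
  assumes "g \<in> carrier G.F" "f \<in> graded_part" shows "f \<otimes>\<^bsub>G.F\<^esub> g \<in> graded_part"
  using assms
proof (induction g arbitrary: f rule: free_algebra_induct)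
  case one
  then show ?case by (simp add: graded_part_def)
next
  case (gen x)
  then show ?case
    by (auto simp: graded_part_def part_mult_gen free_gen_closed G.I.I_r_closed)
next
  case (mult g g')
  then have "f \<in> carrier G.F" by (simp add: graded_part_def)
  with mult show ?case by (simp flip: G.F.A.m_assoc)
next
  case (add g g')
  then have "f \<in> carrier G.F" by (simp add: graded_part_def)
  with add show ?case by (simp add: G.F.A.r_distr graded_part_add)
next
  case (smult c g)
  then have "f \<in> carrier G.F" by (simp add: graded_part_def)
  with smult show ?case by (simp add: G.F.smult_mult_right graded_part_smult)
qed

lemma graded_part_ideal: "ideal graded_part G.F"
proof (rule idealI)
  show "subgroup graded_part (add_monoid G.F)"
  proof (rule G.F.M.add.subgroupI)
    have "\<zero>\<^bsub>G.F\<^esub> \<in> graded_part"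
      using G.I.zero_closed by (auto simp: graded_part_def part_def free_algebra_simps(3))
    then show "graded_part \<noteq> {}" by blast
    fix f assume f: "f \<in> graded_part"
    then have "\<ominus>\<^bsub>G.F\<^esub> f = (\<ominus> \<one>) \<odot>\<^bsub>G.F\<^esub> f"
      by (simp add: graded_part_def G.F.smult_l_minus)
    then show "\<ominus>\<^bsub>G.F\<^esub> f \<in> graded_part" using f by (simp add: graded_part_smult)
  qed (auto simp: graded_part_add, auto simp: graded_part_def)
qed (use graded_part_l graded_part_r G.F.A.ring_axioms in auto)

section \<open>Homogeneity of the defining relations\<close>

lemma homogeneous_gens:
  "homogeneous s s (G.gB d)" "homogeneous s (\<sigma>' \<beta> s) (G.gX \<beta>)" "homogeneous s (\<sigma> \<beta> s) (G.gY \<beta>)"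
  "homogeneous s s \<one>\<^bsub>G.F\<^esub>"
  by (auto simp: homogeneous_def free_gen_def free_algebra_simps)

lemma homogeneous_add: "homogeneous s e f \<Longrightarrow> homogeneous s e g \<Longrightarrow> homogeneous s e (f \<oplus>\<^bsub>G.F\<^esub> g)"
  by (force simp: homogeneous_def free_algebra_simps)

lemma homogeneous_smult: "c \<in> carrier K \<Longrightarrow> homogeneous s e f \<Longrightarrow> homogeneous s e (c \<odot>\<^bsub>G.F\<^esub> f)"
  by (force simp: homogeneous_def free_algebra_simps)

text \<open>Degrees compose like maps: \<open>f\<close> leads from \<open>s\<close> to
  \<open>e\<close>, and \<open>g\<close> continues from \<open>e\<close>.\<close>

lemma homogeneous_mult:
  assumes "f \<in> carrier G.F" "g \<in> carrier G.F" "homogeneous s e f" "homogeneous e e' g"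
  shows "homogeneous s e' (f \<otimes>\<^bsub>G.F\<^esub> g)"
  unfolding homogeneous_def
proof (intro allI impI)
  fix w assume "(f \<otimes>\<^bsub>G.F\<^esub> g) w \<noteq> \<zero>"
  then obtain u v where "w = u @ v" "f u \<noteq> \<zero>" "g v \<noteq> \<zero>"
    using free_mult_supp[OF free_algebra_range[OF assms(1)] free_algebra_range[OF assms(2)]] by blast
  then show "shift s w = e'" using assms(3,4) by (simp add: homogeneous_def)
qed

text \<open>Base letters leave the value unchanged, which settles the families that only move or
  combine base letters. The families \<open>XX\<close>, \<open>YY\<close>, \<open>XY\<close> hold
  because the automorphisms and their inverses commute, and \<open>YXa\<close>, \<open>XYa\<close>
  because \<open>\<sigma>' \<beta>\<close> and \<open>\<sigma> \<beta>\<close> cancel. These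
  identities are available on \<open>carrier D\<close>, hence the condition on
  \<open>s\<close>.\<close>

lemma homogeneous_relation:
  assumes "(p, q) \<in> G.rels" and s: "s \<in> carrier D"
  shows "\<exists>e. homogeneous s e p \<and> homogeneous s e q"
  using assms(1)
proof (cases rule: G.gwa_relationsE)
  case (add d e)
  then show ?thesis using homogeneous_gens(1) homogeneous_add by blast
next
  case (mult d e)
  have "homogeneous s s q" unfolding mult(4)
    by (rule homogeneous_mult[OF _ _ homogeneous_gens(1) homogeneous_gens(1)])
      (use mult in \<open>simp_all add: G.gens_closed\<close>)
  with homogeneous_gens(1) show ?thesis unfolding mult(3) by blast
next
  case one
  then show ?thesis using homogeneous_gens by blast
next
  case (smult c d)
  then show ?thesis using homogeneous_gens(1) homogeneous_smult by blast
next
  case (XB \<beta> d)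
  have "homogeneous s (\<sigma>' \<beta> s) p" unfolding XB(3)
    by (rule homogeneous_mult[OF _ _ homogeneous_gens(2) homogeneous_gens(1)])
      (use XB in \<open>simp_all add: G.gens_closed\<close>)
  moreover have "homogeneous s (\<sigma>' \<beta> s) q" unfolding XB(4)
    by (rule homogeneous_mult[OF _ _ homogeneous_gens(1) homogeneous_gens(2)])
      (use XB in \<open>simp_all add: G.gens_closed\<close>)
  ultimately show ?thesis by blast
next
  case (YB \<beta> d)
  have "homogeneous s (\<sigma> \<beta> s) p" unfolding YB(3)
    by (rule homogeneous_mult[OF _ _ homogeneous_gens(3) homogeneous_gens(1)])
      (use YB in \<open>simp_all add: G.gens_closed\<close>)
  moreover have "homogeneous s (\<sigma> \<beta> s) q" unfolding YB(4)
    by (rule homogeneous_mult[OF _ _ homogeneous_gens(1) homogeneous_gens(3)])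
      (use YB in \<open>simp_all add: G.gens_closed\<close>)
  ultimately show ?thesis by blast
next
  case (XX \<beta> \<gamma>)
  have "homogeneous s (\<sigma>' \<gamma> (\<sigma>' \<beta> s)) p" unfolding XX(4)
    by (rule homogeneous_mult[OF _ _ homogeneous_gens(2) homogeneous_gens(2)])
      (use XX in \<open>simp_all add: G.gens_closed\<close>)
  moreover have "homogeneous s (\<sigma>' \<beta> (\<sigma>' \<gamma> s)) q" unfolding XX(5)
    by (rule homogeneous_mult[OF _ _ homogeneous_gens(2) homogeneous_gens(2)])
      (use XX in \<open>simp_all add: G.gens_closed\<close>)
  ultimately show ?thesis using \<sigma>'_commute[OF XX(1,2) s] by metis
next
  case (YY \<beta> \<gamma>)
  have "homogeneous s (\<sigma> \<gamma> (\<sigma> \<beta> s)) p" unfolding YY(4)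
    by (rule homogeneous_mult[OF _ _ homogeneous_gens(3) homogeneous_gens(3)])
      (use YY in \<open>simp_all add: G.gens_closed\<close>)
  moreover have "homogeneous s (\<sigma> \<beta> (\<sigma> \<gamma> s)) q" unfolding YY(5)
    by (rule homogeneous_mult[OF _ _ homogeneous_gens(3) homogeneous_gens(3)])
      (use YY in \<open>simp_all add: G.gens_closed\<close>)
  ultimately show ?thesis using commuting[OF YY(1,2) s] by metis
next
  case (XY \<beta> \<gamma>)
  have "homogeneous s (\<sigma> \<gamma> (\<sigma>' \<beta> s)) p" unfolding XY(4)
    by (rule homogeneous_mult[OF _ _ homogeneous_gens(2) homogeneous_gens(3)])
      (use XY in \<open>simp_all add: G.gens_closed\<close>)
  moreover have "homogeneous s (\<sigma>' \<beta> (\<sigma> \<gamma> s)) q" unfolding XY(5)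
    by (rule homogeneous_mult[OF _ _ homogeneous_gens(3) homogeneous_gens(2)])
      (use XY in \<open>simp_all add: G.gens_closed\<close>)
  ultimately show ?thesis using \<sigma>_\<sigma>'_commute[OF XY(2,1) s] by metis
next
  case (YXa \<beta>)
  have "homogeneous s (\<sigma>' \<beta> (\<sigma> \<beta> s)) p" unfolding YXa(2)
    by (rule homogeneous_mult[OF _ _ homogeneous_gens(3) homogeneous_gens(2)])
      (use YXa in \<open>simp_all add: G.gens_closed\<close>)
  moreover have "homogeneous s s q" unfolding YXa(3) by (rule homogeneous_gens)
  ultimately show ?thesis using \<sigma>'_\<sigma>[OF YXa(1) s] by metis
next
  case (XYa \<beta>)
  have "homogeneous s (\<sigma> \<beta> (\<sigma>' \<beta> s)) p" unfolding XYa(2)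
    by (rule homogeneous_mult[OF _ _ homogeneous_gens(2) homogeneous_gens(3)])
      (use XYa in \<open>simp_all add: G.gens_closed\<close>)
  moreover have "homogeneous s s q" unfolding XYa(3) by (rule homogeneous_gens)
  ultimately show ?thesis using \<sigma>_\<sigma>'[OF XYa(1) s] by metis
qed

text \<open>As \<open>graded_part\<close> is an ideal, it suffices to test the relators. A relator
  is homogeneous for each starting value, so each of its components is either the whole relator or
  zero.\<close>

lemma ideal_graded: "G.I \<subseteq> graded_part"
proof -
  have "p \<ominus>\<^bsub>G.F\<^esub> q \<in> graded_part" if pq: "(p, q) \<in> G.rels" for p q
  proof -
    note closed = G.gwa_relations_closed[OF pq]
    \<comment> \<open>Written as a sum with a scalar multiple, to which the closure properties of
      homogeneity apply.\<close>
    have minus: "p \<ominus>\<^bsub>G.F\<^esub> q = p \<oplus>\<^bsub>G.F\<^esub> (\<ominus> \<one>) \<odot>\<^bsub>G.F\<^esub> q"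
      using closed by (simp add: a_minus_def G.F.smult_l_minus)
    have "part s T (p \<ominus>\<^bsub>G.F\<^esub> q) \<in> G.I" if s: "s \<in> carrier D" for s T
    proof -
      obtain e where "homogeneous s e p" "homogeneous s e q"
        using homogeneous_relation[OF pq s] by blast
      then have "homogeneous s e (p \<ominus>\<^bsub>G.F\<^esub> q)"
        unfolding minus by (intro homogeneous_add homogeneous_smult) simp_all
      then have "part s T (p \<ominus>\<^bsub>G.F\<^esub> q) = (if e \<in> T then p \<ominus>\<^bsub>G.F\<^esub> q else \<zero>\<^bsub>G.F\<^esub>)"
        by (cases "e \<in> T") (simp_all add: homogeneous_def part_def fun_eq_iff free_algebra_simps(3), metis+)
      then show ?thesis using G.relation_in_ideal[OF pq] G.I.zero_closed by metis
    qed
    moreover have "p \<ominus>\<^bsub>G.F\<^esub> q \<in> carrier G.F" using closed by simp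
    ultimately show ?thesis unfolding graded_part_def by blast
  qed
  then show ?thesis
    unfolding gwa_ideal_def Let_def
    by (intro G.F.A.genideal_minimal graded_part_ideal subsetI) (elim CollectE exE conjE, simp only:)
qed

section \<open>Moving denominators through homogeneous elements\<close>

lemma mono_shift:
  assumes "w \<in> lists (gwa_gens D \<alpha>)" "s \<in> S"
  shows "G.b s \<otimes>\<^bsub>G.A\<^esub> G.\<pi> (\<lambda>v. if v = w then \<one> else \<zero>) =
    G.\<pi> (\<lambda>v. if v = w then \<one> else \<zero>) \<otimes>\<^bsub>G.A\<^esub> G.b (shift s w)"
  using assms
proof (induction w arbitrary: s)
  case Nil
  have "G.\<pi> (\<lambda>v. if v = [] then \<one> else \<zero>) = \<one>\<^bsub>G.A\<^esub>"
    using G.proj_one by (simp add: free_algebra_simps(2))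
  with Nil show ?case by simp
next
  case (Cons x w)
  let ?m = "\<lambda>w v. if v = w then \<one> else \<zero>"
  have m: "G.\<pi> (?m w) \<in> carrier G.A" using Cons by (intro G.proj_closed mono_closed)
  have x: "x \<in> gwa_gens D \<alpha>" "G.\<pi> (free_gen K x) \<in> carrier G.A"
    using Cons by (auto intro!: G.proj_closed free_gen_closed)
  \<comment> \<open>Base letters commute with \<open>s\<close> because \<open>S\<close> is central
    in \<open>D\<close>; for \<open>Xplus \<beta>\<close> the value
    \<open>\<sigma>' \<beta> s\<close> is the one that \<open>X \<beta>\<close> turns back into
    \<open>s\<close>. All intermediate values stay in \<open>S\<close>, so the argument can be
    repeated letter by letter.\<close>
  have "G.b s \<otimes>\<^bsub>G.A\<^esub> G.\<pi> (free_gen K x) = G.\<pi> (free_gen K x) \<otimes>\<^bsub>G.A\<^esub> G.b (shift1 s x)"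
  proof (cases x)
    case (Base d)
    with x(1) have "d \<in> carrier D" by (auto simp: gwa_gens_def)
    then show ?thesis using b_commute[OF Cons.prems] by (simp add: Base G.b_eq)
  next
    case (Xplus \<beta>)
    with x(1) have "\<beta> \<in> Field \<alpha>" by (auto simp: gwa_gens_def)
    then show ?thesis using G.X_b[of \<beta> "\<sigma>' \<beta> s"] Cons.prems by (simp add: Xplus)
  next
    case (Xminus \<beta>)
    with x(1) have "\<beta> \<in> Field \<alpha>" by (auto simp: gwa_gens_def)
    then show ?thesis using G.Y_b[of \<beta> "\<sigma> \<beta> s"] Cons.prems by (simp add: Xminus)
  qed
  moreover have "G.\<pi> (?m (x # w)) = G.\<pi> (free_gen K x) \<otimes>\<^bsub>G.A\<^esub> G.\<pi> (?m w)"
    using x(1) Cons.hyps Cons.prems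
    by (simp add: mono_Cons[where x = x and w = w and G = "gwa_gens D \<alpha>"] G.proj_mult free_gen_closed mono_closed)
  moreover have "G.b (shift1 s x) \<in> carrier G.A" "G.b (shift s (x # w)) \<in> carrier G.A" "G.b s \<in> carrier G.A"
    using Cons.prems shift1_S[OF x(1)] shift_S[OF Cons.hyps(2)] by simp_all
  moreover have "G.b (shift1 s x) \<otimes>\<^bsub>G.A\<^esub> G.\<pi> (?m w) = G.\<pi> (?m w) \<otimes>\<^bsub>G.A\<^esub> G.b (shift s (x # w))"
    using Cons shift1_S[OF x(1)] by simp
  ultimately show ?case using m x(2)
    by (metis G.A.A.m_assoc)
qed

text \<open>All words of the component have the same degree \<open>e\<close> at \<open>s\<close>, so
  one and the same \<open>e\<close> appears to the right of every monomial.\<close>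

lemma part_shift:
  assumes f: "f \<in> carrier G.F" and s: "s \<in> S" and e: "e \<in> S"
  shows "G.b s \<otimes>\<^bsub>G.A\<^esub> G.\<pi> (part s {e} f) = G.\<pi> (part s {e} f) \<otimes>\<^bsub>G.A\<^esub> G.b e"
proof (rule free_algebra_span[OF part_closed[OF f]])
  show "G.b s \<otimes>\<^bsub>G.A\<^esub> G.\<pi> \<zero>\<^bsub>G.F\<^esub> = G.\<pi> \<zero>\<^bsub>G.F\<^esub> \<otimes>\<^bsub>G.A\<^esub> G.b e"
    using s e by (simp add: k_algebra_hom_minus(1)[OF G.F.k_algebra_axioms G.A.k_algebra_axioms G.proj_hom])
next
  fix g h assume "g \<in> carrier G.F" "h \<in> carrier G.F" "G.b s \<otimes>\<^bsub>G.A\<^esub> G.\<pi> g = G.\<pi> g \<otimes>\<^bsub>G.A\<^esub> G.b e"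
    "G.b s \<otimes>\<^bsub>G.A\<^esub> G.\<pi> h = G.\<pi> h \<otimes>\<^bsub>G.A\<^esub> G.b e"
  then show "G.b s \<otimes>\<^bsub>G.A\<^esub> G.\<pi> (g \<oplus>\<^bsub>G.F\<^esub> h) = G.\<pi> (g \<oplus>\<^bsub>G.F\<^esub> h) \<otimes>\<^bsub>G.A\<^esub> G.b e"
    using s e by (simp add: G.proj_add G.proj_closed G.A.A.l_distr G.A.A.r_distr)
next
  fix c w assume c: "c \<in> carrier K" and w: "w \<in> lists (gwa_gens D \<alpha>)" and "part s {e} f w \<noteq> \<zero>"
  then have "shift s w = e" by (simp add: part_def split: if_splits)
  then show "G.b s \<otimes>\<^bsub>G.A\<^esub> G.\<pi> (c \<odot>\<^bsub>G.F\<^esub> (\<lambda>v. if v = w then \<one> else \<zero>)) =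
      G.\<pi> (c \<odot>\<^bsub>G.F\<^esub> (\<lambda>v. if v = w then \<one> else \<zero>)) \<otimes>\<^bsub>G.A\<^esub> G.b e"
    using mono_shift[OF w s] c w s e
    by (simp add: G.proj_smult mono_closed G.proj_closed G.A.smult_mult_left G.A.smult_mult_right
        del: lists_eq_set)
qed

text \<open>Split a preimage \<open>f\<close> of \<open>r\<close> into its finitely many components
  \<open>f_e\<close> for the starting value \<open>s\<close>. Since the ideal is graded and contains
  \<open>s f\<close>, each \<open>s f_e\<close> vanishes in the algebra. But
  \<open>s f_e = f_e e\<close>, so each component is killed on the right by its own degree
  \<open>e \<in> S\<close>, and the product of these degrees kills \<open>r\<close>.\<close>

lemma right_reversible:
  assumes r: "r \<in> carrier G.A" and s: "s \<in> S" and sr: "G.b s \<otimes>\<^bsub>G.A\<^esub> r = \<zero>\<^bsub>G.A\<^esub>"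
  shows "\<exists>s'\<in>S. r \<otimes>\<^bsub>G.A\<^esub> G.b s' = \<zero>\<^bsub>G.A\<^esub>"
proof -
  obtain f where f: "f \<in> carrier G.F" "r = G.\<pi> f" using G.proj_surj[OF r] by blast
  have sf: "G.gB s \<otimes>\<^bsub>G.F\<^esub> f \<in> G.I"
    using sr f s by (simp add: G.b_eq G.gens_closed flip: G.proj_mult G.proj_zero_iff)
  have kill: "G.\<pi> (part s {e} f) \<otimes>\<^bsub>G.A\<^esub> G.b e = \<zero>\<^bsub>G.A\<^esub>" if "e \<in> S" for e
  proof -
    have "G.\<pi> (part s {e} f) \<otimes>\<^bsub>G.A\<^esub> G.b e = G.b s \<otimes>\<^bsub>G.A\<^esub> G.\<pi> (part s {e} f)"
      using part_shift[OF f(1) s that] by simp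
    also have "\<dots> = G.\<pi> (part s {e} (G.gB s \<otimes>\<^bsub>G.F\<^esub> f))"
      \<comment> \<open>The letter \<open>Base s\<close> does not change the value, so taking the
        component commutes with left multiplication by \<open>s\<close>.\<close>
      using f s by (simp add: G.b_eq part_gen_mult part_closed G.proj_mult G.gens_closed)
    also have "\<dots> = \<zero>\<^bsub>G.A\<^esub>"
      using ideal_graded sf s f by (subst G.proj_zero_iff) (auto simp: graded_part_def G.gens_closed part_closed)
    finally show ?thesis .
  qed
  have "\<exists>s'\<in>S. G.\<pi> (part s T f) \<otimes>\<^bsub>G.A\<^esub> G.b s' = \<zero>\<^bsub>G.A\<^esub>" if "finite T" "T \<subseteq> S" for T
    using that
  proof (induction T)
    case empty
    have "part s {} f = \<zero>\<^bsub>G.F\<^esub>" by (simp add: part_def free_algebra_simps(3))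
    then show ?case
      by (intro bexI[of _ "\<one>\<^bsub>D\<^esub>"])
        (simp_all add: k_algebra_hom_minus(1)[OF G.F.k_algebra_axioms G.A.k_algebra_axioms G.proj_hom])
  next
    case (insert e T)
    then obtain s' where s': "s' \<in> S" "G.\<pi> (part s T f) \<otimes>\<^bsub>G.A\<^esub> G.b s' = \<zero>\<^bsub>G.A\<^esub>" by auto
    have "part s (insert e T) f = part s {e} f \<oplus>\<^bsub>G.F\<^esub> part s T f"
      using insert(2) free_algebra_range[OF f(1)] by (auto simp: part_def free_algebra_simps(4) fun_eq_iff)
    then have "G.\<pi> (part s (insert e T) f) \<otimes>\<^bsub>G.A\<^esub> G.b (e \<otimes>\<^bsub>D\<^esub> s') =
        (G.\<pi> (part s {e} f) \<otimes>\<^bsub>G.A\<^esub> G.b e) \<otimes>\<^bsub>G.A\<^esub> G.b s' \<oplus>\<^bsub>G.A\<^esub>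
        (G.\<pi> (part s T f) \<otimes>\<^bsub>G.A\<^esub> G.b s') \<otimes>\<^bsub>G.A\<^esub> G.b e"
      using insert s'(1) f b_commute[of s' e]
      by (simp add: G.proj_add part_closed G.proj_closed G.A.A.l_distr G.b_mult G.A.A.m_assoc)
    also have "\<dots> = \<zero>\<^bsub>G.A\<^esub>" using kill insert s' by simp
    finally show ?case using insert s' by (intro bexI[of _ "e \<otimes>\<^bsub>D\<^esub> s'"]) simp_all
  qed
  \<comment> \<open>The degrees of the words in the support form a finite subset of
    \<open>S\<close>, and the components at these degrees exhaust \<open>f\<close>.\<close>
  from this[of "shift s ` {w. f w \<noteq> \<zero>}"]
  have "\<exists>s'\<in>S. G.\<pi> (part s (shift s ` {w. f w \<noteq> \<zero>}) f) \<otimes>\<^bsub>G.A\<^esub> G.b s' = \<zero>\<^bsub>G.A\<^esub>"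
    using f(1) shift_S[OF _ s] by (force simp: free_algebra_simps)
  moreover have "part s (shift s ` {w. f w \<noteq> \<zero>}) f = f" by (rule ext) (auto simp: part_def)
  ultimately show ?thesis using f(2) by simp
qed

end

section \<open>The localized base ring\<close>

text \<open>The operations of \<open>localization\<close>, and \<open>loc_map\<close>, are unions
  over choices of representatives. Such a union is computed by exhibiting one choice and showing
  that all choices give the same class.\<close>

lemma Union_eqI: "A \<noteq> {} \<Longrightarrow> (\<And>X. X \<in> A \<Longrightarrow> X = U) \<Longrightarrow> \<Union>A = U"
  by auto

context gwa_localization
begin

abbreviation "fr \<equiv> left_frac D S"
abbreviation "DS \<equiv> localization D S"

lemma S_lcomm:
  "s \<in> S \<Longrightarrow> d \<in> carrier D \<Longrightarrow> e \<in> carrier D \<Longrightarrow> d \<otimes>\<^bsub>D\<^esub> (s \<otimes>\<^bsub>D\<^esub> e) = s \<otimes>\<^bsub>D\<^esub> (d \<otimes>\<^bsub>D\<^esub> e)"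
  using S_central[of s d] by (metis A.m_assoc S_closed)

lemma regular_cancel:
  assumes "regular_element D x" "y \<in> carrier D" "z \<in> carrier D" "x \<otimes>\<^bsub>D\<^esub> y = x \<otimes>\<^bsub>D\<^esub> z"
  shows "y = z"
proof -
  have "x \<otimes>\<^bsub>D\<^esub> (y \<ominus>\<^bsub>D\<^esub> z) = \<zero>\<^bsub>D\<^esub>"
    using assms by (simp add: regular_element_def a_minus_def A.r_distr A.r_minus M.r_neg)
  then have "y \<ominus>\<^bsub>D\<^esub> z = \<zero>\<^bsub>D\<^esub>"
    using assms(1) M.minus_closed[OF assms(2,3)] unfolding regular_element_def by blast
  then show ?thesis using assms(2,3) M.minus_eq_zeroD by blast
qed

lemma S_cancel:
  "\<lbrakk>s \<in> S; x \<in> carrier D; y \<in> carrier D; s \<otimes>\<^bsub>D\<^esub> x = s \<otimes>\<^bsub>D\<^esub> y\<rbrakk> \<Longrightarrow> x = y"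
  using S_regular regular_cancel by blast

text \<open>Centrality makes denominators commute and regularity cancels the auxiliary multiplier,
  so the Ore equivalence becomes plain cross multiplication.\<close>

lemma frac_mem_iff:
  assumes s: "s \<in> S" and r: "r \<in> carrier D"
  shows "(t, q) \<in> fr s r \<longleftrightarrow> t \<in> S \<and> q \<in> carrier D \<and> s \<otimes>\<^bsub>D\<^esub> q = t \<otimes>\<^bsub>D\<^esub> r"
proof
  assume "(t, q) \<in> fr s r"
  then obtain c d where t: "t \<in> S" and q: "q \<in> carrier D" and c: "c \<in> carrier D" and d: "d \<in> carrier D"
    and eq: "c \<otimes>\<^bsub>D\<^esub> s = d \<otimes>\<^bsub>D\<^esub> t" "c \<otimes>\<^bsub>D\<^esub> s \<in> S" "c \<otimes>\<^bsub>D\<^esub> r = d \<otimes>\<^bsub>D\<^esub> q"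
    by (auto simp: left_frac_def)
  \<comment> \<open>The element \<open>c s\<close> lies in \<open>S\<close>: both sides of the claim
    are compared after multiplication by it, and it is cancelled at the end.\<close>
  have "(c \<otimes>\<^bsub>D\<^esub> s) \<otimes>\<^bsub>D\<^esub> (s \<otimes>\<^bsub>D\<^esub> q) = s \<otimes>\<^bsub>D\<^esub> ((c \<otimes>\<^bsub>D\<^esub> s) \<otimes>\<^bsub>D\<^esub> q)"
    using s c q by (simp add: S_lcomm)
  also have "\<dots> = s \<otimes>\<^bsub>D\<^esub> (d \<otimes>\<^bsub>D\<^esub> (t \<otimes>\<^bsub>D\<^esub> q))"
    unfolding eq(1) using s t d q by (simp add: A.m_assoc)
  also have "\<dots> = s \<otimes>\<^bsub>D\<^esub> (t \<otimes>\<^bsub>D\<^esub> (c \<otimes>\<^bsub>D\<^esub> r))"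
    using t d q by (simp add: eq(3) S_lcomm[OF t d q])
  also have "\<dots> = (c \<otimes>\<^bsub>D\<^esub> s) \<otimes>\<^bsub>D\<^esub> (t \<otimes>\<^bsub>D\<^esub> r)"
    using s t c r by (metis A.m_assoc A.m_closed S_closed S_lcomm)
  finally show "t \<in> S \<and> q \<in> carrier D \<and> s \<otimes>\<^bsub>D\<^esub> q = t \<otimes>\<^bsub>D\<^esub> r"
    using S_cancel[OF eq(2)] s t q r by simp
next
  assume "t \<in> S \<and> q \<in> carrier D \<and> s \<otimes>\<^bsub>D\<^esub> q = t \<otimes>\<^bsub>D\<^esub> r"
  then have tq: "t \<in> S" "q \<in> carrier D" "t \<otimes>\<^bsub>D\<^esub> r = s \<otimes>\<^bsub>D\<^esub> q" by simp_all
  have "\<exists>c\<in>carrier D. \<exists>d\<in>carrier D. c \<otimes>\<^bsub>D\<^esub> s = d \<otimes>\<^bsub>D\<^esub> t \<and> c \<otimes>\<^bsub>D\<^esub> s \<in> S \<and> c \<otimes>\<^bsub>D\<^esub> r = d \<otimes>\<^bsub>D\<^esub> q"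
    \<comment> \<open>The common multiple of \<open>s\<close> and \<open>t\<close> is
      \<open>t s = s t\<close>.\<close>
    by (rule bexI[of _ t], rule bexI[of _ s]) (use s tq S_central[of s t] in simp_all)
  with tq show "(t, q) \<in> fr s r" by (simp add: left_frac_def)
qed

lemma frac_refl: "s \<in> S \<Longrightarrow> r \<in> carrier D \<Longrightarrow> (s, r) \<in> fr s r"
  by (simp add: frac_mem_iff)

lemma frac_trans:
  assumes "s \<in> S" "t \<in> S" "u \<in> S" "r \<in> carrier D" "q \<in> carrier D" "p \<in> carrier D"
    "s \<otimes>\<^bsub>D\<^esub> q = t \<otimes>\<^bsub>D\<^esub> r" "t \<otimes>\<^bsub>D\<^esub> p = u \<otimes>\<^bsub>D\<^esub> q"
  shows "s \<otimes>\<^bsub>D\<^esub> p = u \<otimes>\<^bsub>D\<^esub> r"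
proof (rule S_cancel[OF assms(2)])
  have "t \<otimes>\<^bsub>D\<^esub> (s \<otimes>\<^bsub>D\<^esub> p) = s \<otimes>\<^bsub>D\<^esub> (t \<otimes>\<^bsub>D\<^esub> p)" using assms by (simp add: S_lcomm)
  also have "\<dots> = u \<otimes>\<^bsub>D\<^esub> (s \<otimes>\<^bsub>D\<^esub> q)" unfolding assms(8) using assms(1-6) by (simp add: S_lcomm)
  also have "\<dots> = t \<otimes>\<^bsub>D\<^esub> (u \<otimes>\<^bsub>D\<^esub> r)" unfolding assms(7) using assms(1-6) by (simp add: S_lcomm)
  finally show "t \<otimes>\<^bsub>D\<^esub> (s \<otimes>\<^bsub>D\<^esub> p) = t \<otimes>\<^bsub>D\<^esub> (u \<otimes>\<^bsub>D\<^esub> r)" .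
qed (use assms in simp_all)

lemma frac_eq_iff:
  assumes "s \<in> S" "t \<in> S" "r \<in> carrier D" "q \<in> carrier D"
  shows "fr s r = fr t q \<longleftrightarrow> s \<otimes>\<^bsub>D\<^esub> q = t \<otimes>\<^bsub>D\<^esub> r"
proof
  assume "fr s r = fr t q"
  then have "(t, q) \<in> fr s r" using assms frac_refl by simp
  then show "s \<otimes>\<^bsub>D\<^esub> q = t \<otimes>\<^bsub>D\<^esub> r" using assms by (simp add: frac_mem_iff)
next
  assume eq: "s \<otimes>\<^bsub>D\<^esub> q = t \<otimes>\<^bsub>D\<^esub> r"
  have "(u, p) \<in> fr s r \<longleftrightarrow> (u, p) \<in> fr t q" for u p
    unfolding frac_mem_iff[OF assms(1,3)] frac_mem_iff[OF assms(2,4)]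
    using frac_trans[OF assms(1,2) _ assms(3,4) _ eq] frac_trans[OF assms(2,1) _ assms(4,3) _ eq[symmetric]]
    by blast
  then show "fr s r = fr t q" by (intro equalityI subrelI) blast+
qed

lemma DS_carrierE:
  assumes "P \<in> carrier DS" obtains s r where "s \<in> S" "r \<in> carrier D" "P = fr s r"
  using assms by (auto simp: localization_def)

lemma frac_closed [simp]: "s \<in> S \<Longrightarrow> r \<in> carrier D \<Longrightarrow> fr s r \<in> carrier DS"
  by (auto simp: localization_def)

lemma frac_cancel:
  "s \<in> S \<Longrightarrow> t \<in> S \<Longrightarrow> r \<in> carrier D \<Longrightarrow> fr (t \<otimes>\<^bsub>D\<^esub> s) (t \<otimes>\<^bsub>D\<^esub> r) = fr s r"
  using S_lcomm[of t s r] by (simp add: frac_eq_iff A.m_assoc)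

text \<open>Equal denominators suffice, since \<open>DS_common_denominatorE\<close> brings any two
  fractions into this form.\<close>

lemma DS_add:
  assumes s: "s \<in> S" and r: "r \<in> carrier D" and q: "q \<in> carrier D"
  shows "fr s r \<oplus>\<^bsub>DS\<^esub> fr s q = fr s (r \<oplus>\<^bsub>D\<^esub> q)"
  unfolding localization_def ring.simps
proof (rule Union_eqI, goal_cases)
  case 1
  have "(s, r) \<in> fr s r" "(s, q) \<in> fr s q" using s r q frac_refl by auto
  moreover have "\<one>\<^bsub>D\<^esub> \<otimes>\<^bsub>D\<^esub> s \<in> S" using s by simp
  ultimately show ?case using A.one_closed by blast
next
  case (2 X)
  then obtain s1 r1 t1 q1 c d where X: "X = fr (c \<otimes>\<^bsub>D\<^esub> s1) (c \<otimes>\<^bsub>D\<^esub> r1 \<oplus>\<^bsub>D\<^esub> d \<otimes>\<^bsub>D\<^esub> q1)"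
    and m: "(s1, r1) \<in> fr s r" "(t1, q1) \<in> fr s q" and c: "c \<in> carrier D" "d \<in> carrier D"
    and eq: "c \<otimes>\<^bsub>D\<^esub> s1 = d \<otimes>\<^bsub>D\<^esub> t1" "c \<otimes>\<^bsub>D\<^esub> s1 \<in> S"
    by auto
  have 1: "s1 \<in> S" "r1 \<in> carrier D" "s \<otimes>\<^bsub>D\<^esub> r1 = s1 \<otimes>\<^bsub>D\<^esub> r"
    and 2: "t1 \<in> S" "q1 \<in> carrier D" "s \<otimes>\<^bsub>D\<^esub> q1 = t1 \<otimes>\<^bsub>D\<^esub> q"
    using m s r q by (simp_all add: frac_mem_iff)
  have "s \<otimes>\<^bsub>D\<^esub> (c \<otimes>\<^bsub>D\<^esub> r1) = c \<otimes>\<^bsub>D\<^esub> (s \<otimes>\<^bsub>D\<^esub> r1)" using S_lcomm[of s c r1] s c 1(2) by simp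
  also have "\<dots> = (c \<otimes>\<^bsub>D\<^esub> s1) \<otimes>\<^bsub>D\<^esub> r" unfolding 1(3) using c 1(1,2) r by (simp add: A.m_assoc)
  finally have a: "s \<otimes>\<^bsub>D\<^esub> (c \<otimes>\<^bsub>D\<^esub> r1) = (c \<otimes>\<^bsub>D\<^esub> s1) \<otimes>\<^bsub>D\<^esub> r" .
  have "s \<otimes>\<^bsub>D\<^esub> (d \<otimes>\<^bsub>D\<^esub> q1) = d \<otimes>\<^bsub>D\<^esub> (s \<otimes>\<^bsub>D\<^esub> q1)" using S_lcomm[of s d q1] s c 2(2) by simp
  also have "\<dots> = (c \<otimes>\<^bsub>D\<^esub> s1) \<otimes>\<^bsub>D\<^esub> q" unfolding 2(3) eq(1) using c 2(1,2) q by (simp add: A.m_assoc)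
  finally have b: "s \<otimes>\<^bsub>D\<^esub> (d \<otimes>\<^bsub>D\<^esub> q1) = (c \<otimes>\<^bsub>D\<^esub> s1) \<otimes>\<^bsub>D\<^esub> q" .
  show ?case unfolding X using a b s r q c 1(1,2) 2(1,2) eq(2)
    by (subst frac_eq_iff) (simp_all add: A.r_distr)
qed

lemma DS_mult:
  assumes s: "s \<in> S" and t: "t \<in> S" and r: "r \<in> carrier D" and q: "q \<in> carrier D"
  shows "fr s r \<otimes>\<^bsub>DS\<^esub> fr t q = fr (s \<otimes>\<^bsub>D\<^esub> t) (r \<otimes>\<^bsub>D\<^esub> q)"
  unfolding localization_def monoid.simps
proof (rule Union_eqI, goal_cases)
  case 1
  have "(s, r) \<in> fr s r" "(t, q) \<in> fr t q" using s t r q frac_refl by auto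
  \<comment> \<open>An admissible choice is \<open>u = t\<close> and \<open>c = r\<close>, since
    \<open>t r = r t\<close>.\<close>
  with t r S_central[OF t r] show ?case by blast
next
  case (2 X)
  then obtain s1 r1 t1 q1 u c where X: "X = fr (u \<otimes>\<^bsub>D\<^esub> s1) (c \<otimes>\<^bsub>D\<^esub> q1)"
    and m: "(s1, r1) \<in> fr s r" "(t1, q1) \<in> fr t q" and c: "u \<in> S" "c \<in> carrier D"
    and eq: "u \<otimes>\<^bsub>D\<^esub> r1 = c \<otimes>\<^bsub>D\<^esub> t1"
    by auto
  have 1: "s1 \<in> S" "r1 \<in> carrier D" "s \<otimes>\<^bsub>D\<^esub> r1 = s1 \<otimes>\<^bsub>D\<^esub> r"
    and 2: "t1 \<in> S" "q1 \<in> carrier D" "t \<otimes>\<^bsub>D\<^esub> q1 = t1 \<otimes>\<^bsub>D\<^esub> q"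
    using m s t r q by (simp_all add: frac_mem_iff)
  have "u \<otimes>\<^bsub>D\<^esub> s1 \<otimes>\<^bsub>D\<^esub> (r \<otimes>\<^bsub>D\<^esub> q) = u \<otimes>\<^bsub>D\<^esub> (s1 \<otimes>\<^bsub>D\<^esub> r) \<otimes>\<^bsub>D\<^esub> q"
    using c 1(1) r q by (simp add: A.m_assoc)
  also have "\<dots> = s \<otimes>\<^bsub>D\<^esub> (u \<otimes>\<^bsub>D\<^esub> r1) \<otimes>\<^bsub>D\<^esub> q"
    unfolding 1(3)[symmetric] using S_lcomm[of s u r1] s c 1(2) by simp
  also have "\<dots> = s \<otimes>\<^bsub>D\<^esub> (c \<otimes>\<^bsub>D\<^esub> (t1 \<otimes>\<^bsub>D\<^esub> q))"
    unfolding eq using s c 2(1) q by (simp add: A.m_assoc)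
  also have "\<dots> = s \<otimes>\<^bsub>D\<^esub> t \<otimes>\<^bsub>D\<^esub> (c \<otimes>\<^bsub>D\<^esub> q1)"
    unfolding 2(3)[symmetric] using s t c 2(2) S_lcomm[of t c q1] by (simp add: A.m_assoc)
  finally show ?case unfolding X using s t r q c 1(1,2) 2(1,2)
    by (subst frac_eq_iff) simp_all
qed

lemma DS_smult:
  assumes k: "k \<in> carrier K" and s: "s \<in> S" and r: "r \<in> carrier D"
  shows "k \<odot>\<^bsub>DS\<^esub> fr s r = fr s (k \<odot>\<^bsub>D\<^esub> r)"
  unfolding localization_def module.simps
proof (rule Union_eqI, goal_cases)
  case 1
  then show ?case using frac_refl[OF s r] by blast
next
  case (2 X)
  then obtain s1 r1 where X: "X = fr s1 (k \<odot>\<^bsub>D\<^esub> r1)" and m: "(s1, r1) \<in> fr s r" by auto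
  have 1: "s1 \<in> S" "r1 \<in> carrier D" "s \<otimes>\<^bsub>D\<^esub> r1 = s1 \<otimes>\<^bsub>D\<^esub> r"
    using m s r by (simp_all add: frac_mem_iff)
  show ?case unfolding X using k s r 1 by (subst frac_eq_iff) (simp_all add: smult_mult_right)
qed

lemma DS_one: "\<one>\<^bsub>DS\<^esub> = fr \<one>\<^bsub>D\<^esub> \<one>\<^bsub>D\<^esub>"
  by (simp add: localization_def)

lemma loc_map_frac:
  assumes \<beta>: "\<beta> \<in> Field \<alpha>" and s: "s \<in> S" and r: "r \<in> carrier D"
  shows "loc_map D S (\<sigma> \<beta>) (fr s r) = fr (\<sigma> \<beta> s) (\<sigma> \<beta> r)"
  unfolding loc_map_def
proof (rule Union_eqI, goal_cases)
  case 1
  then show ?case using frac_refl[OF s r] by blast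
next
  case (2 X)
  then obtain s1 r1 where X: "X = fr (\<sigma> \<beta> s1) (\<sigma> \<beta> r1)" and m: "(s1, r1) \<in> fr s r" by auto
  have 1: "s1 \<in> S" "r1 \<in> carrier D" "s \<otimes>\<^bsub>D\<^esub> r1 = s1 \<otimes>\<^bsub>D\<^esub> r"
    using m s r by (simp_all add: frac_mem_iff)
  show ?case unfolding X using \<beta> s r 1 by (subst frac_eq_iff) (simp_all flip: \<sigma>_hom)
qed

text \<open>The presentation over the localized ring is written with the inverse of
  \<open>loc_map\<close>. Injectivity of \<open>loc_map\<close> comes from cross multiplication and
  injectivity of \<open>\<sigma> \<beta>\<close>; a preimage is found by applying
  \<open>\<sigma>' \<beta>\<close> to numerator and denominator.\<close>

lemma loc_map_inv_frac:
  assumes \<beta>: "\<beta> \<in> Field \<alpha>" and s: "s \<in> S" and r: "r \<in> carrier D"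
  shows "inv_into (carrier DS) (loc_map D S (\<sigma> \<beta>)) (fr s r) = fr (\<sigma>' \<beta> s) (\<sigma>' \<beta> r)"
proof (rule inv_into_f_eq)
  show "inj_on (loc_map D S (\<sigma> \<beta>)) (carrier DS)"
  proof (rule inj_onI)
    fix P Q assume "P \<in> carrier DS" "Q \<in> carrier DS"
    then obtain s r t q where sr: "s \<in> S" "r \<in> carrier D" "P = fr s r"
      and tq: "t \<in> S" "q \<in> carrier D" "Q = fr t q" by (metis DS_carrierE)
    assume "loc_map D S (\<sigma> \<beta>) P = loc_map D S (\<sigma> \<beta>) Q"
    then have "\<sigma> \<beta> (s \<otimes>\<^bsub>D\<^esub> q) = \<sigma> \<beta> (t \<otimes>\<^bsub>D\<^esub> r)"
      using sr tq \<beta> by (simp add: loc_map_frac frac_eq_iff \<sigma>_hom)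
    then have "s \<otimes>\<^bsub>D\<^esub> q = t \<otimes>\<^bsub>D\<^esub> r"
      using sr tq \<beta> by (metis \<sigma>'_\<sigma> A.m_closed S_closed)
    then show "P = Q" using sr tq by (simp add: frac_eq_iff)
  qed
qed (use assms in \<open>simp_all add: loc_map_frac\<close>)

lemma DS_common_denominatorE:
  assumes "P \<in> carrier DS" "Q \<in> carrier DS"
  obtains s r q where "s \<in> S" "r \<in> carrier D" "q \<in> carrier D" "P = fr s r" "Q = fr s q"
proof -
  obtain s r t q where sr: "s \<in> S" "r \<in> carrier D" "P = fr s r"
    and tq: "t \<in> S" "q \<in> carrier D" "Q = fr t q" using assms by (metis DS_carrierE)
  have "P = fr (t \<otimes>\<^bsub>D\<^esub> s) (t \<otimes>\<^bsub>D\<^esub> r)" "Q = fr (t \<otimes>\<^bsub>D\<^esub> s) (s \<otimes>\<^bsub>D\<^esub> q)"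
    using sr tq by (simp add: frac_cancel) (use sr tq S_central[of t s] in \<open>simp add: frac_cancel\<close>)
  then show thesis using sr tq by (intro that[of "t \<otimes>\<^bsub>D\<^esub> s"]) simp_all
qed

sublocale L: gwa_presentation K DS \<alpha> "\<lambda>\<beta>. loc_map D S (\<sigma> \<beta>)" "\<lambda>\<beta>. loc_embed D S (a \<beta>)"
proof unfold_locales
  fix d e assume "d \<in> carrier DS" "e \<in> carrier DS"
  then obtain s r t q where sr: "s \<in> S" "r \<in> carrier D" "d = fr s r"
    and tq: "t \<in> S" "q \<in> carrier D" "e = fr t q" by (metis DS_carrierE)
  show "d \<otimes>\<^bsub>DS\<^esub> e \<in> carrier DS" using sr tq by (simp add: DS_mult)
next
  fix d e assume "d \<in> carrier DS" "e \<in> carrier DS"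
  then show "d \<oplus>\<^bsub>DS\<^esub> e \<in> carrier DS"
    by (rule DS_common_denominatorE) (simp add: DS_add)
next
  show "\<one>\<^bsub>DS\<^esub> \<in> carrier DS" by (simp add: DS_one)
next
  fix c d assume "c \<in> carrier K" "d \<in> carrier DS"
  then show "c \<odot>\<^bsub>DS\<^esub> d \<in> carrier DS" by (auto simp: DS_smult elim!: DS_carrierE)
next
  fix \<beta> d assume "\<beta> \<in> Field \<alpha>" "d \<in> carrier DS"
  then show "loc_map D S (\<sigma> \<beta>) d \<in> carrier DS"
    and "inv_into (carrier DS) (loc_map D S (\<sigma> \<beta>)) d \<in> carrier DS"
    by (auto simp: loc_map_frac loc_map_inv_frac elim!: DS_carrierE)
next
  fix \<beta> assume "\<beta> \<in> Field \<alpha>"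
  then show "loc_embed D S (a \<beta>) \<in> carrier DS" by (simp add: loc_embed_def)
qed

text \<open>This is the comparison map \<phi>. The images of the letters satisfy the relations
  because passing to fractions with denominator one respects the operations of \<open>D\<close> and
  carries \<open>\<sigma> \<beta>\<close> and \<open>\<sigma>' \<beta>\<close> to their
  extensions.\<close>

lemma localization_hom:
  obtains \<phi> where "\<phi> \<in> k_algebra_hom K G.A L.A"
    "\<And>d. d \<in> carrier D \<Longrightarrow> \<phi> (G.b d) = L.b (fr \<one>\<^bsub>D\<^esub> d)"
    "\<And>\<beta>. \<beta> \<in> Field \<alpha> \<Longrightarrow> \<phi> (G.X \<beta>) = L.X \<beta>" "\<And>\<beta>. \<beta> \<in> Field \<alpha> \<Longrightarrow> \<phi> (G.Y \<beta>) = L.Y \<beta>"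
proof (rule G.universal_property[OF L.A.k_algebra_axioms, of "\<lambda>d. L.b (fr \<one>\<^bsub>D\<^esub> d)" L.X L.Y])
  fix d assume d: "d \<in> carrier D"
  show "L.b (fr \<one>\<^bsub>D\<^esub> d) \<in> carrier L.A" using d by simp
  fix e assume e: "e \<in> carrier D"
  show "L.b (fr \<one>\<^bsub>D\<^esub> (d \<oplus>\<^bsub>D\<^esub> e)) = L.b (fr \<one>\<^bsub>D\<^esub> d) \<oplus>\<^bsub>L.A\<^esub> L.b (fr \<one>\<^bsub>D\<^esub> e)"
    using d e by (simp add: DS_add flip: L.b_add)
  show "L.b (fr \<one>\<^bsub>D\<^esub> (d \<otimes>\<^bsub>D\<^esub> e)) = L.b (fr \<one>\<^bsub>D\<^esub> d) \<otimes>\<^bsub>L.A\<^esub> L.b (fr \<one>\<^bsub>D\<^esub> e)"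
    using d e by (simp add: DS_mult flip: L.b_mult)
next
  show "L.b (fr \<one>\<^bsub>D\<^esub> \<one>\<^bsub>D\<^esub>) = \<one>\<^bsub>L.A\<^esub>" using L.b_one by (simp add: DS_one)
next
  fix c d assume "c \<in> carrier K" "d \<in> carrier D"
  then show "L.b (fr \<one>\<^bsub>D\<^esub> (c \<odot>\<^bsub>D\<^esub> d)) = c \<odot>\<^bsub>L.A\<^esub> L.b (fr \<one>\<^bsub>D\<^esub> d)"
    by (simp add: DS_smult flip: L.b_smult)
next
  fix \<beta> d assume "\<beta> \<in> Field \<alpha>" "d \<in> carrier D"
  then show "L.X \<beta> \<otimes>\<^bsub>L.A\<^esub> L.b (fr \<one>\<^bsub>D\<^esub> d) = L.b (fr \<one>\<^bsub>D\<^esub> (\<sigma> \<beta> d)) \<otimes>\<^bsub>L.A\<^esub> L.X \<beta>"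
    and "L.Y \<beta> \<otimes>\<^bsub>L.A\<^esub> L.b (fr \<one>\<^bsub>D\<^esub> d) = L.b (fr \<one>\<^bsub>D\<^esub> (\<sigma>' \<beta> d)) \<otimes>\<^bsub>L.A\<^esub> L.Y \<beta>"
    by (simp_all add: L.X_b L.Y_b loc_map_frac loc_map_inv_frac \<sigma>_hom \<sigma>'_hom)
next
  fix \<beta> assume \<beta>: "\<beta> \<in> Field \<alpha>"
  have e: "loc_embed D S (a \<beta>) = fr \<one>\<^bsub>D\<^esub> (a \<beta>)" by (simp add: loc_embed_def)
  show "L.Y \<beta> \<otimes>\<^bsub>L.A\<^esub> L.X \<beta> = L.b (fr \<one>\<^bsub>D\<^esub> (a \<beta>))"
    unfolding L.Y_X_a[OF \<beta>] e ..
  have "loc_map D S (\<sigma> \<beta>) (loc_embed D S (a \<beta>)) = fr \<one>\<^bsub>D\<^esub> (\<sigma> \<beta> (a \<beta>))"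
    using \<beta> by (simp add: e loc_map_frac \<sigma>_hom)
  then show "L.X \<beta> \<otimes>\<^bsub>L.A\<^esub> L.Y \<beta> = L.b (fr \<one>\<^bsub>D\<^esub> (\<sigma> \<beta> (a \<beta>)))"
    unfolding L.X_Y_a[OF \<beta>] by (rule arg_cong)
qed (simp_all add: L.X_X L.Y_Y L.X_Y that)

end

section \<open>Endomorphism algebras of modules\<close>

text \<open>Operators are extensional on the carrier, so that equality in the algebra is pointwise
  equality there, as \<open>end_algebra_eqI\<close> records.\<close>

definition end_algebra ::
    "('k, 'm) ring_scheme \<Rightarrow> ('k, 'v, 'p) module_scheme \<Rightarrow> ('k, 'v \<Rightarrow> 'v) module"
  where "end_algebra K V = \<lparr>
    carrier = {f \<in> carrier V \<rightarrow>\<^sub>E carrier V.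
      (\<forall>x\<in>carrier V. \<forall>y\<in>carrier V. f (x \<oplus>\<^bsub>V\<^esub> y) = f x \<oplus>\<^bsub>V\<^esub> f y) \<and>
      (\<forall>c\<in>carrier K. \<forall>x\<in>carrier V. f (c \<odot>\<^bsub>V\<^esub> x) = c \<odot>\<^bsub>V\<^esub> f x)},
    mult = (\<lambda>f g. \<lambda>x\<in>carrier V. f (g x)),
    one = (\<lambda>x\<in>carrier V. x),
    zero = (\<lambda>x\<in>carrier V. \<zero>\<^bsub>V\<^esub>),
    add = (\<lambda>f g. \<lambda>x\<in>carrier V. f x \<oplus>\<^bsub>V\<^esub> g x),
    smult = (\<lambda>c f. \<lambda>x\<in>carrier V. c \<odot>\<^bsub>V\<^esub> f x)\<rparr>"

lemma end_algebra_simps: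
  "\<one>\<^bsub>end_algebra K V\<^esub> = (\<lambda>x\<in>carrier V. x)"
  "\<zero>\<^bsub>end_algebra K V\<^esub> = (\<lambda>x\<in>carrier V. \<zero>\<^bsub>V\<^esub>)"
  "f \<otimes>\<^bsub>end_algebra K V\<^esub> g = (\<lambda>x\<in>carrier V. f (g x))"
  "f \<oplus>\<^bsub>end_algebra K V\<^esub> g = (\<lambda>x\<in>carrier V. f x \<oplus>\<^bsub>V\<^esub> g x)"
  "c \<odot>\<^bsub>end_algebra K V\<^esub> f = (\<lambda>x\<in>carrier V. c \<odot>\<^bsub>V\<^esub> f x)"
  by (simp_all add: end_algebra_def)

lemma end_algebraD:
  assumes "f \<in> carrier (end_algebra K V)"
  shows "x \<in> carrier V \<Longrightarrow> f x \<in> carrier V"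
    and "\<lbrakk>x \<in> carrier V; y \<in> carrier V\<rbrakk> \<Longrightarrow> f (x \<oplus>\<^bsub>V\<^esub> y) = f x \<oplus>\<^bsub>V\<^esub> f y"
    and "\<lbrakk>c \<in> carrier K; x \<in> carrier V\<rbrakk> \<Longrightarrow> f (c \<odot>\<^bsub>V\<^esub> x) = c \<odot>\<^bsub>V\<^esub> f x"
    and "f \<in> extensional (carrier V)"
  using assms by (auto simp: end_algebra_def PiE_iff)

lemma end_algebraI:
  assumes "\<And>x. x \<in> carrier V \<Longrightarrow> f x \<in> carrier V"
    and "\<And>x y. \<lbrakk>x \<in> carrier V; y \<in> carrier V\<rbrakk> \<Longrightarrow> f (x \<oplus>\<^bsub>V\<^esub> y) = f x \<oplus>\<^bsub>V\<^esub> f y"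
    and "\<And>c x. \<lbrakk>c \<in> carrier K; x \<in> carrier V\<rbrakk> \<Longrightarrow> f (c \<odot>\<^bsub>V\<^esub> x) = c \<odot>\<^bsub>V\<^esub> f x"
    and "f \<in> extensional (carrier V)"
  shows "f \<in> carrier (end_algebra K V)"
  using assms by (auto simp: end_algebra_def PiE_iff)

lemma end_algebra_eqI:
  assumes "f \<in> carrier (end_algebra K V)" "g \<in> carrier (end_algebra K V)"
    and "\<And>x. x \<in> carrier V \<Longrightarrow> f x = g x"
  shows "f = g"
  using extensionalityI[OF end_algebraD(4)[OF assms(1)] end_algebraD(4)[OF assms(2)]] assms(3) by blast

lemma end_algebra_k_algebra:
  fixes K :: "('k, 'm) ring_scheme" and V :: "('k, 'v, 'p) module_scheme"
  assumes K: "field K" and V: "module K V"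
  shows "k_algebra K (end_algebra K V)"
proof -
  interpret K: field K by fact
  interpret module K V by fact
  let ?E = "end_algebra K V"
  note simps = end_algebra_simps end_algebraD and eqI = end_algebra_eqI[where K = K and V = V]
  have mult: "f \<otimes>\<^bsub>?E\<^esub> g \<in> carrier ?E" if "f \<in> carrier ?E" "g \<in> carrier ?E" for f g
    using that by (intro end_algebraI) (simp_all add: simps)
  have add: "f \<oplus>\<^bsub>?E\<^esub> g \<in> carrier ?E" if "f \<in> carrier ?E" "g \<in> carrier ?E" for f g
    using that by (intro end_algebraI) (simp_all add: simps M.a_ac smult_r_distr)
  have smult: "c \<odot>\<^bsub>?E\<^esub> f \<in> carrier ?E" if "c \<in> carrier K" "f \<in> carrier ?E" for c f
    using that
    by (intro end_algebraI) (simp_all add: simps smult_r_distr K.m_comm flip: smult_assoc1)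
  have zero: "\<zero>\<^bsub>?E\<^esub> \<in> carrier ?E" and one: "\<one>\<^bsub>?E\<^esub> \<in> carrier ?E"
    by (intro end_algebraI; simp add: simps)+
  note closed = mult add smult zero one
  have ag: "abelian_group ?E"
  proof (rule abelian_groupI)
    fix f assume f: "f \<in> carrier ?E"
    have "((\<ominus>\<^bsub>K\<^esub> \<one>\<^bsub>K\<^esub>) \<odot>\<^bsub>?E\<^esub> f) \<oplus>\<^bsub>?E\<^esub> f = \<zero>\<^bsub>?E\<^esub>"
      using f by (intro eqI closed) (simp_all add: simps smult_l_minus M.l_neg)
    then show "\<exists>g\<in>carrier ?E. g \<oplus>\<^bsub>?E\<^esub> f = \<zero>\<^bsub>?E\<^esub>"
      using f closed by (intro bexI[of _ "(\<ominus>\<^bsub>K\<^esub> \<one>\<^bsub>K\<^esub>) \<odot>\<^bsub>?E\<^esub> f"]) simp_all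
    show "\<zero>\<^bsub>?E\<^esub> \<oplus>\<^bsub>?E\<^esub> f = f"
      using f by (intro eqI closed) (simp_all add: simps)
  next
    fix f g assume fg: "f \<in> carrier ?E" "g \<in> carrier ?E"
    then show "f \<oplus>\<^bsub>?E\<^esub> g \<in> carrier ?E" by (rule add)
    show "f \<oplus>\<^bsub>?E\<^esub> g = g \<oplus>\<^bsub>?E\<^esub> f"
      using fg by (intro eqI closed) (simp_all add: simps M.a_ac)
    fix h assume h: "h \<in> carrier ?E"
    show "f \<oplus>\<^bsub>?E\<^esub> g \<oplus>\<^bsub>?E\<^esub> h = f \<oplus>\<^bsub>?E\<^esub> (g \<oplus>\<^bsub>?E\<^esub> h)"
      using fg h by (intro eqI closed) (simp_all add: simps M.a_ac)
  qed (rule zero)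
  have ring: "ring ?E"
  proof (rule ringI[OF ag])
    show "monoid ?E"
    proof (rule monoidI)
      fix f g h assume "f \<in> carrier ?E" "g \<in> carrier ?E" "h \<in> carrier ?E"
      then show "f \<otimes>\<^bsub>?E\<^esub> g \<otimes>\<^bsub>?E\<^esub> h = f \<otimes>\<^bsub>?E\<^esub> (g \<otimes>\<^bsub>?E\<^esub> h)"
        by (intro eqI closed) (simp_all add: simps)
    next
      fix f assume f: "f \<in> carrier ?E"
      show "\<one>\<^bsub>?E\<^esub> \<otimes>\<^bsub>?E\<^esub> f = f" "f \<otimes>\<^bsub>?E\<^esub> \<one>\<^bsub>?E\<^esub> = f"
        using f by (intro eqI closed; simp add: simps)+
    qed (auto intro: closed)
  next
    fix f g h assume h: "f \<in> carrier ?E" "g \<in> carrier ?E" "h \<in> carrier ?E"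
    show "(f \<oplus>\<^bsub>?E\<^esub> g) \<otimes>\<^bsub>?E\<^esub> h = f \<otimes>\<^bsub>?E\<^esub> h \<oplus>\<^bsub>?E\<^esub> g \<otimes>\<^bsub>?E\<^esub> h"
      "h \<otimes>\<^bsub>?E\<^esub> (f \<oplus>\<^bsub>?E\<^esub> g) = h \<otimes>\<^bsub>?E\<^esub> f \<oplus>\<^bsub>?E\<^esub> h \<otimes>\<^bsub>?E\<^esub> g"
      using h by (intro eqI closed; simp add: simps)+
  qed
  have "module K ?E"
  proof (rule moduleI)
    fix c d f g assume h: "c \<in> carrier K" "d \<in> carrier K" "f \<in> carrier ?E" "g \<in> carrier ?E"
    show "c \<odot>\<^bsub>?E\<^esub> f \<in> carrier ?E" using h closed by blast
    show "(c \<oplus>\<^bsub>K\<^esub> d) \<odot>\<^bsub>?E\<^esub> f = c \<odot>\<^bsub>?E\<^esub> f \<oplus>\<^bsub>?E\<^esub> d \<odot>\<^bsub>?E\<^esub> f"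
      "c \<odot>\<^bsub>?E\<^esub> (f \<oplus>\<^bsub>?E\<^esub> g) = c \<odot>\<^bsub>?E\<^esub> f \<oplus>\<^bsub>?E\<^esub> c \<odot>\<^bsub>?E\<^esub> g"
      "(c \<otimes>\<^bsub>K\<^esub> d) \<odot>\<^bsub>?E\<^esub> f = c \<odot>\<^bsub>?E\<^esub> (d \<odot>\<^bsub>?E\<^esub> f)"
      using h K.a_closed K.m_closed
      by (intro eqI closed; simp add: simps smult_l_distr smult_r_distr smult_assoc1)+
  next
    fix f assume "f \<in> carrier ?E"
    then show "\<one>\<^bsub>K\<^esub> \<odot>\<^bsub>?E\<^esub> f = f" by (intro eqI closed) (simp_all add: simps)
  qed (fact K.is_cring, fact ag)
  moreover have "k_algebra_axioms K ?E"
  proof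
    fix c f g assume h: "c \<in> carrier K" "f \<in> carrier ?E" "g \<in> carrier ?E"
    show "c \<odot>\<^bsub>?E\<^esub> f \<otimes>\<^bsub>?E\<^esub> g = c \<odot>\<^bsub>?E\<^esub> (f \<otimes>\<^bsub>?E\<^esub> g)"
      "f \<otimes>\<^bsub>?E\<^esub> (c \<odot>\<^bsub>?E\<^esub> g) = c \<odot>\<^bsub>?E\<^esub> (f \<otimes>\<^bsub>?E\<^esub> g)"
      using h by (intro eqI closed; simp add: simps)+
  qed
  ultimately show ?thesis using ring by (intro k_algebra.intro K)
qed

section \<open>Localization of modules\<close>

text \<open>To be applied with \<A> as \<open>V\<close> and the left multiplications by
  \<open>S\<close> as operators: these are linear and commute with one another, although
  \<open>S\<close> need not be central in \<A>.\<close>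

locale module_localization = module K V + T: comm_monoid T
  for K :: "('k, 'm) ring_scheme" (structure) and V :: "('k, 'v, 'p) module_scheme" (structure)
    and T :: "('s, 't) monoid_scheme" +
  fixes act :: "'s \<Rightarrow> 'v \<Rightarrow> 'v"
  assumes act_closed [simp]: "\<lbrakk>s \<in> carrier T; x \<in> carrier V\<rbrakk> \<Longrightarrow> act s x \<in> carrier V"
    and act_add: "\<lbrakk>s \<in> carrier T; x \<in> carrier V; y \<in> carrier V\<rbrakk> \<Longrightarrow>
      act s (x \<oplus>\<^bsub>V\<^esub> y) = act s x \<oplus>\<^bsub>V\<^esub> act s y"
    and act_smult: "\<lbrakk>s \<in> carrier T; c \<in> carrier K; x \<in> carrier V\<rbrakk> \<Longrightarrow>
      act s (c \<odot>\<^bsub>V\<^esub> x) = c \<odot>\<^bsub>V\<^esub> act s x"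
    and act_mult: "\<lbrakk>s \<in> carrier T; t \<in> carrier T; x \<in> carrier V\<rbrakk> \<Longrightarrow>
      act (s \<otimes>\<^bsub>T\<^esub> t) x = act s (act t x)"
    and act_one: "x \<in> carrier V \<Longrightarrow> act \<one>\<^bsub>T\<^esub> x = x"
begin

lemma act_commute:
  "\<lbrakk>s \<in> carrier T; t \<in> carrier T; x \<in> carrier V\<rbrakk> \<Longrightarrow> act s (act t x) = act t (act s x)"
  by (metis act_mult T.m_comm)

text \<open>The factor \<open>u\<close> allows for torsion: an operator may fail to be injective on
  \<open>V\<close>, and then the relation without \<open>u\<close> need not be transitive.\<close>

definition cls :: "'s \<Rightarrow> 'v \<Rightarrow> ('s \<times> 'v) set"
  where "cls t m = {(t', m'). t' \<in> carrier T \<and> m' \<in> carrier V \<and>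
    (\<exists>u\<in>carrier T. act u (act t' m) = act u (act t m'))}"

lemma cls_trans:
  assumes t: "t \<in> carrier T" "t' \<in> carrier T" "t'' \<in> carrier T"
    and m: "m \<in> carrier V" "m' \<in> carrier V" "m'' \<in> carrier V"
    and 1: "\<exists>u\<in>carrier T. act u (act t' m) = act u (act t m')"
    and 2: "\<exists>u\<in>carrier T. act u (act t'' m') = act u (act t' m'')"
  shows "\<exists>u\<in>carrier T. act u (act t'' m) = act u (act t m'')"
proof -
  obtain u v where u: "u \<in> carrier T" "act u (act t' m) = act u (act t m')"
    and v: "v \<in> carrier T" "act v (act t'' m') = act v (act t' m'')" using 1 2 by blast
  \<comment> \<open>The factors \<open>u\<close> and \<open>v\<close> come from the two given
    equivalences; \<open>t'\<close> is added in order to pass through the middle fraction.\<close>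
  let ?w = "u \<otimes>\<^bsub>T\<^esub> v \<otimes>\<^bsub>T\<^esub> t'"
  have "act ?w (act t'' m) = act v (act t'' (act u (act t' m)))"
    using t m(1) u(1) v(1) by (simp add: act_mult act_commute)
  also have "\<dots> = act u (act t (act v (act t'' m')))"
    unfolding u(2) using t m(2) u(1) v(1) by (simp add: act_commute)
  also have "\<dots> = act ?w (act t m'')"
    unfolding v(2) using t m(3) u(1) v(1) by (simp add: act_mult act_commute)
  finally show ?thesis using t u v by (intro bexI[of _ ?w]) simp_all
qed

lemma cls_eq_iff:
  assumes t: "t \<in> carrier T" "t' \<in> carrier T" and m: "m \<in> carrier V" "m' \<in> carrier V"
  shows "cls t m = cls t' m' \<longleftrightarrow> (\<exists>u\<in>carrier T. act u (act t' m) = act u (act t m'))"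
proof
  assume "cls t m = cls t' m'"
  moreover have "(t', m') \<in> cls t' m'" using t m by (auto simp: cls_def)
  ultimately have "(t', m') \<in> cls t m" by blast
  then show "\<exists>u\<in>carrier T. act u (act t' m) = act u (act t m')" by (simp add: cls_def)
next
  assume a: "\<exists>u\<in>carrier T. act u (act t' m) = act u (act t m')"
  then have b: "\<exists>u\<in>carrier T. act u (act t m') = act u (act t' m)" by metis
  have "(s, n) \<in> cls t m \<longleftrightarrow> (s, n) \<in> cls t' m'" for s n
    unfolding cls_def mem_Collect_eq prod.case
    using cls_trans[OF t(2,1) _ m(2,1) _ b] cls_trans[OF t _ m _ a] by blast
  then show "cls t m = cls t' m'" by (intro equalityI subrelI) blast+
qed

lemma cls_eqI:
  assumes "t \<in> carrier T" "t' \<in> carrier T" "m \<in> carrier V" "m' \<in> carrier V" "act t' m = act t m'"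
  shows "cls t m = cls t' m'"
  using assms by (auto simp: cls_eq_iff)

lemma cls_cancel:
  assumes "u \<in> carrier T" "t \<in> carrier T" "m \<in> carrier V"
  shows "cls (u \<otimes>\<^bsub>T\<^esub> t) (act u m) = cls t m"
  using assms by (intro cls_eqI) (simp_all add: act_mult act_commute)

text \<open>Sum and scalar multiple are determined by uniqueness over all ways of writing the
  arguments, for the sum with a common denominator. \<open>common_denominatorE\<close> provides such
  a form, and \<open>M_add\<close> and \<open>M_smult\<close> show independence of it.\<close>

definition loc_module :: "('k, ('s \<times> 'v) set) module"
  where "loc_module = \<lparr>
    carrier = {cls t m | t m. t \<in> carrier T \<and> m \<in> carrier V},
    mult = undefined, one = undefined,
    zero = cls \<one>\<^bsub>T\<^esub> \<zero>\<^bsub>V\<^esub>,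
    add = (\<lambda>P Q. THE R. \<exists>t m n. t \<in> carrier T \<and> m \<in> carrier V \<and> n \<in> carrier V \<and>
      P = cls t m \<and> Q = cls t n \<and> R = cls t (m \<oplus>\<^bsub>V\<^esub> n)),
    smult = (\<lambda>c P. THE R. \<exists>t m. t \<in> carrier T \<and> m \<in> carrier V \<and> P = cls t m \<and> R = cls t (c \<odot>\<^bsub>V\<^esub> m))\<rparr>"

abbreviation "M \<equiv> loc_module"

lemma cls_closed [simp]: "t \<in> carrier T \<Longrightarrow> m \<in> carrier V \<Longrightarrow> cls t m \<in> carrier M"
  by (auto simp: loc_module_def)

lemma M_carrierE:
  assumes "P \<in> carrier M" obtains t m where "t \<in> carrier T" "m \<in> carrier V" "P = cls t m"
  using assms by (auto simp: loc_module_def)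

lemma common_denominatorE:
  assumes "P \<in> carrier M" "Q \<in> carrier M"
  obtains t m n where "t \<in> carrier T" "m \<in> carrier V" "n \<in> carrier V" "P = cls t m" "Q = cls t n"
proof -
  obtain t m t' n where 1: "t \<in> carrier T" "m \<in> carrier V" "P = cls t m"
    and 2: "t' \<in> carrier T" "n \<in> carrier V" "Q = cls t' n" using assms by (metis M_carrierE)
  have "P = cls (t' \<otimes>\<^bsub>T\<^esub> t) (act t' m)" using 1 2(1) by (simp add: cls_cancel)
  moreover have "Q = cls (t' \<otimes>\<^bsub>T\<^esub> t) (act t n)"
    using cls_cancel[of t t' n] T.m_comm[of t t'] 1(1) 2 by simp
  ultimately show thesis using 1 2 by (intro that[of "t' \<otimes>\<^bsub>T\<^esub> t"]) simp_all
qed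

lemma M_add:
  assumes "t \<in> carrier T" "m \<in> carrier V" "n \<in> carrier V"
  shows "cls t m \<oplus>\<^bsub>M\<^esub> cls t n = cls t (m \<oplus>\<^bsub>V\<^esub> n)"
proof -
  have "cls t' (m' \<oplus>\<^bsub>V\<^esub> n') = cls t (m \<oplus>\<^bsub>V\<^esub> n)"
    if h: "t' \<in> carrier T" "m' \<in> carrier V" "n' \<in> carrier V" "cls t m = cls t' m'" "cls t n = cls t' n'"
    for t' m' n'
  proof -
    obtain u v where u: "u \<in> carrier T" "act u (act t' m) = act u (act t m')"
      and v: "v \<in> carrier T" "act v (act t' n) = act v (act t n')"
      using h assms by (auto simp: cls_eq_iff)
    \<comment> \<open>Each of the two equivalences has its own torsion factor; their product serves
      for both.\<close>
    have "act (u \<otimes>\<^bsub>T\<^esub> v) (act t' m) = act (u \<otimes>\<^bsub>T\<^esub> v) (act t m')"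
      using u v(1) assms h by (metis act_mult act_commute act_closed)
    moreover have "act (u \<otimes>\<^bsub>T\<^esub> v) (act t' n) = act (u \<otimes>\<^bsub>T\<^esub> v) (act t n')"
      using v u(1) assms h by (metis act_mult act_closed)
    ultimately have "act (u \<otimes>\<^bsub>T\<^esub> v) (act t' (m \<oplus>\<^bsub>V\<^esub> n)) = act (u \<otimes>\<^bsub>T\<^esub> v) (act t (m' \<oplus>\<^bsub>V\<^esub> n'))"
      using u(1) v(1) assms h by (simp add: act_add)
    then have "cls t (m \<oplus>\<^bsub>V\<^esub> n) = cls t' (m' \<oplus>\<^bsub>V\<^esub> n')"
      using u(1) v(1) assms h by (subst cls_eq_iff) (auto intro!: bexI[of _ "u \<otimes>\<^bsub>T\<^esub> v"])
    then show ?thesis by simp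
  qed
  then show ?thesis
    unfolding loc_module_def ring.simps using assms by (intro the_equality) blast+
qed

lemma M_smult:
  assumes c: "c \<in> carrier K" and "t \<in> carrier T" "m \<in> carrier V"
  shows "c \<odot>\<^bsub>M\<^esub> cls t m = cls t (c \<odot>\<^bsub>V\<^esub> m)"
proof -
  have "cls t' (c \<odot>\<^bsub>V\<^esub> m') = cls t (c \<odot>\<^bsub>V\<^esub> m)"
    if h: "t' \<in> carrier T" "m' \<in> carrier V" "cls t m = cls t' m'" for t' m'
  proof -
    obtain u where u: "u \<in> carrier T" "act u (act t' m) = act u (act t m')"
      using h assms by (auto simp: cls_eq_iff)
    have "act u (act t' (c \<odot>\<^bsub>V\<^esub> m)) = act u (act t (c \<odot>\<^bsub>V\<^esub> m'))"
      using u assms h by (simp add: act_smult)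
    then have "cls t (c \<odot>\<^bsub>V\<^esub> m) = cls t' (c \<odot>\<^bsub>V\<^esub> m')"
      using u(1) assms h by (subst cls_eq_iff) auto
    then show ?thesis by simp
  qed
  then show ?thesis
    unfolding loc_module_def module.simps using assms by (intro the_equality) blast+
qed

lemma M_zero: "t \<in> carrier T \<Longrightarrow> cls t \<zero>\<^bsub>V\<^esub> = \<zero>\<^bsub>M\<^esub>"
proof -
  assume t: "t \<in> carrier T"
  have "act s \<zero>\<^bsub>V\<^esub> = \<zero>\<^bsub>V\<^esub>" if "s \<in> carrier T" for s
    using act_smult[OF that, of \<zero> "\<zero>\<^bsub>V\<^esub>"] that by simp
  then show "cls t \<zero>\<^bsub>V\<^esub> = \<zero>\<^bsub>M\<^esub>" using t by (simp add: loc_module_def cls_eqI)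
qed

lemma M_module: "module K M"
proof (rule moduleI)
  show "abelian_group M"
  proof (rule abelian_groupI)
    fix P assume "P \<in> carrier M"
    then obtain t m where t: "t \<in> carrier T" "m \<in> carrier V" "P = cls t m" by (rule M_carrierE)
    show "\<zero>\<^bsub>M\<^esub> \<oplus>\<^bsub>M\<^esub> P = P" using t by (simp add: M_add flip: M_zero[of t])
    have "cls t (\<ominus>\<^bsub>V\<^esub> m) \<oplus>\<^bsub>M\<^esub> P = \<zero>\<^bsub>M\<^esub>" using t by (simp add: M_add M.l_neg M_zero)
    then show "\<exists>Q\<in>carrier M. Q \<oplus>\<^bsub>M\<^esub> P = \<zero>\<^bsub>M\<^esub>" using t by (intro bexI[of _ "cls t (\<ominus>\<^bsub>V\<^esub> m)"]) simp_all
  next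
    fix P Q assume P: "P \<in> carrier M" and Q: "Q \<in> carrier M"
    obtain t m n where t: "t \<in> carrier T" "m \<in> carrier V" "n \<in> carrier V" "P = cls t m" "Q = cls t n"
      using P Q by (rule common_denominatorE)
    show "P \<oplus>\<^bsub>M\<^esub> Q \<in> carrier M" using t by (simp add: M_add)
    show "P \<oplus>\<^bsub>M\<^esub> Q = Q \<oplus>\<^bsub>M\<^esub> P" using t by (simp add: M_add M.a_ac)
  next
    fix P Q R assume P: "P \<in> carrier M" and Q: "Q \<in> carrier M" and R: "R \<in> carrier M"
    obtain t m n where t: "t \<in> carrier T" "m \<in> carrier V" "n \<in> carrier V" "P = cls t m" "Q = cls t n"
      using P Q by (rule common_denominatorE)
    obtain t' k where t': "t' \<in> carrier T" "k \<in> carrier V" "R = cls t' k" using R by (rule M_carrierE)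
    have "P = cls (t' \<otimes>\<^bsub>T\<^esub> t) (act t' m)" "Q = cls (t' \<otimes>\<^bsub>T\<^esub> t) (act t' n)"
      using t t'(1) by (simp_all add: cls_cancel)
    moreover have "R = cls (t' \<otimes>\<^bsub>T\<^esub> t) (act t k)"
      using cls_cancel[of t t' k] T.m_comm[of t t'] t(1) t' by simp
    ultimately show "P \<oplus>\<^bsub>M\<^esub> Q \<oplus>\<^bsub>M\<^esub> R = P \<oplus>\<^bsub>M\<^esub> (Q \<oplus>\<^bsub>M\<^esub> R)"
      using t(1-3) t'(1,2) by (simp add: M_add M.a_assoc)
  qed (simp add: M_zero[OF T.one_closed, symmetric])
  fix c d P Q assume c: "c \<in> carrier K" "d \<in> carrier K" and P: "P \<in> carrier M" "Q \<in> carrier M"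
  obtain t m n where t: "t \<in> carrier T" "m \<in> carrier V" "n \<in> carrier V" "P = cls t m" "Q = cls t n"
    using P by (rule common_denominatorE)
  show "c \<odot>\<^bsub>M\<^esub> P \<in> carrier M" using c t by (simp add: M_smult)
  show "(c \<oplus> d) \<odot>\<^bsub>M\<^esub> P = c \<odot>\<^bsub>M\<^esub> P \<oplus>\<^bsub>M\<^esub> d \<odot>\<^bsub>M\<^esub> P"
    using c t by (simp add: M_smult M_add smult_l_distr)
  show "c \<odot>\<^bsub>M\<^esub> (P \<oplus>\<^bsub>M\<^esub> Q) = c \<odot>\<^bsub>M\<^esub> P \<oplus>\<^bsub>M\<^esub> c \<odot>\<^bsub>M\<^esub> Q"
    using c t by (simp add: M_smult M_add smult_r_distr)
  show "(c \<otimes> d) \<odot>\<^bsub>M\<^esub> P = c \<odot>\<^bsub>M\<^esub> (d \<odot>\<^bsub>M\<^esub> P)"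
    using c t by (simp add: M_smult smult_assoc1)
next
  fix P assume "P \<in> carrier M"
  then show "\<one> \<odot>\<^bsub>M\<^esub> P = P" by (auto simp: M_smult elim!: M_carrierE)
qed (fact R.is_cring)

text \<open>The operator \<open>t\<^sup>-\<^sup>1 m \<mapsto> (s \<tau>(t))\<^sup>-\<^sup>1 f(m)\<close>.\<close>

definition lift :: "'s \<Rightarrow> ('s \<Rightarrow> 's) \<Rightarrow> ('v \<Rightarrow> 'v) \<Rightarrow> ('s \<times> 'v) set \<Rightarrow> ('s \<times> 'v) set"
  where "lift s \<tau> f = (\<lambda>P\<in>carrier M. THE R. \<exists>t m. t \<in> carrier T \<and> m \<in> carrier V \<and>
    P = cls t m \<and> R = cls (s \<otimes>\<^bsub>T\<^esub> \<tau> t) (f m))"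

text \<open>Passing \<open>f\<close> across \<open>t\<close> twists it by \<tau>, which is why the
  formula for \<open>lift\<close> divides by \<open>\<tau> t\<close>. The letters give the examples:
  \<open>X \<beta>\<close> with twist \<open>\<sigma> \<beta>\<close>, \<open>Y \<beta>\<close> with
  twist \<open>\<sigma>' \<beta>\<close>, base elements with the identity.\<close>

definition semilinear :: "('s \<Rightarrow> 's) \<Rightarrow> ('v \<Rightarrow> 'v) \<Rightarrow> bool"
  where "semilinear \<tau> f \<longleftrightarrow> \<tau> \<in> carrier T \<rightarrow> carrier T \<and> f \<in> carrier V \<rightarrow> carrier V \<and>
    (\<forall>x\<in>carrier V. \<forall>y\<in>carrier V. f (x \<oplus>\<^bsub>V\<^esub> y) = f x \<oplus>\<^bsub>V\<^esub> f y) \<and>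
    (\<forall>c\<in>carrier K. \<forall>x\<in>carrier V. f (c \<odot>\<^bsub>V\<^esub> x) = c \<odot>\<^bsub>V\<^esub> f x) \<and>
    (\<forall>t\<in>carrier T. \<forall>x\<in>carrier V. f (act t x) = act (\<tau> t) (f x))"

lemma semilinearD:
  assumes "semilinear \<tau> f"
  shows "t \<in> carrier T \<Longrightarrow> \<tau> t \<in> carrier T" "x \<in> carrier V \<Longrightarrow> f x \<in> carrier V"
    "\<lbrakk>x \<in> carrier V; y \<in> carrier V\<rbrakk> \<Longrightarrow> f (x \<oplus>\<^bsub>V\<^esub> y) = f x \<oplus>\<^bsub>V\<^esub> f y"
    "\<lbrakk>c \<in> carrier K; x \<in> carrier V\<rbrakk> \<Longrightarrow> f (c \<odot>\<^bsub>V\<^esub> x) = c \<odot>\<^bsub>V\<^esub> f x"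
    "\<lbrakk>t \<in> carrier T; x \<in> carrier V\<rbrakk> \<Longrightarrow> f (act t x) = act (\<tau> t) (f x)"
  using assms by (auto simp: semilinear_def)

lemma lift_cls:
  assumes f: "semilinear \<tau> f" and s: "s \<in> carrier T" and t: "t \<in> carrier T" and m: "m \<in> carrier V"
  shows "lift s \<tau> f (cls t m) = cls (s \<otimes>\<^bsub>T\<^esub> \<tau> t) (f m)"
proof -
  note semi = semilinearD[OF f]
  have wd: "cls (s \<otimes>\<^bsub>T\<^esub> \<tau> t') (f m') = cls (s \<otimes>\<^bsub>T\<^esub> \<tau> t) (f m)"
    if h: "t' \<in> carrier T" "m' \<in> carrier V" "cls t m = cls t' m'" for t' m'
  proof -
    obtain u where u: "u \<in> carrier T" "act u (act t' m) = act u (act t m')"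
      using h t m by (auto simp: cls_eq_iff)
    \<comment> \<open>Applying \<open>f\<close> to the equation replaces every denominator by its
      image under \<tau>, and \<open>\<tau> u\<close> becomes the new torsion factor.\<close>
    have "act (\<tau> u) (act (\<tau> t') (f m)) = act (\<tau> u) (act (\<tau> t) (f m'))"
      using u h t m by (metis semi(5) act_closed)
    then have "act (\<tau> u) (act (s \<otimes>\<^bsub>T\<^esub> \<tau> t') (f m)) = act (\<tau> u) (act (s \<otimes>\<^bsub>T\<^esub> \<tau> t) (f m'))"
      using act_commute[of "\<tau> u" s] u h t m s semi(1,2) by (simp add: act_mult)
    then have "cls (s \<otimes>\<^bsub>T\<^esub> \<tau> t) (f m) = cls (s \<otimes>\<^bsub>T\<^esub> \<tau> t') (f m')"
      using u h t m s semi(1,2) by (subst cls_eq_iff) auto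
    then show ?thesis by simp
  qed
  have "lift s \<tau> f (cls t m) = (THE R. \<exists>t' m'. t' \<in> carrier T \<and> m' \<in> carrier V \<and>
      cls t m = cls t' m' \<and> R = cls (s \<otimes>\<^bsub>T\<^esub> \<tau> t') (f m'))"
    using t m by (simp add: lift_def)
  also have "\<dots> = cls (s \<otimes>\<^bsub>T\<^esub> \<tau> t) (f m)"
  proof (rule the_equality)
    show "\<exists>t' m'. t' \<in> carrier T \<and> m' \<in> carrier V \<and>
        cls t m = cls t' m' \<and> cls (s \<otimes>\<^bsub>T\<^esub> \<tau> t) (f m) = cls (s \<otimes>\<^bsub>T\<^esub> \<tau> t') (f m')"
      using t m by blast
  qed (elim exE conjE, simp only: wd)
  finally show ?thesis .
qed

lemma lift_end:
  assumes f: "semilinear \<tau> f" and s: "s \<in> carrier T"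
  shows "lift s \<tau> f \<in> carrier (end_algebra K M)"
proof (rule end_algebraI)
  note semi = semilinearD[OF f]
  show "lift s \<tau> f P \<in> carrier M" if "P \<in> carrier M" for P
    using that f s semi by (auto simp: lift_cls elim!: M_carrierE)
  show "lift s \<tau> f (c \<odot>\<^bsub>M\<^esub> P) = c \<odot>\<^bsub>M\<^esub> lift s \<tau> f P" if "c \<in> carrier K" "P \<in> carrier M" for c P
    using that f s semi by (auto simp: lift_cls M_smult elim!: M_carrierE)
  show "lift s \<tau> f (P \<oplus>\<^bsub>M\<^esub> Q) = lift s \<tau> f P \<oplus>\<^bsub>M\<^esub> lift s \<tau> f Q" if "P \<in> carrier M" "Q \<in> carrier M" for P Q
    using that by (rule common_denominatorE) (use f s semi in \<open>simp add: lift_cls M_add\<close>)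
qed (simp add: lift_def)

end

section \<open>The action on the localized module\<close>

context gwa_localization
begin

abbreviation "T \<equiv> D\<lparr>carrier := S\<rparr>"

lemma T_comm_monoid: "comm_monoid T"
  by (rule comm_monoidI) (simp_all add: A.m_assoc, simp add: S_central)

sublocale W: module_localization K G.A T "\<lambda>s m. G.b s \<otimes>\<^bsub>G.A\<^esub> m"
proof (intro module_localization.intro module_localization_axioms.intro T_comm_monoid)
  show "module K G.A" by (rule G.A.module_axioms)
qed (simp_all add: G.A.A.r_distr G.A.smult_mult_right G.b_mult G.b_one G.A.A.m_assoc)

abbreviation "E \<equiv> end_algebra K W.M"

lemma E_k_algebra: "k_algebra K E"
  by (rule end_algebra_k_algebra[OF field_axioms W.M_module])

text \<open>Multiplication by the fraction \<open>s^-1 d\<close>, sending \<open>t^-1 m\<close> to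
  \<open>(s t)^-1 d m\<close>; there is no twist because \<open>t\<close> is central in
  \<open>D\<close>.\<close>

definition opB :: "('d \<times> 'd) set \<Rightarrow> ('d \<times> (('d, 'i) gwa_gen list \<Rightarrow> 'k) set) set \<Rightarrow>
    ('d \<times> (('d, 'i) gwa_gen list \<Rightarrow> 'k) set) set"
  where "opB P = (THE f. \<exists>s d. s \<in> S \<and> d \<in> carrier D \<and> P = fr s d \<and>
    f = W.lift s (\<lambda>t. t) (\<lambda>m. G.b d \<otimes>\<^bsub>G.A\<^esub> m))"

text \<open>Forced by \<open>X \<beta> t = (\<sigma> \<beta> t) X \<beta>\<close>: on fractions this
  reads \<open>X \<beta> t^-1 = (\<sigma> \<beta> t)^-1 X \<beta>\<close>.\<close>

definition opX :: "'i \<Rightarrow> ('d \<times> (('d, 'i) gwa_gen list \<Rightarrow> 'k) set) set \<Rightarrow>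
    ('d \<times> (('d, 'i) gwa_gen list \<Rightarrow> 'k) set) set"
  where "opX \<beta> = W.lift \<one>\<^bsub>D\<^esub> (\<sigma> \<beta>) (\<lambda>m. G.X \<beta> \<otimes>\<^bsub>G.A\<^esub> m)"

definition opY :: "'i \<Rightarrow> ('d \<times> (('d, 'i) gwa_gen list \<Rightarrow> 'k) set) set \<Rightarrow>
    ('d \<times> (('d, 'i) gwa_gen list \<Rightarrow> 'k) set) set"
  where "opY \<beta> = W.lift \<one>\<^bsub>D\<^esub> (\<sigma>' \<beta>) (\<lambda>m. G.Y \<beta> \<otimes>\<^bsub>G.A\<^esub> m)"

lemma move_b:
  "\<lbrakk>s \<in> S; d \<in> carrier D; m \<in> carrier G.A\<rbrakk> \<Longrightarrow>
    G.b d \<otimes>\<^bsub>G.A\<^esub> (G.b s \<otimes>\<^bsub>G.A\<^esub> m) = G.b s \<otimes>\<^bsub>G.A\<^esub> (G.b d \<otimes>\<^bsub>G.A\<^esub> m)"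
  by (simp add: b_commute flip: G.A.A.m_assoc)

lemma move_X:
  "\<lbrakk>\<beta> \<in> Field \<alpha>; d \<in> carrier D; m \<in> carrier G.A\<rbrakk> \<Longrightarrow>
    G.X \<beta> \<otimes>\<^bsub>G.A\<^esub> (G.b d \<otimes>\<^bsub>G.A\<^esub> m) = G.b (\<sigma> \<beta> d) \<otimes>\<^bsub>G.A\<^esub> (G.X \<beta> \<otimes>\<^bsub>G.A\<^esub> m)"
  by (simp add: G.X_b flip: G.A.A.m_assoc)

lemma move_Y:
  "\<lbrakk>\<beta> \<in> Field \<alpha>; d \<in> carrier D; m \<in> carrier G.A\<rbrakk> \<Longrightarrow>
    G.Y \<beta> \<otimes>\<^bsub>G.A\<^esub> (G.b d \<otimes>\<^bsub>G.A\<^esub> m) = G.b (\<sigma>' \<beta> d) \<otimes>\<^bsub>G.A\<^esub> (G.Y \<beta> \<otimes>\<^bsub>G.A\<^esub> m)"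
  by (simp add: G.Y_b flip: G.A.A.m_assoc)

lemma semilinear_b: "d \<in> carrier D \<Longrightarrow> W.semilinear (\<lambda>t. t) (\<lambda>m. G.b d \<otimes>\<^bsub>G.A\<^esub> m)"
  by (simp add: W.semilinear_def G.A.A.r_distr G.A.smult_mult_right move_b)

lemma semilinear_X: "\<beta> \<in> Field \<alpha> \<Longrightarrow> W.semilinear (\<sigma> \<beta>) (\<lambda>m. G.X \<beta> \<otimes>\<^bsub>G.A\<^esub> m)"
  by (simp add: W.semilinear_def G.A.A.r_distr G.A.smult_mult_right move_X)

lemma semilinear_Y: "\<beta> \<in> Field \<alpha> \<Longrightarrow> W.semilinear (\<sigma>' \<beta>) (\<lambda>m. G.Y \<beta> \<otimes>\<^bsub>G.A\<^esub> m)"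
  by (simp add: W.semilinear_def G.A.A.r_distr G.A.smult_mult_right move_Y)

lemma lift_b_cls:
  "\<lbrakk>s \<in> S; d \<in> carrier D; t \<in> S; m \<in> carrier G.A\<rbrakk> \<Longrightarrow>
    W.lift s (\<lambda>t. t) (\<lambda>m. G.b d \<otimes>\<^bsub>G.A\<^esub> m) (W.cls t m) = W.cls (s \<otimes>\<^bsub>D\<^esub> t) (G.b d \<otimes>\<^bsub>G.A\<^esub> m)"
  by (simp add: W.lift_cls semilinear_b)

text \<open>Two names of the same fraction satisfy \<open>s d' = s' d\<close>; multiplying by the
  denominator \<open>t\<close> of the argument gives equality of the resulting classes.\<close>

lemma opB_frac:
  assumes s: "s \<in> S" and d: "d \<in> carrier D"
  shows "opB (fr s d) = W.lift s (\<lambda>t. t) (\<lambda>m. G.b d \<otimes>\<^bsub>G.A\<^esub> m)"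
  unfolding opB_def
proof (rule the_equality)
  show "\<exists>s' d'. s' \<in> S \<and> d' \<in> carrier D \<and> fr s d = fr s' d' \<and>
      W.lift s (\<lambda>t. t) (\<lambda>m. G.b d \<otimes>\<^bsub>G.A\<^esub> m) = W.lift s' (\<lambda>t. t) (\<lambda>m. G.b d' \<otimes>\<^bsub>G.A\<^esub> m)"
    using s d by blast
next
  fix f assume "\<exists>s' d'. s' \<in> S \<and> d' \<in> carrier D \<and> fr s d = fr s' d' \<and>
      f = W.lift s' (\<lambda>t. t) (\<lambda>m. G.b d' \<otimes>\<^bsub>G.A\<^esub> m)"
  then obtain s' d' where h: "s' \<in> S" "d' \<in> carrier D" "fr s d = fr s' d'"
    and f: "f = W.lift s' (\<lambda>t. t) (\<lambda>m. G.b d' \<otimes>\<^bsub>G.A\<^esub> m)" by blast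
  have eq: "s \<otimes>\<^bsub>D\<^esub> d' = s' \<otimes>\<^bsub>D\<^esub> d" using h s d by (simp add: frac_eq_iff)
  show "f = W.lift s (\<lambda>t. t) (\<lambda>m. G.b d \<otimes>\<^bsub>G.A\<^esub> m)"
    unfolding f
  proof (rule end_algebra_eqI)
    show "W.lift s' (\<lambda>t. t) (\<lambda>m. G.b d' \<otimes>\<^bsub>G.A\<^esub> m) \<in> carrier E"
      "W.lift s (\<lambda>t. t) (\<lambda>m. G.b d \<otimes>\<^bsub>G.A\<^esub> m) \<in> carrier E"
      using h s d by (simp_all add: W.lift_end semilinear_b)
    fix P assume "P \<in> carrier W.M"
    then obtain t m where t: "t \<in> S" "m \<in> carrier G.A" "P = W.cls t m" by (auto elim: W.M_carrierE)
    have "G.b (s \<otimes>\<^bsub>D\<^esub> t) \<otimes>\<^bsub>G.A\<^esub> (G.b d' \<otimes>\<^bsub>G.A\<^esub> m) = G.b t \<otimes>\<^bsub>G.A\<^esub> (G.b (s \<otimes>\<^bsub>D\<^esub> d') \<otimes>\<^bsub>G.A\<^esub> m)"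
      using move_b[of t s "G.b d' \<otimes>\<^bsub>G.A\<^esub> m"] h(2) s t(1,2) by (simp add: G.b_mult G.A.A.m_assoc)
    also have "\<dots> = G.b (s' \<otimes>\<^bsub>D\<^esub> t) \<otimes>\<^bsub>G.A\<^esub> (G.b d \<otimes>\<^bsub>G.A\<^esub> m)"
      unfolding eq using move_b[of t s' "G.b d \<otimes>\<^bsub>G.A\<^esub> m"] h(1) d t(1,2)
      by (simp add: G.b_mult G.A.A.m_assoc)
    finally show "W.lift s' (\<lambda>t. t) (\<lambda>m. G.b d' \<otimes>\<^bsub>G.A\<^esub> m) P = W.lift s (\<lambda>t. t) (\<lambda>m. G.b d \<otimes>\<^bsub>G.A\<^esub> m) P"
      unfolding t(3) lift_b_cls[OF h(1,2) t(1,2)] lift_b_cls[OF s d t(1,2)]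
      by (intro W.cls_eqI) (use h(1,2) s d t(1,2) in simp_all)
  qed
qed

lemma op_closed:
  "P \<in> carrier DS \<Longrightarrow> opB P \<in> carrier E"
  "\<beta> \<in> Field \<alpha> \<Longrightarrow> opX \<beta> \<in> carrier E"
  "\<beta> \<in> Field \<alpha> \<Longrightarrow> opY \<beta> \<in> carrier E"
  by (auto simp: opB_frac opX_def opY_def W.lift_end semilinear_b semilinear_X semilinear_Y elim!: DS_carrierE)

lemma op_cls:
  assumes "t \<in> S" "m \<in> carrier G.A"
  shows "\<lbrakk>s \<in> S; d \<in> carrier D\<rbrakk> \<Longrightarrow> opB (fr s d) (W.cls t m) = W.cls (s \<otimes>\<^bsub>D\<^esub> t) (G.b d \<otimes>\<^bsub>G.A\<^esub> m)"
    and "\<beta> \<in> Field \<alpha> \<Longrightarrow> opX \<beta> (W.cls t m) = W.cls (\<sigma> \<beta> t) (G.X \<beta> \<otimes>\<^bsub>G.A\<^esub> m)"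
    and "\<beta> \<in> Field \<alpha> \<Longrightarrow> opY \<beta> (W.cls t m) = W.cls (\<sigma>' \<beta> t) (G.Y \<beta> \<otimes>\<^bsub>G.A\<^esub> m)"
  using assms by (simp_all add: opB_frac lift_b_cls opX_def opY_def W.lift_cls semilinear_X semilinear_Y)

lemma E_eqI:
  assumes "f \<in> carrier E" "g \<in> carrier E"
    and "\<And>t m. \<lbrakk>t \<in> S; m \<in> carrier G.A; W.cls t m \<in> carrier W.M\<rbrakk> \<Longrightarrow> f (W.cls t m) = g (W.cls t m)"
  shows "f = g"
proof (rule end_algebra_eqI[OF assms(1,2)])
  fix P assume P: "P \<in> carrier W.M"
  then obtain t m where "t \<in> S" "m \<in> carrier G.A" "P = W.cls t m" by (auto elim: W.M_carrierE)
  with P show "f P = g P" using assms(3) by blast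
qed

text \<open>Operators agree once they agree on the classes \<open>W.cls t m\<close>. There the
  multiplicative relations split into the corresponding relation of \<A>, applied to the numerator,
  and an identity between denominators, such as commutation of the automorphisms.\<close>

lemma action:
  obtains h where "h \<in> k_algebra_hom K L.A E" "\<And>P. P \<in> carrier DS \<Longrightarrow> h (L.b P) = opB P"
    "\<And>\<beta>. \<beta> \<in> Field \<alpha> \<Longrightarrow> h (L.X \<beta>) = opX \<beta>" "\<And>\<beta>. \<beta> \<in> Field \<alpha> \<Longrightarrow> h (L.Y \<beta>) = opY \<beta>"
proof -
  interpret E: k_algebra K E by (rule E_k_algebra)
  have [simp]: "s \<in> S \<Longrightarrow> m \<in> carrier G.A \<Longrightarrow> W.cls s m \<in> carrier W.M" for s m
    using W.cls_closed by simp
  note simps = op_closed op_cls end_algebra_simps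
  note DS_closed = L.D_add L.D_mult L.D_one L.D_smult L.\<sigma>_closed L.\<sigma>_inv_closed L.a_closed
  show thesis
  proof (rule L.universal_property[OF E_k_algebra, of opB opX opY])
    fix P Q assume PQ: "P \<in> carrier DS" "Q \<in> carrier DS"
    show "opB (P \<oplus>\<^bsub>DS\<^esub> Q) = opB P \<oplus>\<^bsub>E\<^esub> opB Q"
    proof (rule E_eqI)
      fix t m assume t: "t \<in> S" "m \<in> carrier G.A"
      obtain s d e where s: "s \<in> S" "d \<in> carrier D" "e \<in> carrier D" "P = fr s d" "Q = fr s e"
        using PQ by (rule DS_common_denominatorE)
      then show "opB (P \<oplus>\<^bsub>DS\<^esub> Q) (W.cls t m) = (opB P \<oplus>\<^bsub>E\<^esub> opB Q) (W.cls t m)"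
        using t by (simp add: simps DS_add W.M_add G.b_add G.A.A.l_distr)
    qed (use PQ in \<open>simp_all add: op_closed DS_closed\<close>)
    show "opB (P \<otimes>\<^bsub>DS\<^esub> Q) = opB P \<otimes>\<^bsub>E\<^esub> opB Q"
    proof (rule E_eqI)
      fix t m assume t: "t \<in> S" "m \<in> carrier G.A"
      obtain s d s' e where s: "s \<in> S" "d \<in> carrier D" "P = fr s d" "s' \<in> S" "e \<in> carrier D" "Q = fr s' e"
        using PQ by (metis DS_carrierE)
      then show "opB (P \<otimes>\<^bsub>DS\<^esub> Q) (W.cls t m) = (opB P \<otimes>\<^bsub>E\<^esub> opB Q) (W.cls t m)"
        using t by (simp add: simps DS_mult G.b_mult G.A.A.m_assoc A.m_assoc)
    qed (use PQ in \<open>simp_all add: op_closed DS_closed\<close>)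
  next
    show "opB \<one>\<^bsub>DS\<^esub> = \<one>\<^bsub>E\<^esub>"
      by (rule E_eqI) (simp_all add: op_closed DS_closed, simp add: DS_one simps G.b_one)
  next
    fix c P assume c: "c \<in> carrier K" and P: "P \<in> carrier DS"
    show "opB (c \<odot>\<^bsub>DS\<^esub> P) = c \<odot>\<^bsub>E\<^esub> opB P"
    proof (rule E_eqI)
      fix t m assume t: "t \<in> S" "m \<in> carrier G.A"
      obtain s d where s: "s \<in> S" "d \<in> carrier D" "P = fr s d" using P by (rule DS_carrierE)
      then show "opB (c \<odot>\<^bsub>DS\<^esub> P) (W.cls t m) = (c \<odot>\<^bsub>E\<^esub> opB P) (W.cls t m)"
        using t c by (simp add: simps DS_smult W.M_smult G.b_smult G.A.smult_mult_left)
    qed (use c P in \<open>simp_all add: op_closed DS_closed\<close>)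
  next
    fix \<beta> P assume \<beta>: "\<beta> \<in> Field \<alpha>" and P: "P \<in> carrier DS"
    obtain s d where s: "s \<in> S" "d \<in> carrier D" "P = fr s d" using P by (rule DS_carrierE)
    show "opX \<beta> \<otimes>\<^bsub>E\<^esub> opB P = opB (loc_map D S (\<sigma> \<beta>) P) \<otimes>\<^bsub>E\<^esub> opX \<beta>"
      by (rule E_eqI) (use \<beta> P s in \<open>simp_all add: op_closed DS_closed\<close>,
        simp add: simps loc_map_frac \<sigma>_hom move_X)
    show "opY \<beta> \<otimes>\<^bsub>E\<^esub> opB P = opB (inv_into (carrier DS) (loc_map D S (\<sigma> \<beta>)) P) \<otimes>\<^bsub>E\<^esub> opY \<beta>"
      by (rule E_eqI) (use \<beta> P s in \<open>simp_all add: op_closed DS_closed\<close>,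
        simp add: simps loc_map_inv_frac \<sigma>'_hom move_Y)
  next
    fix \<beta> \<gamma> assume \<beta>: "\<beta> \<in> Field \<alpha>" "\<gamma> \<in> Field \<alpha>" "\<beta> \<noteq> \<gamma>"
    show "opX \<beta> \<otimes>\<^bsub>E\<^esub> opX \<gamma> = opX \<gamma> \<otimes>\<^bsub>E\<^esub> opX \<beta>"
      by (rule E_eqI) (use \<beta> in \<open>simp_all add: op_closed\<close>,
        simp add: simps commuting[of \<beta> \<gamma>] G.X_X flip: G.A.A.m_assoc)
    show "opY \<beta> \<otimes>\<^bsub>E\<^esub> opY \<gamma> = opY \<gamma> \<otimes>\<^bsub>E\<^esub> opY \<beta>"
      by (rule E_eqI) (use \<beta> in \<open>simp_all add: op_closed\<close>,
        simp add: simps \<sigma>'_commute[of \<beta> \<gamma>] G.Y_Y flip: G.A.A.m_assoc)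
    show "opX \<beta> \<otimes>\<^bsub>E\<^esub> opY \<gamma> = opY \<gamma> \<otimes>\<^bsub>E\<^esub> opX \<beta>"
      by (rule E_eqI) (use \<beta> in \<open>simp_all add: op_closed\<close>,
        simp add: simps \<sigma>_\<sigma>'_commute G.X_Y flip: G.A.A.m_assoc)
  next
    fix \<beta> assume \<beta>: "\<beta> \<in> Field \<alpha>"
    have e: "loc_embed D S (a \<beta>) = fr \<one>\<^bsub>D\<^esub> (a \<beta>)" by (simp add: loc_embed_def)
    show "opY \<beta> \<otimes>\<^bsub>E\<^esub> opX \<beta> = opB (loc_embed D S (a \<beta>))"
      unfolding e
      by (rule E_eqI) (use \<beta> in \<open>simp_all add: op_closed\<close>,
        simp add: simps G.Y_X_a flip: G.A.A.m_assoc)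
    show "opX \<beta> \<otimes>\<^bsub>E\<^esub> opY \<beta> = opB (loc_map D S (\<sigma> \<beta>) (loc_embed D S (a \<beta>)))"
      unfolding e
      by (rule E_eqI) (use \<beta> in \<open>simp_all add: op_closed loc_map_frac \<sigma>_hom\<close>,
        simp add: simps G.X_Y_a flip: G.A.A.m_assoc)
  qed (simp_all add: op_closed that)
qed

text \<open>The class of the unit serves as test vector. If \<open>\<phi> r\<close> vanishes, the
  class of \<open>r\<close> with denominator one is zero, and equality of classes means equality
  after multiplication by some \<open>u \<in> S\<close>.\<close>

lemma kernel_torsion:
  assumes \<phi>: "\<phi> \<in> k_algebra_hom K G.A L.A" "\<And>d. d \<in> carrier D \<Longrightarrow> \<phi> (G.b d) = L.b (fr \<one>\<^bsub>D\<^esub> d)"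
      "\<And>\<beta>. \<beta> \<in> Field \<alpha> \<Longrightarrow> \<phi> (G.X \<beta>) = L.X \<beta>" "\<And>\<beta>. \<beta> \<in> Field \<alpha> \<Longrightarrow> \<phi> (G.Y \<beta>) = L.Y \<beta>"
    and r: "r \<in> carrier G.A" "\<phi> r = \<zero>\<^bsub>L.A\<^esub>"
  shows "\<exists>s\<in>S. G.b s \<otimes>\<^bsub>G.A\<^esub> r = \<zero>\<^bsub>G.A\<^esub>"
proof (rule action)
  fix h
  assume h: "h \<in> k_algebra_hom K L.A E" "\<And>P. P \<in> carrier DS \<Longrightarrow> h (L.b P) = opB P"
    "\<And>\<beta>. \<beta> \<in> Field \<alpha> \<Longrightarrow> h (L.X \<beta>) = opX \<beta>" "\<And>\<beta>. \<beta> \<in> Field \<alpha> \<Longrightarrow> h (L.Y \<beta>) = opY \<beta>"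
  have [simp]: "s \<in> S \<Longrightarrow> m \<in> carrier G.A \<Longrightarrow> W.cls s m \<in> carrier W.M" for s m
    using W.cls_closed by simp
  note hom = k_algebra_homD[OF \<phi>(1)] k_algebra_homD[OF h(1)]
  \<comment> \<open>Stated for every \<open>m\<close> so that in a product the first factor can act
    on the output of the second. Denominators remain one because \<open>\<sigma> \<beta>\<close> and
    \<open>\<sigma>' \<beta>\<close> fix the unit.\<close>
  have act: "h (\<phi> q) (W.cls \<one>\<^bsub>D\<^esub> m) = W.cls \<one>\<^bsub>D\<^esub> (q \<otimes>\<^bsub>G.A\<^esub> m)"
    if "q \<in> carrier G.A" "m \<in> carrier G.A" for q m
    using that
  proof (induction q arbitrary: m rule: G.gwa_induct)
    case (base d)
    then show ?case by (simp add: \<phi> h op_cls)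
  next
    case (Xplus \<beta>)
    then show ?case by (simp add: \<phi> h op_cls \<sigma>_hom)
  next
    case (Xminus \<beta>)
    then show ?case by (simp add: \<phi> h op_cls \<sigma>'_hom)
  next
    case (mult p q)
    then show ?case by (simp add: hom end_algebra_simps G.A.A.m_assoc)
  next
    case (add p q)
    then show ?case by (simp add: hom end_algebra_simps G.A.A.l_distr W.M_add)
  next
    case (smult c q)
    then show ?case by (simp add: hom end_algebra_simps G.A.smult_mult_left W.M_smult)
  qed
  have "W.cls \<one>\<^bsub>D\<^esub> r = h (\<phi> r) (W.cls \<one>\<^bsub>D\<^esub> \<one>\<^bsub>G.A\<^esub>)" using act[OF r(1)] r(1) by simp
  also have "\<dots> = \<zero>\<^bsub>W.M\<^esub>"
    unfolding r(2) k_algebra_hom_minus(1)[OF L.A.k_algebra_axioms E_k_algebra h(1)]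
    by (simp add: end_algebra_simps)
  also have "\<dots> = W.cls \<one>\<^bsub>D\<^esub> \<zero>\<^bsub>G.A\<^esub>" using W.M_zero[of "\<one>\<^bsub>D\<^esub>"] by simp
  finally obtain u where "u \<in> S" "G.b u \<otimes>\<^bsub>G.A\<^esub> (G.b \<one>\<^bsub>D\<^esub> \<otimes>\<^bsub>G.A\<^esub> r) =
      G.b u \<otimes>\<^bsub>G.A\<^esub> (G.b \<one>\<^bsub>D\<^esub> \<otimes>\<^bsub>G.A\<^esub> \<zero>\<^bsub>G.A\<^esub>)"
    using r(1) by (subst (asm) W.cls_eq_iff) auto
  then show ?thesis using r(1) by (intro bexI[of _ u]) (simp_all add: G.b_one)
qed

end

section \<open>Recognizing an Ore localization\<close>

text \<open>
  The class of the fraction \<open>s\<^sup>-\<^sup>1 r\<close> is the fibre \<open>{(t, q). \<phi>(t) b = \<phi>(q)}\<close> of the element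
  \<open>b = \<phi>(s)\<^sup>-\<^sup>1 \<phi>(r)\<close>. This yields the well-definedness of the operations on fractions for free.
\<close>

lemma localization_isoI:
  fixes K :: "('k, 'm) ring_scheme" and R :: "('k, 'r, 'p) module_scheme" and B :: "('k, 'b, 'q) module_scheme"
  assumes R: "k_algebra K R" and B: "k_algebra K B" and S: "left_denominator_set R S"
    and \<phi>: "\<phi> \<in> k_algebra_hom K R B"
    and unit: "\<And>s. s \<in> S \<Longrightarrow> \<exists>u\<in>carrier B. u \<otimes>\<^bsub>B\<^esub> \<phi> s = \<one>\<^bsub>B\<^esub> \<and> \<phi> s \<otimes>\<^bsub>B\<^esub> u = \<one>\<^bsub>B\<^esub>"
    and ker: "\<And>r. \<lbrakk>r \<in> carrier R; \<phi> r = \<zero>\<^bsub>B\<^esub>\<rbrakk> \<Longrightarrow> \<exists>s\<in>S. s \<otimes>\<^bsub>R\<^esub> r = \<zero>\<^bsub>R\<^esub>"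
    and surj: "\<And>b. b \<in> carrier B \<Longrightarrow> \<exists>s\<in>S. \<exists>r\<in>carrier R. \<phi> s \<otimes>\<^bsub>B\<^esub> b = \<phi> r"
  shows "\<exists>h. h \<in> k_algebra_iso K (localization R S) B"
proof -
  interpret R: k_algebra K R by fact
  interpret B: k_algebra K B by fact
  note hom = k_algebra_homD[OF \<phi>]
  have S_closed: "s \<in> carrier R" if "s \<in> S" for s
    using S that by (auto simp: left_denominator_set_def dest: submonoid.mem_carrier)
  have S_mult: "s \<otimes>\<^bsub>R\<^esub> t \<in> S" if "s \<in> S" "t \<in> S" for s t
    using S that by (auto simp: left_denominator_set_def dest: submonoid.m_closed)
  have S_one: "\<one>\<^bsub>R\<^esub> \<in> S"
    using S by (auto simp: left_denominator_set_def dest: submonoid.one_closed)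
  have ore: "\<exists>r'\<in>carrier R. \<exists>s'\<in>S. s' \<otimes>\<^bsub>R\<^esub> r = r' \<otimes>\<^bsub>R\<^esub> s" if "r \<in> carrier R" "s \<in> S" for r s
    using S that by (simp add: left_denominator_set_def)
  have cancel: "x = y" if h: "s \<in> S" "x \<in> carrier B" "y \<in> carrier B" "\<phi> s \<otimes>\<^bsub>B\<^esub> x = \<phi> s \<otimes>\<^bsub>B\<^esub> y" for s x y
  proof -
    obtain u where u: "u \<in> carrier B" "u \<otimes>\<^bsub>B\<^esub> \<phi> s = \<one>\<^bsub>B\<^esub>" using unit[OF h(1)] by blast
    have "u \<otimes>\<^bsub>B\<^esub> \<phi> s \<otimes>\<^bsub>B\<^esub> x = u \<otimes>\<^bsub>B\<^esub> \<phi> s \<otimes>\<^bsub>B\<^esub> y"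
      using h u(1) S_closed hom(1) by (simp add: B.A.m_assoc)
    then show ?thesis using u(2) h(2,3) by simp
  qed
  define fib where "fib b = {(t, q). t \<in> S \<and> q \<in> carrier R \<and> \<phi> t \<otimes>\<^bsub>B\<^esub> b = \<phi> q}" for b
  \<comment> \<open>The inclusion into the fibre uses that \<phi> inverts \<open>S\<close>; the
    reverse inclusion uses the Ore condition and the description of the kernel.\<close>
  have frac_fib: "left_frac R S s r = fib b"
    if s: "s \<in> S" and r: "r \<in> carrier R" and b: "b \<in> carrier B" and eq: "\<phi> s \<otimes>\<^bsub>B\<^esub> b = \<phi> r" for s r b
  proof (intro equalityI subrelI)
    fix t q assume "(t, q) \<in> left_frac R S s r"
    then obtain c d where t: "t \<in> S" and q: "q \<in> carrier R" and c: "c \<in> carrier R" and d: "d \<in> carrier R"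
      and cd: "c \<otimes>\<^bsub>R\<^esub> s = d \<otimes>\<^bsub>R\<^esub> t" "c \<otimes>\<^bsub>R\<^esub> s \<in> S" "c \<otimes>\<^bsub>R\<^esub> r = d \<otimes>\<^bsub>R\<^esub> q"
      by (auto simp: left_frac_def)
    note closed = S_closed[OF s] S_closed[OF t] r q c d b hom(1)
    \<comment> \<open>The element \<open>u (\<phi> q)\<close> is the value of the fraction
      \<open>t^-1 q\<close>; it is compared with \<open>b\<close> after multiplication by the
      invertible element \<open>\<phi> (c s)\<close>.\<close>
    obtain u where u: "u \<in> carrier B" "\<phi> t \<otimes>\<^bsub>B\<^esub> u = \<one>\<^bsub>B\<^esub>" using unit[OF t] by blast
    have "\<phi> (d \<otimes>\<^bsub>R\<^esub> t) \<otimes>\<^bsub>B\<^esub> (u \<otimes>\<^bsub>B\<^esub> \<phi> q) = \<phi> d \<otimes>\<^bsub>B\<^esub> (\<phi> t \<otimes>\<^bsub>B\<^esub> u) \<otimes>\<^bsub>B\<^esub> \<phi> q"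
      using closed u(1) by (simp add: hom(3) B.A.m_assoc)
    also have "\<dots> = \<phi> (c \<otimes>\<^bsub>R\<^esub> r)" unfolding cd(3) using closed u(2) by (simp add: hom(3))
    also have "\<dots> = \<phi> (c \<otimes>\<^bsub>R\<^esub> s) \<otimes>\<^bsub>B\<^esub> b" using closed by (simp add: hom(3) B.A.m_assoc eq)
    finally have "\<phi> (c \<otimes>\<^bsub>R\<^esub> s) \<otimes>\<^bsub>B\<^esub> (u \<otimes>\<^bsub>B\<^esub> \<phi> q) = \<phi> (c \<otimes>\<^bsub>R\<^esub> s) \<otimes>\<^bsub>B\<^esub> b" unfolding cd(1) .
    then have "u \<otimes>\<^bsub>B\<^esub> \<phi> q = b" using cancel[OF cd(2)] closed u(1) by simp
    then have "\<phi> t \<otimes>\<^bsub>B\<^esub> b = \<phi> t \<otimes>\<^bsub>B\<^esub> u \<otimes>\<^bsub>B\<^esub> \<phi> q" using closed u(1) by (simp add: B.A.m_assoc)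
    then show "(t, q) \<in> fib b" using t q u(2) hom(1) by (simp add: fib_def)
  next
    fix t q assume "(t, q) \<in> fib b"
    then have t: "t \<in> S" and q: "q \<in> carrier R" and tq: "\<phi> t \<otimes>\<^bsub>B\<^esub> b = \<phi> q" by (simp_all add: fib_def)
    note closed = S_closed[OF s] S_closed[OF t] r q b hom(1)
    \<comment> \<open>A common left multiple \<open>s' s = c' t\<close> of the denominators. The
      numerators \<open>s' r\<close> and \<open>c' q\<close> then have the same image under \<phi>,
      and a further factor \<open>u\<close> from the kernel condition makes them equal in
      \<open>R\<close>.\<close>
    obtain c' s' where c': "c' \<in> carrier R" "s' \<in> S" "s' \<otimes>\<^bsub>R\<^esub> s = c' \<otimes>\<^bsub>R\<^esub> t"
      using ore[OF S_closed[OF s] t] by blast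
    note closed = closed c'(1) S_closed[OF c'(2)]
    have "\<phi> (s' \<otimes>\<^bsub>R\<^esub> r) = \<phi> (s' \<otimes>\<^bsub>R\<^esub> s) \<otimes>\<^bsub>B\<^esub> b" using closed by (simp add: hom(3) B.A.m_assoc eq)
    also have "\<dots> = \<phi> (c' \<otimes>\<^bsub>R\<^esub> q)" unfolding c'(3) using closed by (simp add: hom(3) B.A.m_assoc tq)
    finally have "\<phi> (s' \<otimes>\<^bsub>R\<^esub> r) = \<phi> (c' \<otimes>\<^bsub>R\<^esub> q)" .
    moreover have "\<phi> (s' \<otimes>\<^bsub>R\<^esub> r \<ominus>\<^bsub>R\<^esub> c' \<otimes>\<^bsub>R\<^esub> q) = \<phi> (s' \<otimes>\<^bsub>R\<^esub> r) \<ominus>\<^bsub>B\<^esub> \<phi> (c' \<otimes>\<^bsub>R\<^esub> q)"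
      using closed by (intro k_algebra_hom_minus(2)[OF R B \<phi>]) simp_all
    ultimately have "\<phi> (s' \<otimes>\<^bsub>R\<^esub> r \<ominus>\<^bsub>R\<^esub> c' \<otimes>\<^bsub>R\<^esub> q) = \<zero>\<^bsub>B\<^esub>"
      using closed by (simp add: a_minus_def B.M.r_neg)
    moreover have "s' \<otimes>\<^bsub>R\<^esub> r \<ominus>\<^bsub>R\<^esub> c' \<otimes>\<^bsub>R\<^esub> q \<in> carrier R" using closed by simp
    ultimately obtain u where u: "u \<in> S" "u \<otimes>\<^bsub>R\<^esub> (s' \<otimes>\<^bsub>R\<^esub> r \<ominus>\<^bsub>R\<^esub> c' \<otimes>\<^bsub>R\<^esub> q) = \<zero>\<^bsub>R\<^esub>"
      using ker by blast
    note closed = closed S_closed[OF u(1)]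
    have "u \<otimes>\<^bsub>R\<^esub> s' \<otimes>\<^bsub>R\<^esub> r \<ominus>\<^bsub>R\<^esub> u \<otimes>\<^bsub>R\<^esub> c' \<otimes>\<^bsub>R\<^esub> q = \<zero>\<^bsub>R\<^esub>"
      using u(2) closed by (simp add: a_minus_def R.A.r_distr R.A.r_minus R.A.m_assoc)
    then have "u \<otimes>\<^bsub>R\<^esub> s' \<otimes>\<^bsub>R\<^esub> r = u \<otimes>\<^bsub>R\<^esub> c' \<otimes>\<^bsub>R\<^esub> q"
      by (rule R.M.minus_eq_zeroD[rotated 2]) (use closed in simp_all)
    moreover have "u \<otimes>\<^bsub>R\<^esub> s' \<otimes>\<^bsub>R\<^esub> s = u \<otimes>\<^bsub>R\<^esub> c' \<otimes>\<^bsub>R\<^esub> t" 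
      by (simp add: R.A.m_assoc[OF S_closed[OF u(1)] S_closed[OF c'(2)] S_closed[OF s]]
          R.A.m_assoc[OF S_closed[OF u(1)] c'(1) S_closed[OF t]] c'(3))
    moreover have "u \<otimes>\<^bsub>R\<^esub> s' \<otimes>\<^bsub>R\<^esub> s \<in> S" using u(1) c'(2) s by (intro S_mult)
    moreover have "u \<otimes>\<^bsub>R\<^esub> s' \<in> carrier R" "u \<otimes>\<^bsub>R\<^esub> c' \<in> carrier R" using closed by simp_all
    ultimately show "(t, q) \<in> left_frac R S s r"
      unfolding left_frac_def using t q by blast
  qed
  have fib_nonempty: "\<exists>s r. s \<in> S \<and> r \<in> carrier R \<and> \<phi> s \<otimes>\<^bsub>B\<^esub> b = \<phi> r \<and> (s, r) \<in> fib b"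
    if "b \<in> carrier B" for b
    using surj[OF that] by (auto simp: fib_def)
  have fib_inj: "b = b'" if h: "b \<in> carrier B" "b' \<in> carrier B" "fib b = fib b'" for b b'
  proof -
    obtain s r where "s \<in> S" "\<phi> s \<otimes>\<^bsub>B\<^esub> b = \<phi> r" "(s, r) \<in> fib b'"
      using fib_nonempty[OF h(1)] h(3) by auto
    then show ?thesis using cancel h(1,2) by (simp add: fib_def)
  qed
  let ?L = "localization R S"
  have carrier: "carrier ?L = fib ` carrier B"
  proof (intro equalityI subsetI)
    fix P assume "P \<in> carrier ?L"
    then obtain s r where s: "s \<in> S" and r: "r \<in> carrier R" and P: "P = left_frac R S s r"
      by (auto simp: localization_def)
    obtain u where u: "u \<in> carrier B" "\<phi> s \<otimes>\<^bsub>B\<^esub> u = \<one>\<^bsub>B\<^esub>" using unit[OF s] by blast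
    have "\<phi> s \<otimes>\<^bsub>B\<^esub> (u \<otimes>\<^bsub>B\<^esub> \<phi> r) = \<phi> s \<otimes>\<^bsub>B\<^esub> u \<otimes>\<^bsub>B\<^esub> \<phi> r"
      using s r u(1) S_closed hom(1) by (simp add: B.A.m_assoc)
    then have "P = fib (u \<otimes>\<^bsub>B\<^esub> \<phi> r)" unfolding P using s r u hom(1) by (intro frac_fib) simp_all
    then show "P \<in> fib ` carrier B" using u(1) r hom(1) by auto
  next
    fix P assume "P \<in> fib ` carrier B"
    then obtain b where b: "b \<in> carrier B" "P = fib b" by blast
    obtain s r where s: "s \<in> S" "r \<in> carrier R" "\<phi> s \<otimes>\<^bsub>B\<^esub> b = \<phi> r"
      using fib_nonempty[OF b(1)] by blast
    have "P = left_frac R S s r" unfolding b(2) using frac_fib[OF s(1,2) b(1) s(3)] by simp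
    then show "P \<in> carrier ?L" using s(1,2) by (auto simp: localization_def)
  qed
  have mult: "fib b \<otimes>\<^bsub>?L\<^esub> fib b' = fib (b \<otimes>\<^bsub>B\<^esub> b')" if b: "b \<in> carrier B" "b' \<in> carrier B" for b b'
    unfolding localization_def monoid.simps
  proof (rule Union_eqI, goal_cases)
    case 1
    obtain s r t q where s: "(s, r) \<in> fib b" "(t, q) \<in> fib b'" using fib_nonempty b by metis
    then obtain c u where "c \<in> carrier R" "u \<in> S" "u \<otimes>\<^bsub>R\<^esub> r = c \<otimes>\<^bsub>R\<^esub> t"
      using ore[of r t] by (auto simp: fib_def)
    with s show ?case by blast
  next
    case (2 Z)
    then obtain s r t q u c where Z: "Z = left_frac R S (u \<otimes>\<^bsub>R\<^esub> s) (c \<otimes>\<^bsub>R\<^esub> q)"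
      and m: "(s, r) \<in> fib b" "(t, q) \<in> fib b'" and u: "u \<in> S" "c \<in> carrier R" "u \<otimes>\<^bsub>R\<^esub> r = c \<otimes>\<^bsub>R\<^esub> t"
      by blast
    have s: "s \<in> S" "r \<in> carrier R" "\<phi> s \<otimes>\<^bsub>B\<^esub> b = \<phi> r" and t: "t \<in> S" "q \<in> carrier R" "\<phi> t \<otimes>\<^bsub>B\<^esub> b' = \<phi> q"
      using m by (simp_all add: fib_def)
    note closed = S_closed[OF s(1)] s(2) S_closed[OF t(1)] t(2) S_closed[OF u(1)] u(2) b hom(1)
    have "\<phi> (u \<otimes>\<^bsub>R\<^esub> s) \<otimes>\<^bsub>B\<^esub> (b \<otimes>\<^bsub>B\<^esub> b') = \<phi> u \<otimes>\<^bsub>B\<^esub> (\<phi> s \<otimes>\<^bsub>B\<^esub> b) \<otimes>\<^bsub>B\<^esub> b'"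
      using closed by (simp add: hom(3) B.A.m_assoc)
    also have "\<dots> = \<phi> (u \<otimes>\<^bsub>R\<^esub> r) \<otimes>\<^bsub>B\<^esub> b'" unfolding s(3) using closed by (simp add: hom(3))
    also have "\<dots> = \<phi> (c \<otimes>\<^bsub>R\<^esub> q)" unfolding u(3) using closed by (simp add: hom(3) B.A.m_assoc t(3))
    finally show ?case unfolding Z using closed S_mult[OF u(1) s(1)] by (intro frac_fib) simp_all
  qed
  have add: "fib b \<oplus>\<^bsub>?L\<^esub> fib b' = fib (b \<oplus>\<^bsub>B\<^esub> b')" if b: "b \<in> carrier B" "b' \<in> carrier B" for b b'
    unfolding localization_def ring.simps
  proof (rule Union_eqI, goal_cases)
    case 1
    obtain s r t q where s: "(s, r) \<in> fib b" "(t, q) \<in> fib b'" using fib_nonempty b by metis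
    then have "s \<in> S" "t \<in> S" by (simp_all add: fib_def)
    then obtain d c where "d \<in> carrier R" "c \<in> S" "c \<otimes>\<^bsub>R\<^esub> s = d \<otimes>\<^bsub>R\<^esub> t" "c \<otimes>\<^bsub>R\<^esub> s \<in> S" "c \<in> carrier R"
      using ore[of s t] S_closed S_mult by blast
    with s show ?case by blast
  next
    case (2 Z)
    then obtain s r t q c d where Z: "Z = left_frac R S (c \<otimes>\<^bsub>R\<^esub> s) (c \<otimes>\<^bsub>R\<^esub> r \<oplus>\<^bsub>R\<^esub> d \<otimes>\<^bsub>R\<^esub> q)"
      and m: "(s, r) \<in> fib b" "(t, q) \<in> fib b'" and c: "c \<in> carrier R" "d \<in> carrier R"
      and eq: "c \<otimes>\<^bsub>R\<^esub> s = d \<otimes>\<^bsub>R\<^esub> t" "c \<otimes>\<^bsub>R\<^esub> s \<in> S"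
      by blast
    have s: "s \<in> S" "r \<in> carrier R" "\<phi> s \<otimes>\<^bsub>B\<^esub> b = \<phi> r" and t: "t \<in> S" "q \<in> carrier R" "\<phi> t \<otimes>\<^bsub>B\<^esub> b' = \<phi> q"
      using m by (simp_all add: fib_def)
    note closed = S_closed[OF s(1)] s(2) S_closed[OF t(1)] t(2) c b hom(1)
    have "\<phi> (c \<otimes>\<^bsub>R\<^esub> s) \<otimes>\<^bsub>B\<^esub> (b \<oplus>\<^bsub>B\<^esub> b') = \<phi> (c \<otimes>\<^bsub>R\<^esub> s) \<otimes>\<^bsub>B\<^esub> b \<oplus>\<^bsub>B\<^esub> \<phi> (d \<otimes>\<^bsub>R\<^esub> t) \<otimes>\<^bsub>B\<^esub> b'"
      unfolding eq(1)[symmetric] using closed by (simp add: B.A.r_distr)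
    also have "\<dots> = \<phi> (c \<otimes>\<^bsub>R\<^esub> r \<oplus>\<^bsub>R\<^esub> d \<otimes>\<^bsub>R\<^esub> q)"
      using closed by (simp add: hom(2,3) B.A.m_assoc s(3) t(3))
    finally show ?case unfolding Z using closed eq(2) by (intro frac_fib) simp_all
  qed
  have smult: "k \<odot>\<^bsub>?L\<^esub> fib b = fib (k \<odot>\<^bsub>B\<^esub> b)" if k: "k \<in> carrier K" and b: "b \<in> carrier B" for k b
    unfolding localization_def module.simps
  proof (rule Union_eqI, goal_cases)
    case 1
    then show ?case using fib_nonempty[OF b] by blast
  next
    case (2 Z)
    then obtain s r where Z: "Z = left_frac R S s (k \<odot>\<^bsub>R\<^esub> r)" and "(s, r) \<in> fib b" by blast
    then have s: "s \<in> S" "r \<in> carrier R" "\<phi> s \<otimes>\<^bsub>B\<^esub> b = \<phi> r" by (simp_all add: fib_def)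
    then show ?case unfolding Z using k b S_closed hom(1)
      by (intro frac_fib) (simp_all add: B.smult_mult_right hom(5))
  qed
  have one: "\<one>\<^bsub>?L\<^esub> = fib \<one>\<^bsub>B\<^esub>"
    using frac_fib[OF S_one R.A.one_closed B.A.one_closed] hom(4) by (simp add: localization_def)
  have inj: "inj_on fib (carrier B)" using fib_inj by (rule inj_onI)
  \<comment> \<open>Fibres determine the elements they belong to, so \<open>fib\<close> is a
    bijection that already respects all operations; the isomorphism is its inverse.\<close>
  define h where "h = inv_into (carrier B) fib"
  have h: "h (fib b) = b" if "b \<in> carrier B" for b
    using that inj by (simp add: h_def)
  have "h \<in> ring_hom ?L B"
    by (rule ring_hom_memI) (auto simp: carrier h mult add one)
  moreover have "bij_betw h (carrier ?L) (carrier B)"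
    unfolding h_def carrier using inj by (intro bij_betw_inv_into) (simp add: bij_betw_def)
  moreover have "h (k \<odot>\<^bsub>?L\<^esub> P) = k \<odot>\<^bsub>B\<^esub> h P" if "k \<in> carrier K" "P \<in> carrier ?L" for k P
    using that by (auto simp: carrier h smult)
  ultimately show ?thesis by (auto simp: k_algebra_iso_def ring_iso_def)
qed

section \<open>Verification of the recognition criterion for the comparison map\<close>

context gwa_localization
begin

abbreviation "S\<^sub>A \<equiv> G.b ` S"

lemma S\<^sub>A_submonoid: "submonoid S\<^sub>A G.A"
  by (rule submonoid.intro) (auto simp flip: G.b_mult G.b_one)

lemma right_denominators: "right_denominator_set G.A S\<^sub>A"
  unfolding right_denominator_set_def
proof (intro conjI ballI impI S\<^sub>A_submonoid)
  fix r s assume r: "r \<in> carrier G.A" and "s \<in> S\<^sub>A"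
  then obtain t where t: "t \<in> S" "s = G.b t" by blast
  show "\<exists>r'\<in>carrier G.A. \<exists>s'\<in>S\<^sub>A. r \<otimes>\<^bsub>G.A\<^esub> s' = s \<otimes>\<^bsub>G.A\<^esub> r'"
    using right_ore[OF r t(1)] t(2) by blast
  show "\<exists>s'\<in>S\<^sub>A. r \<otimes>\<^bsub>G.A\<^esub> s' = \<zero>\<^bsub>G.A\<^esub>" if "s \<otimes>\<^bsub>G.A\<^esub> r = \<zero>\<^bsub>G.A\<^esub>"
    using right_reversible[OF r t(1)] t(2) that by blast
qed

text \<open>Induction over the generators of the target: a base element \<open>s^-1 d\<close>
  becomes \<open>d\<close> after multiplication by \<open>s\<close>, and the other letters are
  already values of \<phi>.\<close>

lemma fraction:
  assumes \<phi>: "\<phi> \<in> k_algebra_hom K G.A L.A" "\<And>d. d \<in> carrier D \<Longrightarrow> \<phi> (G.b d) = L.b (fr \<one>\<^bsub>D\<^esub> d)"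
      "\<And>\<beta>. \<beta> \<in> Field \<alpha> \<Longrightarrow> \<phi> (G.X \<beta>) = L.X \<beta>" "\<And>\<beta>. \<beta> \<in> Field \<alpha> \<Longrightarrow> \<phi> (G.Y \<beta>) = L.Y \<beta>"
    and x: "x \<in> carrier L.A"
  shows "\<exists>s\<in>S. \<exists>r\<in>carrier G.A. \<phi> (G.b s) \<otimes>\<^bsub>L.A\<^esub> x = \<phi> r"
  using x
proof (induction x rule: L.gwa_induct)
  case (base P)
  then obtain s d where s: "s \<in> S" "d \<in> carrier D" "P = fr s d" by (rule DS_carrierE)
  have "fr \<one>\<^bsub>D\<^esub> s \<otimes>\<^bsub>DS\<^esub> fr s d = fr \<one>\<^bsub>D\<^esub> d"
    using s frac_cancel[of "\<one>\<^bsub>D\<^esub>" s d] by (simp add: DS_mult)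
  then have "\<phi> (G.b s) \<otimes>\<^bsub>L.A\<^esub> L.b P = \<phi> (G.b d)" using s by (simp add: \<phi> flip: L.b_mult)
  then show ?case using s by (intro bexI[of _ s] bexI[of _ "G.b d"]) simp_all
next
  case (Xplus \<beta>)
  then show ?case
    using k_algebra_homD(4)[OF \<phi>(1)]
    by (intro bexI[of _ "\<one>\<^bsub>D\<^esub>"] bexI[of _ "G.X \<beta>"]) (simp_all add: G.b_one \<phi>)
next
  case (Xminus \<beta>)
  then show ?case
    using k_algebra_homD(4)[OF \<phi>(1)]
    by (intro bexI[of _ "\<one>\<^bsub>D\<^esub>"] bexI[of _ "G.Y \<beta>"]) (simp_all add: G.b_one \<phi>)
next
  case (mult x y)
  note hom = k_algebra_homD[OF \<phi>(1)]
  obtain s r where s: "s \<in> S" "r \<in> carrier G.A" "\<phi> (G.b s) \<otimes>\<^bsub>L.A\<^esub> x = \<phi> r" using mult by blast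
  obtain t q where t: "t \<in> S" "q \<in> carrier G.A" "\<phi> (G.b t) \<otimes>\<^bsub>L.A\<^esub> y = \<phi> q" using mult by blast
  \<comment> \<open>The denominator \<open>t\<close> of the second factor has to pass the numerator
    \<open>r\<close> of the first, which is the left Ore condition in \<A>.\<close>
  obtain u c where u: "u \<in> S" "c \<in> carrier G.A" "G.b u \<otimes>\<^bsub>G.A\<^esub> r = c \<otimes>\<^bsub>G.A\<^esub> G.b t"
    using left_ore[OF s(2) t(1)] by blast
  have "\<phi> (G.b (u \<otimes>\<^bsub>D\<^esub> s)) \<otimes>\<^bsub>L.A\<^esub> (x \<otimes>\<^bsub>L.A\<^esub> y) = \<phi> (G.b u) \<otimes>\<^bsub>L.A\<^esub> (\<phi> (G.b s) \<otimes>\<^bsub>L.A\<^esub> x) \<otimes>\<^bsub>L.A\<^esub> y"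
    using s(1) u(1) mult.hyps by (simp add: G.b_mult hom(1,3) L.A.A.m_assoc)
  also have "\<dots> = \<phi> (G.b u \<otimes>\<^bsub>G.A\<^esub> r) \<otimes>\<^bsub>L.A\<^esub> y" unfolding s(3) using s(2) u(1) by (simp add: hom(3))
  also have "\<dots> = \<phi> (c \<otimes>\<^bsub>G.A\<^esub> q)"
    unfolding u(3) using t u(2) mult.hyps by (simp add: hom(1,3) L.A.A.m_assoc)
  finally show ?case using s(1) t(2) u by (intro bexI[of _ "u \<otimes>\<^bsub>D\<^esub> s"] bexI[of _ "c \<otimes>\<^bsub>G.A\<^esub> q"]) simp_all
next
  case (add x y)
  note hom = k_algebra_homD[OF \<phi>(1)]
  obtain s r where s: "s \<in> S" "r \<in> carrier G.A" "\<phi> (G.b s) \<otimes>\<^bsub>L.A\<^esub> x = \<phi> r" using add by blast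
  obtain t q where t: "t \<in> S" "q \<in> carrier G.A" "\<phi> (G.b t) \<otimes>\<^bsub>L.A\<^esub> y = \<phi> q" using add by blast
  have "\<phi> (G.b (t \<otimes>\<^bsub>D\<^esub> s)) \<otimes>\<^bsub>L.A\<^esub> x = \<phi> (G.b t \<otimes>\<^bsub>G.A\<^esub> r)"
    using s t(1) add.hyps by (simp add: G.b_mult hom(1,3) L.A.A.m_assoc)
  moreover have "\<phi> (G.b (t \<otimes>\<^bsub>D\<^esub> s)) \<otimes>\<^bsub>L.A\<^esub> y = \<phi> (G.b s \<otimes>\<^bsub>G.A\<^esub> q)"
    using s(1) t add.hyps by (simp add: S_central[of t s] G.b_mult hom(1,3) L.A.A.m_assoc)
  ultimately have "\<phi> (G.b (t \<otimes>\<^bsub>D\<^esub> s)) \<otimes>\<^bsub>L.A\<^esub> (x \<oplus>\<^bsub>L.A\<^esub> y) = \<phi> (G.b t \<otimes>\<^bsub>G.A\<^esub> r \<oplus>\<^bsub>G.A\<^esub> G.b s \<otimes>\<^bsub>G.A\<^esub> q)"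
    using s(1,2) t(1,2) add.hyps by (simp add: L.A.A.r_distr hom(1,2))
  then show ?case using s(1,2) t(1,2)
    by (intro bexI[of _ "t \<otimes>\<^bsub>D\<^esub> s"] bexI[of _ "G.b t \<otimes>\<^bsub>G.A\<^esub> r \<oplus>\<^bsub>G.A\<^esub> G.b s \<otimes>\<^bsub>G.A\<^esub> q"]) simp_all
next
  case (smult c x)
  note hom = k_algebra_homD[OF \<phi>(1)]
  obtain s r where s: "s \<in> S" "r \<in> carrier G.A" "\<phi> (G.b s) \<otimes>\<^bsub>L.A\<^esub> x = \<phi> r" using smult by blast
  then have "\<phi> (G.b s) \<otimes>\<^bsub>L.A\<^esub> (c \<odot>\<^bsub>L.A\<^esub> x) = \<phi> (c \<odot>\<^bsub>G.A\<^esub> r)"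
    using smult.hyps by (simp add: hom(1,5) L.A.smult_mult_right)
  then show ?case using s(1,2) smult.hyps by blast
qed

text \<open>Both parts are drawn from one comparison map \<phi>: its kernel gives left
  reversibility, which in turn is part of what the recognition criterion requires.\<close>

lemma left_denominators_and_iso:
  "left_denominator_set G.A S\<^sub>A \<and> (\<exists>h. h \<in> k_algebra_iso K (localization G.A S\<^sub>A) L.A)"
proof (rule localization_hom)
  fix \<phi>
  assume \<phi>: "\<phi> \<in> k_algebra_hom K G.A L.A" "\<And>d. d \<in> carrier D \<Longrightarrow> \<phi> (G.b d) = L.b (fr \<one>\<^bsub>D\<^esub> d)"
    "\<And>\<beta>. \<beta> \<in> Field \<alpha> \<Longrightarrow> \<phi> (G.X \<beta>) = L.X \<beta>" "\<And>\<beta>. \<beta> \<in> Field \<alpha> \<Longrightarrow> \<phi> (G.Y \<beta>) = L.Y \<beta>"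
  note hom = k_algebra_homD[OF \<phi>(1)]
  have unit: "\<exists>u\<in>carrier L.A. u \<otimes>\<^bsub>L.A\<^esub> \<phi> (G.b s) = \<one>\<^bsub>L.A\<^esub> \<and> \<phi> (G.b s) \<otimes>\<^bsub>L.A\<^esub> u = \<one>\<^bsub>L.A\<^esub>"
    if s: "s \<in> S" for s
  proof -
    \<comment> \<open>The inverse of \<open>s\<close> is the fraction with denominator
      \<open>s\<close> and numerator one.\<close>
    have "fr s \<one>\<^bsub>D\<^esub> \<otimes>\<^bsub>DS\<^esub> fr \<one>\<^bsub>D\<^esub> s = \<one>\<^bsub>DS\<^esub>" "fr \<one>\<^bsub>D\<^esub> s \<otimes>\<^bsub>DS\<^esub> fr s \<one>\<^bsub>D\<^esub> = \<one>\<^bsub>DS\<^esub>"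
      using s by (simp_all add: DS_mult DS_one frac_eq_iff)
    then show ?thesis using s
      by (intro bexI[of _ "L.b (fr s \<one>\<^bsub>D\<^esub>)"]) (simp_all add: \<phi>(2) L.b_one flip: L.b_mult)
  qed
  have reversible: "\<exists>s'\<in>S. G.b s' \<otimes>\<^bsub>G.A\<^esub> r = \<zero>\<^bsub>G.A\<^esub>"
    if r: "r \<in> carrier G.A" and s: "s \<in> S" and rs: "r \<otimes>\<^bsub>G.A\<^esub> G.b s = \<zero>\<^bsub>G.A\<^esub>" for r s
  proof -
    obtain u where u: "u \<in> carrier L.A" "\<phi> (G.b s) \<otimes>\<^bsub>L.A\<^esub> u = \<one>\<^bsub>L.A\<^esub>" using unit[OF s] by blast
    \<comment> \<open>Invertibility of \<open>\<phi> (G.b s)\<close> turns an annihilator on the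
      right into membership of \<open>r\<close> in the kernel, where annihilators on the left are
      available.\<close>
    have "\<phi> r = \<phi> (r \<otimes>\<^bsub>G.A\<^esub> G.b s) \<otimes>\<^bsub>L.A\<^esub> u"
      using r s u by (simp add: hom(1,3) L.A.A.m_assoc)
    also have "\<dots> = \<zero>\<^bsub>L.A\<^esub>"
      unfolding rs k_algebra_hom_minus(1)[OF G.A.k_algebra_axioms L.A.k_algebra_axioms \<phi>(1)]
      using u(1) by simp
    finally show ?thesis using kernel_torsion[OF \<phi> r] by blast
  qed
  have left: "left_denominator_set G.A S\<^sub>A"
    unfolding left_denominator_set_def
  proof (intro conjI ballI impI S\<^sub>A_submonoid)
    fix r s assume r: "r \<in> carrier G.A" and "s \<in> S\<^sub>A"
    then obtain t where t: "t \<in> S" "s = G.b t" by blast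
    show "\<exists>r'\<in>carrier G.A. \<exists>s'\<in>S\<^sub>A. s' \<otimes>\<^bsub>G.A\<^esub> r = r' \<otimes>\<^bsub>G.A\<^esub> s"
      using left_ore[OF r t(1)] t(2) by blast
    show "\<exists>s'\<in>S\<^sub>A. s' \<otimes>\<^bsub>G.A\<^esub> r = \<zero>\<^bsub>G.A\<^esub>" if "r \<otimes>\<^bsub>G.A\<^esub> s = \<zero>\<^bsub>G.A\<^esub>"
      using reversible[OF r t(1)] t(2) that by blast
  qed
  moreover have "\<exists>h. h \<in> k_algebra_iso K (localization G.A S\<^sub>A) L.A"
  proof (rule localization_isoI[OF G.A.k_algebra_axioms L.A.k_algebra_axioms left \<phi>(1)])
    fix s assume "s \<in> S\<^sub>A"
    then show "\<exists>u\<in>carrier L.A. u \<otimes>\<^bsub>L.A\<^esub> \<phi> s = \<one>\<^bsub>L.A\<^esub> \<and> \<phi> s \<otimes>\<^bsub>L.A\<^esub> u = \<one>\<^bsub>L.A\<^esub>"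
      using unit by blast
  next
    fix r assume r: "r \<in> carrier G.A" "\<phi> r = \<zero>\<^bsub>L.A\<^esub>"
    show "\<exists>s\<in>S\<^sub>A. s \<otimes>\<^bsub>G.A\<^esub> r = \<zero>\<^bsub>G.A\<^esub>" using kernel_torsion[OF \<phi> r] by blast
  next
    fix x assume x: "x \<in> carrier L.A"
    show "\<exists>s\<in>S\<^sub>A. \<exists>r\<in>carrier G.A. \<phi> s \<otimes>\<^bsub>L.A\<^esub> x = \<phi> r"
      using fraction[OF \<phi> x] by blast
  qed
  ultimately show ?thesis by blast
qed

end

theorem theorem6p12:
  fixes K :: "('k, 'm) ring_scheme" and D :: "('k, 'd, 'p) module_scheme"
    and \<alpha> :: "'i rel" and \<sigma> :: "'i \<Rightarrow> 'd \<Rightarrow> 'd" and a :: "'i \<Rightarrow> 'd" and S :: "'d set"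
  assumes "gwa_data K D \<alpha> \<sigma> a"
    and "submonoid S D"
    and "S \<subseteq> ring_center D"
    and "\<forall>s \<in> S. regular_element D s"
    and "\<forall>\<beta> \<in> Field \<alpha>. \<forall>j :: int. aut_pow D (\<sigma> \<beta>) j ` S \<subseteq> S"
  defines "\<A> \<equiv> gwa K D \<alpha> \<sigma> a"
    and "S\<^sub>\<A> \<equiv> gwa_base K D \<alpha> \<sigma> a ` S"
    and "\<AA> \<equiv> gwa K (localization D S) \<alpha> (\<lambda>\<beta>. loc_map D S (\<sigma> \<beta>)) (\<lambda>\<beta>. loc_embed D S (a \<beta>))"
  shows "left_denominator_set \<A> S\<^sub>\<A> \<and> right_denominator_set \<A> S\<^sub>\<A> \<and>
    (\<exists>h. h \<in> k_algebra_iso K (localization \<A> S\<^sub>\<A>) \<AA>)"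
proof -
  interpret gwa_localization K D \<alpha> \<sigma> a S
    by (intro gwa_localization.intro gwa_localization_axioms.intro assms(1-5))
  show ?thesis
    unfolding \<A>_def S\<^sub>\<A>_def \<AA>_def using left_denominators_and_iso right_denominators by blast
qed

end
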